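(* Let $d\ge 1$ and let $\Delta\subset\mathbb{R}^d$ be a lattice simplex of dimension $d$ which is not a lattice pyramid, and whose $\delta$-polynomial equals $1+t^{i_1}+\cdots+t^{i_{V-1}}$ with $2\le V\le 4$ and integers $1\le i_1\le\cdots\le i_{V-1}\le d$, where $(i_1,\ldots,i_{V-1})$ satisfies: if $V=2$, $i_1\le\lfloor (d+1)/2\rfloor$; if $V=3$, $2i_1\ge i_2$ and $i_2\le\lfloor (d+1)/2\rfloor$; if $V=4$, $i_3\le i_1+i_2$, $i_1+i_3\le d+1$, $i_2\le\lfloor(d+1)/2\rfloor$, and ($2i_2\le i_1+i_3$ or $i_2+i_3\le d+1$). Write $\mathbf{e}_1,\ldots,\mathbf{e}_d$ for the standard unit vectors and $\mathbf{0}$ for the origin. Then, up to unimodular equivalence, there are exactly the following $5$ possibilities for $\Delta$ (each being the convex hull of the listed vertices, and occurring under the listed condition): <ol> <li>$V=2$: $\Delta^{(2)}$, where $d=2i_1-1$, with vertices $\mathbf{0},\mathbf{e}_1,\ldots,\mathbf{e}_{d-1},\ \mathbf{e}_1+\cdots+\mathbf{e}_{d-1}+2\mathbf{e}_d$.</li> <li>$V=3$: $\Delta^{(3)}$, where $d=i_1+i_2-1$, with vertices $\mathbf{0},\mathbf{e}_1,\ldots,\mathbf{e}_{d-1}$ and $2\sum_{i=1,\,i\ne d}^{-i_1+2i_2-1}\mathbf{e}_i+\sum_{i=-i_1+2i_2}^{d-1}\mathbf{e}_i+3\mathbf{e}_d$.</li> <li>$V=4$: one of <ul> <li>$\Delta^{(4)}_1$,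 where $i_1<i_2<i_3$, $i_1+i_3\ge 2i_2$ and $d=i_1+i_3-1$, with vertices $\mathbf{0},\mathbf{e}_1,\ldots,\mathbf{e}_{d-1}$ and $2\sum_{i=1}^{i_1-2i_2+i_3}\mathbf{e}_i+\sum_{i=i_1-2i_2+i_3+1,\,i\ne d}^{2i_1-i_2}\mathbf{e}_i+3\sum_{i=2i_1-i_2+1}^{d-1}\mathbf{e}_i+4\mathbf{e}_d$;</li> <li>$\Delta^{(4)}_2$, where $d=i_2+i_3-1$, with vertices $\mathbf{0},\mathbf{e}_1,\ldots,\mathbf{e}_{d-1}$ and $2\sum_{i=1}^{-2i_1+i_2+i_3}\mathbf{e}_i+\sum_{i=-2i_1+i_2+i_3+1,\,i\ne d}^{-i_1+2i_2}\mathbf{e}_i+3\sum_{i=-i_1+2i_2+1}^{d-1}\mathbf{e}_i+4\mathbf{e}_d$;</li> <li>$\Delta^{(4)}_3$, where $d=i_1+i_2+i_3-1$, with vertices $\mathbf{0},\mathbf{e}_1,\ldots,\mathbf{e}_{d-2}$, $\sum_{i=-i_1+i_2+i_3}^{d-2}\mathbf{e}_i+2\mathbf{e}_{d-1}$ and $\sum_{i=1}^{-i_1+i_2+i_3-1}\mathbf{e}_i+\sum_{i=2i_3-1}^{d-2}\mathbf{e}_i+2\mathbf{e}_d$.</li> </ul></li> </ol> (Empty sums are zero.)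
   Context: A lattice polytope is a convex polytope whose vertices lie in $\mathbb{Z}^d$. For a $d$-dimensional lattice polytope $\mathcal{P}\subset\mathbb{R}^d$, its $\delta$-polynomial is $\delta(\mathcal{P},t)=(1-t)^{d+1}\bigl[1+\sum_{n\ge1}|n\mathcal{P}\cap\mathbb{Z}^d|\,t^n\bigr]$, a polynomial of degree at most $d$; the sum of its coefficients is the normalized volume $\mathrm{Vol}(\mathcal{P})$. Two lattice polytopes $\mathcal{P}\subset\mathbb{R}^d$, $\mathcal{Q}\subset\mathbb{R}^e$ are unimodularly equivalent if there is an affine map $\mathrm{aff}(\mathcal{P})\to\mathrm{aff}(\mathcal{Q})$ mapping $\mathbb{Z}^d\cap\mathrm{aff}(\mathcal{P})$ bijectively onto $\mathbb{Z}^e\cap\mathrm{aff}(\mathcal{Q})$ and $\mathcal{P}$ onto $\mathcal{Q}$. For a $d$-dimensional lattice polytope $\mathcal{Q}\subset\mathbb{R}^d$, the lattice pyramid over it is $\mathrm{Pyr}(\mathcal{Q})=\mathrm{conv}(\mathcal{Q}\times\{0\},(0,\ldots,0,1))\subset\mathbb{R}^{d+1}$; a lattice polytope is called a lattice pyramid if it is unimodularly equivalent to $\mathrm{Pyr}(\mathcal{Q})$ for some lower-dimensional lattice polytope $\mathcal{Q}$. *)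

theory Defs
  imports
    "HOL-Analysis.Analysis"
    "HOL-Library.Function_Algebras"
    "HOL-Computational_Algebra.Polynomial_FPS"
begin

(* Points of all the spaces R^d live in the single real vector space nat => real (pointwise
   operations), so that the dimension d can be quantified over and the library's convex hull,
   affine hull, extreme points etc. are available. *)

instantiation "fun" :: (type, scaleR) scaleR
begin
definition scaleR_fun_def: "scaleR (c :: real) f = (\<lambda>x. c *\<^sub>R f x)"
instance ..
end

instance "fun" :: (type, real_vector) real_vector
  by standard (simp_all add: scaleR_fun_def fun_eq_iff algebra_simps)

type_synonym point = "nat \<Rightarrow> real"

(* Coordinates are numbered 1, ..., d and all others vanish; hence euclid d is literally the
   subspace R^d x {0} of euclid (d + 1). *)
definition euclid :: "nat \<Rightarrow> point set" where
  "euclid d = {x. \<forall>k. k \<notin> {1..d} \<longrightarrow> x k = 0}"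

definition int_lattice :: "nat \<Rightarrow> point set" where
  "int_lattice d = {x \<in> euclid d. \<forall>k. x k \<in> \<int>}"

definition unit_vec :: "nat \<Rightarrow> point" where
  "unit_vec k = (\<lambda>j. if j = k then 1 else 0)"

definition lattice_polytope :: "nat \<Rightarrow> point set \<Rightarrow> bool" where
  "lattice_polytope d P \<longleftrightarrow>
     polytope P \<and> P \<subseteq> euclid d \<and> {v. v extreme_point_of P} \<subseteq> int_lattice d"

definition full_dimensional :: "nat \<Rightarrow> point set \<Rightarrow> bool" where
  "full_dimensional d P \<longleftrightarrow> affine hull P = euclid d"

(* The library's simplex predicate has exactly this definition, but requires class
   euclidean_space, of which nat => real is not an instance. *)
definition is_simplex :: "nat \<Rightarrow> point set \<Rightarrow> bool" where
  "is_simplex n S \<longleftrightarrow> (\<exists>C. \<not> affine_dependent C \<and> card C = n + 1 \<and> S = convex hull C)"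

(* The delta-polynomial, kept in the ring of formal power series in which its defining product
   is formed. *)
definition delta :: "nat \<Rightarrow> point set \<Rightarrow> int fps" where
  "delta d P = (1 - fps_X) ^ (d + 1) *
     Abs_fps (\<lambda>n. if n = 0 then 1 else int (card ((\<lambda>x. real n *\<^sub>R x) ` P \<inter> int_lattice d)))"

definition affine_map_on :: "point set \<Rightarrow> (point \<Rightarrow> point) \<Rightarrow> bool" where
  "affine_map_on S f \<longleftrightarrow> (\<exists>L c. linear L \<and> (\<forall>x\<in>S. f x = L x + c))"

definition unimodularly_equivalent :: "nat \<Rightarrow> point set \<Rightarrow> nat \<Rightarrow> point set \<Rightarrow> bool" where
  "unimodularly_equivalent d P e Q \<longleftrightarrow>
     (\<exists>f. affine_map_on (affine hull P) f \<and> f ` (affine hull P) \<subseteq> affine hull Q \<and>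
          bij_betw f (int_lattice d \<inter> affine hull P) (int_lattice e \<inter> affine hull Q) \<and> f ` P = Q)"

(* The factor {0} in Q x {0} is invisible because of the convention in euclid. *)
definition Pyr :: "nat \<Rightarrow> point set \<Rightarrow> point set" where
  "Pyr e Q = convex hull (Q \<union> {unit_vec (e + 1)})"

(* A full-dimensional P in R^d can only be equivalent to Pyr e Q with e = d - 1, so Q is
   automatically of lower dimension. *)
definition lattice_pyramid :: "nat \<Rightarrow> point set \<Rightarrow> bool" where
  "lattice_pyramid d P \<longleftrightarrow>
     (\<exists>e Q. lattice_polytope e Q \<and> full_dimensional e Q \<and>
            unimodularly_equivalent d P (e + 1) (Pyr e Q))"

definition nonpyramidal_simplex :: "nat \<Rightarrow> int poly \<Rightarrow> point set \<Rightarrow> bool" where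
  "nonpyramidal_simplex d p \<Delta> \<longleftrightarrow>
     lattice_polytope d \<Delta> \<and> is_simplex d \<Delta> \<and> \<not> lattice_pyramid d \<Delta> \<and>
     delta d \<Delta> = fps_of_poly p"

datatype family = F2 | F3 | F4_1 | F4_2 | F4_3

fun occurs :: "family \<Rightarrow> nat \<Rightarrow> nat \<Rightarrow> (nat \<Rightarrow> nat) \<Rightarrow> bool" where
  "occurs F2 V d i \<longleftrightarrow> V = 2 \<and> d + 1 = 2 * i 1"
| "occurs F3 V d i \<longleftrightarrow> V = 3 \<and> d + 1 = i 1 + i 2"
| "occurs F4_1 V d i \<longleftrightarrow>
     V = 4 \<and> i 1 < i 2 \<and> i 2 < i 3 \<and> 2 * i 2 \<le> i 1 + i 3 \<and> d + 1 = i 1 + i 3"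
| "occurs F4_2 V d i \<longleftrightarrow> V = 4 \<and> d + 1 = i 2 + i 3"
| "occurs F4_3 V d i \<longleftrightarrow> V = 4 \<and> d + 1 = i 1 + i 2 + i 3"

(* The subtractions are on nat; under the corresponding case of occurs and the inequalities
   assumed for the exponents i none of them truncates. *)
fun vertices :: "family \<Rightarrow> nat \<Rightarrow> (nat \<Rightarrow> nat) \<Rightarrow> point set" where
  "vertices F2 d i =
     {0} \<union> unit_vec ` {1..d - 1} \<union>
     {(\<Sum>k\<in>{1..d - 1}. unit_vec k) + 2 *\<^sub>R unit_vec d}"
| "vertices F3 d i =
     {0} \<union> unit_vec ` {1..d - 1} \<union>
     {2 *\<^sub>R (\<Sum>k\<in>{1..2 * i 2 - i 1 - 1} - {d}. unit_vec k)
      + (\<Sum>k\<in>{2 * i 2 - i 1..d - 1}. unit_vec k)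
      + 3 *\<^sub>R unit_vec d}"
| "vertices F4_1 d i =
     {0} \<union> unit_vec ` {1..d - 1} \<union>
     {2 *\<^sub>R (\<Sum>k\<in>{1..i 1 + i 3 - 2 * i 2}. unit_vec k)
      + (\<Sum>k\<in>{i 1 + i 3 - 2 * i 2 + 1..2 * i 1 - i 2} - {d}. unit_vec k)
      + 3 *\<^sub>R (\<Sum>k\<in>{2 * i 1 - i 2 + 1..d - 1}. unit_vec k)
      + 4 *\<^sub>R unit_vec d}"
| "vertices F4_2 d i =
     {0} \<union> unit_vec ` {1..d - 1} \<union>
     {2 *\<^sub>R (\<Sum>k\<in>{1..i 2 + i 3 - 2 * i 1}. unit_vec k)
      + (\<Sum>k\<in>{i 2 + i 3 - 2 * i 1 + 1..2 * i 2 - i 1} - {d}. unit_vec k)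
      + 3 *\<^sub>R (\<Sum>k\<in>{2 * i 2 - i 1 + 1..d - 1}. unit_vec k)
      + 4 *\<^sub>R unit_vec d}"
| "vertices F4_3 d i =
     {0} \<union> unit_vec ` {1..d - 2} \<union>
     {(\<Sum>k\<in>{i 2 + i 3 - i 1..d - 2}. unit_vec k) + 2 *\<^sub>R unit_vec (d - 1),
      (\<Sum>k\<in>{1..i 2 + i 3 - i 1 - 1}. unit_vec k)
      + (\<Sum>k\<in>{2 * i 3 - 1..d - 2}. unit_vec k)
      + 2 *\<^sub>R unit_vec d}"

end

theory Submission
  imports Defs
begin

text \<open>Write the points of the cone over a lattice simplex in barycentric coordinates with respect to
  its vertices \<open>v\<close>. The coordinate vectors of integral height that yield lattice points form a group
  containing all integral vectors; the quotient by the integral vectors is finite, and its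
  representatives with entries in \<open>[0, 1)\<close> (the box) carry everything that is needed.
  The \<open>\<delta>\<close>-polynomial is the height enumerator of the box, the group determines the simplex up to
  unimodular equivalence, and the simplex is a lattice pyramid iff some coordinate vanishes on the
  whole box. For normalized volume at most 4 the quotient is cyclic or the Klein four-group, so up
  to a permutation of the vertices it is determined by how many coordinates a generator takes to each
  possible value. When no coordinate vanishes, the heights determine these numbers by linear
  equations, and comparing them with the listed simplices gives the classification.\<close>

text \<open>The \<open>\<delta>\<close>-polynomial reveals heights but no group structure:
  enumerating the box by exponents and by multiples of a generator gives two orders related by an
  unknown permutation fixing zero. The inequalities on the exponents cut these cases down to the
  listed ones. The dimension formulas come from inverses. Where a coordinate of an element does not
  vanish, it and that of the inverse add up to 1; a generator vanishes nowhere, so its height and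
  that of its inverse add up to \<open>d + 1\<close>. In the Klein case every vertex takes the value
  1/2 on exactly two of the three nonzero elements, so all three heights add up to
  \<open>d + 1\<close>. The harder half of the pyramid criterion is that a vanishing coordinate
  produces a pyramid, since a base of one dimension less must be exhibited. Explicit simplices with
  prescribed coordinate numerators (types) are built for this, and the same construction gives the
  listed vertices: a coefficient of the last vertex is minus the type modulo the group order (for
  the Klein group, two vertices carry parities), and the type of the origin is what makes heights
  integral.\<close>

section \<open>Coordinate spaces, integer points and the standard basis\<close>

lemma sum_apply_fun: "(\<Sum>i\<in>A. f i) x = (\<Sum>i\<in>A. f i x)"
  by (induction A rule: infinite_finite_induct) auto

lemma scaleR_apply [simp]: "(c *\<^sub>R (x :: point)) k = c * x k"
  by (simp add: scaleR_fun_def)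

lemma lincomb_apply: "(\<Sum>i\<in>A. l i *\<^sub>R (v i :: point)) k = (\<Sum>i\<in>A. l i * v i k)"
  by (simp add: sum_apply_fun)

lemma unit_vec_apply: "unit_vec k j = (if j = k then 1 else 0)"
  by (simp add: unit_vec_def)

lemma sum_unit_vec: "finite A \<Longrightarrow> (\<Sum>k\<in>A. unit_vec k) j = (if j \<in> A then 1 else 0)"
  by (simp add: sum_apply_fun unit_vec_apply)

lemma euclid_zero: "x \<in> euclid d \<Longrightarrow> k \<notin> {1..d} \<Longrightarrow> x k = 0"
  by (auto simp: euclid_def)

lemma subspace_euclid: "subspace (euclid d)"
  by (auto simp: subspace_def euclid_def)

lemma int_lattice_euclid: "x \<in> int_lattice d \<Longrightarrow> x \<in> euclid d"
  by (simp add: int_lattice_def)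

lemma int_lattice_add: "x \<in> int_lattice d \<Longrightarrow> y \<in> int_lattice d \<Longrightarrow> x + y \<in> int_lattice d"
  and int_lattice_diff: "x \<in> int_lattice d \<Longrightarrow> y \<in> int_lattice d \<Longrightarrow> x - y \<in> int_lattice d"
  by (auto simp: int_lattice_def euclid_def)

lemma int_lattice_scale: "r \<in> \<int> \<Longrightarrow> x \<in> int_lattice d \<Longrightarrow> r *\<^sub>R x \<in> int_lattice d"
  by (auto simp: int_lattice_def euclid_def)

lemma int_lattice_sum: "(\<And>i. i \<in> A \<Longrightarrow> f i \<in> int_lattice d) \<Longrightarrow> sum f A \<in> int_lattice d"
  by (induction A rule: infinite_finite_induct) (auto simp: int_lattice_add, auto simp: int_lattice_def euclid_def)

text \<open>Such a point is given by \<open>d\<close> integers from a bounded range. Finiteness of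
  the box of a simplex rests on this.\<close>

lemma finite_int_lattice_box: "finite {x \<in> int_lattice d. \<forall>k. \<bar>x k\<bar> \<le> M}"
proof (rule finite_subset)
  let ?S = "{1..d} \<rightarrow>\<^sub>E (of_int ` {-\<lceil>M\<rceil>..\<lceil>M\<rceil>} :: real set)"
  show "finite ((\<lambda>f k. if k \<in> {1..d} then f k else 0) ` ?S)"
    by (intro finite_imageI finite_PiE) auto
  show "{x \<in> int_lattice d. \<forall>k. \<bar>x k\<bar> \<le> M} \<subseteq> (\<lambda>f k. if k \<in> {1..d} then f k else 0) ` ?S"
  proof
    fix x assume x: "x \<in> {x \<in> int_lattice d. \<forall>k. \<bar>x k\<bar> \<le> M}"
    have "x k \<in> of_int ` {-\<lceil>M\<rceil>..\<lceil>M\<rceil>}" for k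
    proof -
      obtain n where n: "x k = of_int n"
        using x unfolding int_lattice_def by (blast elim: Ints_cases)
      moreover have "\<bar>x k\<bar> \<le> M" using x by auto
      ultimately have "n \<in> {-\<lceil>M\<rceil>..\<lceil>M\<rceil>}" by (auto simp: abs_le_iff) linarith+
      with n show ?thesis by auto
    qed
    then have "restrict x {1..d} \<in> ?S" by auto
    moreover have "x = (\<lambda>k. if k \<in> {1..d} then restrict x {1..d} k else 0)"
      using x by (auto simp: int_lattice_def euclid_def fun_eq_iff)
    ultimately show "x \<in> (\<lambda>f k. if k \<in> {1..d} then f k else 0) ` ?S" by blast
  qed
qed

lemma inj_unit_vec: "inj unit_vec"
proof (rule injI)
  fix j k assume "unit_vec j = unit_vec k"
  then have "unit_vec j j = unit_vec k j" by simp
  then show "j = k" by (simp add: unit_vec_def split: if_splits)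
qed

lemma unit_vec_in_int_lattice: "k \<in> {1..d} \<Longrightarrow> unit_vec k \<in> int_lattice d"
  by (auto simp: int_lattice_def euclid_def unit_vec_def)

lemma span_unit_vec: "span (unit_vec ` {1..d}) = euclid d"
proof
  show "span (unit_vec ` {1..d}) \<subseteq> euclid d"
    by (rule span_minimal[OF _ subspace_euclid]) (auto simp: euclid_def unit_vec_def)
  show "euclid d \<subseteq> span (unit_vec ` {1..d})"
  proof
    fix x assume x: "x \<in> euclid d"
    have "(\<Sum>k\<in>{1..d}. x k *\<^sub>R unit_vec k) \<in> span (unit_vec ` {1..d})"
      by (intro span_sum span_scale span_base) auto
    moreover have "(\<Sum>k\<in>{1..d}. x k *\<^sub>R unit_vec k) j = x j" for j
      using euclid_zero[OF x, of j]
      by (cases "j \<in> {1..d}")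
        (auto simp: lincomb_apply unit_vec_apply if_distrib[of "(*) _"] cong: if_cong)
    then have "x = (\<Sum>k\<in>{1..d}. x k *\<^sub>R unit_vec k)" by auto
    ultimately show "x \<in> span (unit_vec ` {1..d})" by simp
  qed
qed

section \<open>Barycentric coordinates of lattice simplices\<close>

text \<open>The vertices form an indexed family, not a set, so that simplices over different index
  sets can be compared along a bijection of indices. The clause \<open>indep\<close> is affine
  independence expressed through coefficients.\<close>

locale lattice_simplex =
  fixes d :: nat and I :: "'a set" and v :: "'a \<Rightarrow> point"
  assumes fin: "finite I" and card_I: "card I = d + 1"
    and vertex: "i \<in> I \<Longrightarrow> v i \<in> int_lattice d"
    and indep: "sum l I = 0 \<Longrightarrow> (\<Sum>i\<in>I. l i *\<^sub>R v i) = 0 \<Longrightarrow> i \<in> I \<Longrightarrow> l i = 0"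
begin

lemma nonempty: "I \<noteq> {}"
  using card_I by auto

lemma coords_unique:
  assumes "sum l I = sum l' I" "(\<Sum>i\<in>I. l i *\<^sub>R v i) = (\<Sum>i\<in>I. l' i *\<^sub>R v i)" "i \<in> I"
  shows "l i = l' i"
  using indep[of "\<lambda>i. l i - l' i" i] assms by (simp add: sum_subtractf scaleR_diff_left)

lemma inj: "inj_on v I"
proof (rule inj_onI)
  fix a b assume ab: "a \<in> I" "b \<in> I" "v a = v b"
  let ?e = "\<lambda>c i. if i = c then 1 else 0 :: real"
  have e: "(\<Sum>i\<in>I. ?e c i *\<^sub>R v i) = v c" if "c \<in> I" for c
    using that fin by (simp add: if_distrib[of "\<lambda>r. r *\<^sub>R _"] cong: if_cong)
  have "?e a a = ?e b a"
    by (rule coords_unique) (simp_all only: e ab, simp add: ab fin)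
  then show "a = b" by (simp split: if_splits)
qed

lemma sum_vertices: "(\<Sum>x\<in>v ` I. u x) = (\<Sum>i\<in>I. u (v i))"
  by (simp add: sum.reindex inj)

lemma card_vertices: "card (v ` I) = d + 1"
  by (simp add: card_image inj card_I)

lemma not_affine_dependent: "\<not> affine_dependent (v ` I)"
proof
  assume "affine_dependent (v ` I)"
  then obtain U where "sum U (v ` I) = 0" "\<exists>x\<in>v ` I. U x \<noteq> 0" "(\<Sum>x\<in>v ` I. U x *\<^sub>R x) = 0"
    using fin by (auto simp: affine_dependent_explicit_finite)
  then show False
    using indep[of "U \<circ> v"] by (auto simp: sum_vertices)
qed

text \<open>A dimension count: the \<open>d\<close> edge vectors at one vertex are independent
  inside a space spanned by \<open>d\<close> unit vectors, so a point outside their span would yield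
  \<open>d + 1\<close> independent vectors there.\<close>

lemma affine_hull: "affine hull (v ` I) = euclid d"
proof -
  obtain a where a: "a \<in> I" using nonempty by blast
  let ?B = "(\<lambda>x. - v a + x) ` (v ` I - {v a})"
  have ins: "v ` I = insert (v a) (v ` I - {v a})" using a by auto
  have ind: "independent ?B"
    using not_affine_dependent affine_dependent_iff_dependent2[of "v a" "v ` I"] a by auto
  have "card ?B = d"
    using a by (subst card_image) (auto simp: card_vertices fin)
  have sub: "?B \<subseteq> span (unit_vec ` {1..d})"
  proof -
    have "- v a + v i \<in> euclid d" if "i \<in> I" for i
      using vertex[OF a] vertex[OF that] by (auto simp: int_lattice_def euclid_def)
    then show ?thesis unfolding span_unit_vec by blast
  qed
  have "euclid d \<subseteq> span ?B"
  proof
    fix x assume x: "x \<in> euclid d"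
    show "x \<in> span ?B"
    proof (rule ccontr)
      assume nx: "x \<notin> span ?B"
      then have "independent (insert x ?B)"
        using ind by (simp add: independent_insert)
      moreover have "insert x ?B \<subseteq> span (unit_vec ` {1..d})"
        using x sub unfolding span_unit_vec by blast
      ultimately have "card (insert x ?B) \<le> card (unit_vec ` {1..d})"
        by (intro conjunct2[OF independent_span_bound]) simp_all
      moreover have "x \<notin> ?B" using nx span_base[of x ?B] by metis
      ultimately show False
        using \<open>card ?B = d\<close> fin by (simp add: card_image inj_on_subset[OF inj_unit_vec])
    qed
  qed
  moreover have "span ?B \<subseteq> euclid d"
    by (rule span_minimal[OF sub[unfolded span_unit_vec] subspace_euclid])
  ultimately have spB: "span ?B = euclid d" by auto
  have "affine hull (v ` I) = (\<lambda>x. v a + x) ` euclid d"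
    by (subst ins, subst affine_hull_insert_span_gen) (simp only: spB)
  also have "\<dots> = euclid d"
  proof -
    have va: "v a \<in> euclid d" using vertex[OF a] int_lattice_euclid by blast
    have "x \<in> (\<lambda>x. v a + x) ` euclid d" if "x \<in> euclid d" for x
      using that va subspace_diff[OF subspace_euclid] by (intro image_eqI[of _ _ "x - v a"]) auto
    then show ?thesis using va subspace_add[OF subspace_euclid] by auto
  qed
  finally show ?thesis .
qed

lemma coords_exist:
  assumes "x \<in> euclid d"
  obtains l where "sum l I = 1" "(\<Sum>i\<in>I. l i *\<^sub>R v i) = x"
proof -
  have "x \<in> affine hull (v ` I)" using assms affine_hull by simp
  then obtain u where "sum u (v ` I) = 1" "(\<Sum>y\<in>v ` I. u y *\<^sub>R y) = x"
    using fin by (auto simp: affine_hull_finite)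
  then show thesis using that[of "u \<circ> v"] by (simp add: sum_vertices)
qed

lemma lincomb_euclid: "(\<Sum>i\<in>I. l i *\<^sub>R v i) \<in> euclid d"
  by (intro subspace_sum subspace_euclid subspace_scale) (auto intro: vertex int_lattice_euclid)

lemma convex_hull_vertices:
  "convex hull (v ` I) = {\<Sum>i\<in>I. l i *\<^sub>R v i | l. (\<forall>i\<in>I. 0 \<le> l i) \<and> sum l I = 1}"
  (is "_ = ?S")
proof
  show "convex hull (v ` I) \<subseteq> ?S"
  proof
    fix y assume "y \<in> convex hull (v ` I)"
    then obtain u where "\<forall>x\<in>v ` I. 0 \<le> u x" "sum u (v ` I) = 1" "(\<Sum>x\<in>v ` I. u x *\<^sub>R x) = y"
      using fin by (auto simp: convex_hull_finite)
    then show "y \<in> ?S"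
      by (intro CollectI exI[of _ "u \<circ> v"]) (auto simp: sum_vertices)
  qed
  show "?S \<subseteq> convex hull (v ` I)"
    by (auto intro!: convex_sum[OF fin convex_convex_hull] intro: hull_inc)
qed

lemma lattice_polytope: "lattice_polytope d (convex hull (v ` I))"
proof -
  have "convex hull (v ` I) \<subseteq> euclid d"
    using convex_hull_subset_affine_hull affine_hull by blast
  moreover have "{x. x extreme_point_of convex hull (v ` I)} \<subseteq> int_lattice d"
    using extreme_point_of_convex_hull[of _ "v ` I"] vertex by blast
  ultimately show ?thesis
    using fin by (auto simp: lattice_polytope_def polytope_def)
qed

lemma full_dimensional: "full_dimensional d (convex hull (v ` I))"
  by (simp add: full_dimensional_def affine_hull)

lemma is_simplex: "is_simplex d (convex hull (v ` I))"
  unfolding is_simplex_def using not_affine_dependent card_vertices by blast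

text \<open>Coefficients may be negative, which makes this a group. Values outside \<open>I\<close>
  are unconstrained; the box later fixes them to be zero.\<close>

definition coord_lattice :: "('a \<Rightarrow> real) set" where
  "coord_lattice = {l. sum l I \<in> \<int> \<and> (\<Sum>i\<in>I. l i *\<^sub>R v i) \<in> int_lattice d}"

lemma coord_lattice_add:
  "l \<in> coord_lattice \<Longrightarrow> l' \<in> coord_lattice \<Longrightarrow> (\<lambda>i. l i + l' i) \<in> coord_lattice"
  unfolding coord_lattice_def mem_Collect_eq sum.distrib scaleR_add_left
  by (intro conjI Ints_add int_lattice_add) simp_all

lemma coord_lattice_cong:
  assumes "l \<in> coord_lattice" "\<And>i. i \<in> I \<Longrightarrow> l' i - l i \<in> \<int>"
  shows "l' \<in> coord_lattice"
proof -
  from assms(1) have l: "sum l I \<in> \<int>" "(\<Sum>i\<in>I. l i *\<^sub>R v i) \<in> int_lattice d"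
    by (simp_all add: coord_lattice_def)
  have "(\<Sum>i\<in>I. l' i - l i) \<in> \<int>"
    by (intro Ints_sum assms(2))
  from Ints_add[OF l(1) this] have "sum l' I \<in> \<int>"
    by (simp add: sum_subtractf)
  moreover have "(\<Sum>i\<in>I. (l' i - l i) *\<^sub>R v i) \<in> int_lattice d"
    by (intro int_lattice_sum int_lattice_scale assms(2) vertex)
  from int_lattice_add[OF l(2) this] have "(\<Sum>i\<in>I. l' i *\<^sub>R v i) \<in> int_lattice d"
    by (simp add: scaleR_diff_left sum_subtractf)
  ultimately show ?thesis by (simp add: coord_lattice_def)
qed

end

text \<open>Integrality is assumed only of extreme points, but no point of an affinely independent
  set lies in the hull of the others, so every point of \<open>C\<close> is extreme.\<close>

lemma lattice_simplex_obtain: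
  assumes "lattice_polytope d P" "is_simplex d P"
  obtains C where "lattice_simplex d C (\<lambda>x. x)" "P = convex hull C"
proof -
  obtain C where C: "\<not> affine_dependent C" "card C = d + 1" "P = convex hull C"
    using assms(2) by (auto simp: is_simplex_def)
  have fin: "finite C" using C(2) card_ge_0_finite[of C] by simp
  have "x extreme_point_of convex hull C" if "x \<in> C" for x
  proof -
    have "x \<notin> convex hull (C - {x})"
      using C(1) that convex_hull_subset_affine_hull[of "C - {x}"]
      unfolding affine_dependent_def by blast
    then have "x extreme_point_of convex hull (insert x (C - {x}))"
      by (intro extreme_point_of_convex_hull_insert) (simp_all add: fin)
    then show ?thesis using that by (simp add: insert_absorb)
  qed
  then have "C \<subseteq> int_lattice d"
    using assms(1) C(3) by (auto simp: lattice_polytope_def)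
  moreover have "l i = 0" if "sum l C = 0" "(\<Sum>i\<in>C. l i *\<^sub>R i) = 0" "i \<in> C" for l i
    using C(1) that unfolding affine_dependent_explicit_finite[OF fin] by blast
  ultimately have "lattice_simplex d C (\<lambda>x. x)"
    using fin C(2) by (intro lattice_simplex.intro) blast+
  then show thesis using that C(3) by blast
qed

section \<open>Simplices with the same coordinate lattice are equivalent\<close>

text \<open>The affine map taking each \<open>v i\<close> to \<open>w i\<close> preserves
  barycentric coordinates, and whether a point is integral can be read off from its coordinates by
  means of the coordinate lattice alone.\<close>

lemma unimodularly_equivalent_same_coords:
  assumes "lattice_simplex d I v" "lattice_simplex d I w"
    and eq: "lattice_simplex.coord_lattice d I v = lattice_simplex.coord_lattice d I w"
  shows "unimodularly_equivalent d (convex hull (v ` I)) d (convex hull (w ` I))"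
proof -
  interpret V: lattice_simplex d I v by fact
  interpret W: lattice_simplex d I w by fact
  obtain a where a: "a \<in> I" using V.nonempty by blast
  let ?B = "(\<lambda>x. - v a + x) ` (v ` I - {v a})"
  have "independent ?B"
    using V.not_affine_dependent affine_dependent_iff_dependent2[of "v a" "v ` I"] a by blast
  \<comment> \<open>The linear part is prescribed on the edge vectors at \<open>v a\<close>; adding
    \<open>v a\<close> back recovers a vertex, and the inverse of \<open>v\<close> recovers its
    index.\<close>
  from linear_independent_extend[OF this, of "\<lambda>x. w (the_inv_into I v (x + v a)) - w a"]
  obtain L where L: "linear L" "\<And>x. x \<in> ?B \<Longrightarrow> L x = w (the_inv_into I v (x + v a)) - w a"
    by blast
  have Lv: "L (v i) = w i - w a + L (v a)" if i: "i \<in> I" for i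
  proof (cases "v i = v a")
    case True
    then show ?thesis using V.inj a i by (simp add: inj_on_eq_iff)
  next
    case False
    then have "- v a + v i \<in> ?B" using i by blast
    from L(2)[OF this] have "L (- v a + v i) = w i - w a"
      using the_inv_into_f_f[OF V.inj i] by simp
    then have "L (v i) - L (v a) = w i - w a" by (simp add: linear_diff[OF L(1)])
    then show ?thesis by (simp only: diff_eq_eq)
  qed
  \<comment> \<open>The translation is chosen so that \<open>v a\<close> goes to \<open>w a\<close>;
    by \<open>Lv\<close> every \<open>v i\<close> then goes to \<open>w i\<close>.\<close>
  define f where "f x = L x + (w a - L (v a))" for x
  have f: "f (\<Sum>i\<in>I. l i *\<^sub>R v i) = (\<Sum>i\<in>I. l i *\<^sub>R w i)" if l: "sum l I = 1" for l
  proof -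
    have "L (\<Sum>i\<in>I. l i *\<^sub>R v i) = (\<Sum>i\<in>I. l i *\<^sub>R (w i + (L (v a) - w a)))"
      unfolding linear_sum[OF L(1)] linear_scale[OF L(1)]
      by (rule sum.cong) (simp_all add: Lv algebra_simps)
    also have "\<dots> = (\<Sum>i\<in>I. l i *\<^sub>R w i) + (L (v a) - w a)"
      by (simp only: scaleR_add_right sum.distrib flip: scaleR_left.sum) (simp add: l)
    finally show ?thesis by (simp add: f_def)
  qed
  have "affine_map_on (euclid d) f"
    unfolding affine_map_on_def f_def using L(1) by blast
  moreover have "f ` euclid d \<subseteq> euclid d"
  proof
    fix y assume "y \<in> f ` euclid d"
    then obtain x where x: "x \<in> euclid d" "y = f x" by blast
    obtain l where "sum l I = 1" "(\<Sum>i\<in>I. l i *\<^sub>R v i) = x" using V.coords_exist[OF x(1)] .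
    then show "y \<in> euclid d" using f W.lincomb_euclid x(2) by metis
  qed
  moreover have lat: "(\<Sum>i\<in>I. l i *\<^sub>R v i) \<in> int_lattice d \<longleftrightarrow> (\<Sum>i\<in>I. l i *\<^sub>R w i) \<in> int_lattice d"
    if "sum l I = 1" for l
  proof -
    have "l \<in> V.coord_lattice \<longleftrightarrow> l \<in> W.coord_lattice" by (simp only: eq)
    then show ?thesis using that by (simp add: V.coord_lattice_def W.coord_lattice_def)
  qed
  have "bij_betw f (int_lattice d) (int_lattice d)"
  proof (rule bij_betw_imageI)
    show "inj_on f (int_lattice d)"
    proof (rule inj_onI)
      fix x y assume xy: "x \<in> int_lattice d" "y \<in> int_lattice d" "f x = f y"
      obtain l where l: "sum l I = 1" "(\<Sum>i\<in>I. l i *\<^sub>R v i) = x"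
        using V.coords_exist[OF int_lattice_euclid[OF xy(1)]] .
      obtain k where k: "sum k I = 1" "(\<Sum>i\<in>I. k i *\<^sub>R v i) = y"
        using V.coords_exist[OF int_lattice_euclid[OF xy(2)]] .
      have "(\<Sum>i\<in>I. l i *\<^sub>R w i) = (\<Sum>i\<in>I. k i *\<^sub>R w i)"
        using f[OF l(1)] f[OF k(1)] l(2) k(2) xy(3) by simp
      then have "l i = k i" if "i \<in> I" for i
        using W.coords_unique[of l k i] l k that by simp
      then show "x = y" using l(2) k(2) by (metis (no_types, lifting) sum.cong)
    qed
    show "f ` int_lattice d = int_lattice d"
    proof
      show "f ` int_lattice d \<subseteq> int_lattice d"
      proof
        fix y assume "y \<in> f ` int_lattice d"
        then obtain x where x: "x \<in> int_lattice d" "y = f x" by blast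
        obtain l where l: "sum l I = 1" "(\<Sum>i\<in>I. l i *\<^sub>R v i) = x"
          using V.coords_exist[OF int_lattice_euclid[OF x(1)]] .
        show "y \<in> int_lattice d" using lat[OF l(1)] f[OF l(1)] l(2) x by simp
      qed
      show "int_lattice d \<subseteq> f ` int_lattice d"
      proof
        fix y assume y: "y \<in> int_lattice d"
        obtain l where l: "sum l I = 1" "(\<Sum>i\<in>I. l i *\<^sub>R w i) = y"
          using W.coords_exist[OF int_lattice_euclid[OF y]] .
        show "y \<in> f ` int_lattice d" using lat[OF l(1)] f[OF l(1)] l(2) y by (metis imageI)
      qed
    qed
  qed
  moreover have "f ` (convex hull (v ` I)) = convex hull (w ` I)"
  proof
    show "f ` (convex hull (v ` I)) \<subseteq> convex hull (w ` I)"
      unfolding V.convex_hull_vertices W.convex_hull_vertices using f by auto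
    show "convex hull (w ` I) \<subseteq> f ` (convex hull (v ` I))"
    proof
      fix y assume "y \<in> convex hull (w ` I)"
      then obtain l where l: "\<forall>i\<in>I. 0 \<le> l i" "sum l I = 1" "y = (\<Sum>i\<in>I. l i *\<^sub>R w i)"
        unfolding W.convex_hull_vertices by blast
      then have "y = f (\<Sum>i\<in>I. l i *\<^sub>R v i)" using f by simp
      then show "y \<in> f ` (convex hull (v ` I))"
        unfolding V.convex_hull_vertices using l(1,2) by blast
    qed
  qed
  ultimately show ?thesis
    unfolding unimodularly_equivalent_def affine_hull_convex_hull V.affine_hull W.affine_hull
    using int_lattice_euclid by (intro exI[of _ f]) (simp add: Int_absorb2 subset_iff)
qed

context lattice_simplex
begin

lemma lincomb_reindex:
  assumes "bij_betw \<sigma> J I"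
  shows "sum l J = (\<Sum>i\<in>I. l (the_inv_into J \<sigma> i))"
    and "(\<Sum>j\<in>J. l j *\<^sub>R (v \<circ> \<sigma>) j) = (\<Sum>i\<in>I. l (the_inv_into J \<sigma> i) *\<^sub>R v i)"
proof -
  have inv: "the_inv_into J \<sigma> (\<sigma> j) = j" if "j \<in> J" for j
    using assms that by (simp add: bij_betw_def the_inv_into_f_f)
  show "sum l J = (\<Sum>i\<in>I. l (the_inv_into J \<sigma> i))"
    by (subst sum.reindex_bij_betw[OF assms, symmetric]) (simp add: inv)
  show "(\<Sum>j\<in>J. l j *\<^sub>R (v \<circ> \<sigma>) j) = (\<Sum>i\<in>I. l (the_inv_into J \<sigma> i) *\<^sub>R v i)"
    by (subst sum.reindex_bij_betw[OF assms, symmetric]) (simp add: inv)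
qed

lemma lattice_simplex_reindex:
  assumes "bij_betw \<sigma> J I"
  shows "lattice_simplex d J (v \<circ> \<sigma>)"
proof (rule lattice_simplex.intro)
  show "finite J" "card J = d + 1"
    using assms fin card_I bij_betw_finite bij_betw_same_card by metis+
  show "(v \<circ> \<sigma>) j \<in> int_lattice d" if "j \<in> J" for j
    using assms that vertex bij_betwE by fastforce
  show "l j = 0" if "sum l J = 0" "(\<Sum>j\<in>J. l j *\<^sub>R (v \<circ> \<sigma>) j) = 0" "j \<in> J" for l j
    using indep[of "\<lambda>i. l (the_inv_into J \<sigma> i)" "\<sigma> j"] that assms
    by (simp only: lincomb_reindex[OF assms])
      (simp add: bij_betw_def the_inv_into_f_f bij_betw_apply[OF assms])
qed

lemma coord_lattice_reindex:
  assumes "bij_betw \<sigma> J I"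
  shows "l \<in> lattice_simplex.coord_lattice d J (v \<circ> \<sigma>) \<longleftrightarrow> (\<lambda>i. l (the_inv_into J \<sigma> i)) \<in> coord_lattice"
  unfolding lattice_simplex.coord_lattice_def[OF lattice_simplex_reindex[OF assms]] coord_lattice_def
    mem_Collect_eq lincomb_reindex[OF assms] ..

end

text \<open>The number \<open>t i\<close> is the type of the vertex \<open>i\<close>, and \<open>\<psi> c x\<close> is the coordinate of the group element
  \<open>c\<close> at all vertices of type \<open>x\<close>.\<close>

definition char_lattice :: "'a set \<Rightarrow> nat \<Rightarrow> (nat \<Rightarrow> nat \<Rightarrow> real) \<Rightarrow> ('a \<Rightarrow> nat) \<Rightarrow> ('a \<Rightarrow> real) set" where
  "char_lattice I V \<psi> t = {l. \<exists>c<V. \<forall>i\<in>I. l i - \<psi> c (t i) \<in> \<int>}"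

lemma char_lattice_cong: "(\<And>i. i \<in> I \<Longrightarrow> t i = t' i) \<Longrightarrow> char_lattice I V \<psi> t = char_lattice I V \<psi> t'"
  by (simp add: char_lattice_def)

lemma (in lattice_simplex) char_lattice_reindex:
  assumes \<sigma>: "bij_betw \<sigma> J I" and "coord_lattice = char_lattice I V \<psi> t"
  shows "lattice_simplex.coord_lattice d J (v \<circ> \<sigma>) = char_lattice J V \<psi> (t \<circ> \<sigma>)"
proof -
  have "l \<in> lattice_simplex.coord_lattice d J (v \<circ> \<sigma>) \<longleftrightarrow> l \<in> char_lattice J V \<psi> (t \<circ> \<sigma>)" for l
  proof -
    have I: "I = \<sigma> ` J" using \<sigma> by (simp add: bij_betw_def)
    have "(\<forall>i\<in>I. l (the_inv_into J \<sigma> i) - \<psi> c (t i) \<in> \<int>) \<longleftrightarrow> (\<forall>j\<in>J. l j - \<psi> c (t (\<sigma> j)) \<in> \<int>)" for c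
      using \<sigma> unfolding I ball_simps by (simp add: bij_betw_def the_inv_into_f_f)
    then show ?thesis
      by (simp add: coord_lattice_reindex[OF \<sigma>] assms(2) char_lattice_def)
  qed
  then show ?thesis by blast
qed

text \<open>Bijections between corresponding fibres are glued together. This matches vertices by
  type as well as box elements with exponents by height.\<close>

lemma bij_betw_of_fibre_cards:
  assumes "finite I" "finite J" "\<And>x. card {i \<in> I. t i = x} = card {j \<in> J. t' j = x}"
  obtains \<sigma> where "bij_betw \<sigma> I J" "\<And>i. i \<in> I \<Longrightarrow> t' (\<sigma> i) = t i"
proof -
  have "\<exists>\<phi>. bij_betw \<phi> {i \<in> I. t i = x} {j \<in> J. t' j = x}" for x
    using assms by (intro finite_same_card_bij) auto
  then obtain \<phi> where \<phi>: "\<And>x. bij_betw (\<phi> x) {i \<in> I. t i = x} {j \<in> J. t' j = x}" by metis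
  let ?\<sigma> = "\<lambda>i. \<phi> (t i) i"
  have \<sigma>: "?\<sigma> i \<in> J" "t' (?\<sigma> i) = t i" if "i \<in> I" for i
    using bij_betwE[OF \<phi>[of "t i"]] that by auto
  moreover have "bij_betw ?\<sigma> I J"
  proof (rule bij_betw_imageI)
    show "inj_on ?\<sigma> I"
    proof (rule inj_onI)
      fix i k assume ik: "i \<in> I" "k \<in> I" "?\<sigma> i = ?\<sigma> k"
      then have "t i = t k" using \<sigma> by metis
      then show "i = k"
        using bij_betw_imp_inj_on[OF \<phi>[of "t k"]] ik by (auto dest: inj_onD)
    qed
    show "?\<sigma> ` I = J"
    proof
      show "?\<sigma> ` I \<subseteq> J" using \<sigma> by blast
      show "J \<subseteq> ?\<sigma> ` I"
      proof
        fix j assume "j \<in> J"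
        then obtain i where i: "i \<in> I" "t i = t' j" "j = \<phi> (t' j) i"
          using bij_betw_imp_surj_on[OF \<phi>[of "t' j"]] by blast
        then have "j = ?\<sigma> i" by (simp only: i(2))
        then show "j \<in> ?\<sigma> ` I" using i(1) by (rule image_eqI)
      qed
    qed
  qed
  ultimately show thesis using that by blast
qed

text \<open>A type-preserving bijection of the vertices carries one coordinate lattice to the other,
  so only the number of vertices of each type matters.\<close>

lemma unimodularly_equivalent_same_type:
  assumes "lattice_simplex d I v" "lattice_simplex d J w"
    and v: "lattice_simplex.coord_lattice d I v = char_lattice I V \<psi> t"
    and w: "lattice_simplex.coord_lattice d J w = char_lattice J V \<psi> t'"
    and cards: "\<And>x. card {i \<in> I. t i = x} = card {j \<in> J. t' j = x}"
  shows "unimodularly_equivalent d (convex hull (v ` I)) d (convex hull (w ` J))"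
proof -
  interpret V: lattice_simplex d I v by fact
  interpret W: lattice_simplex d J w by fact
  obtain \<sigma> where \<sigma>: "bij_betw \<sigma> I J" "\<And>i. i \<in> I \<Longrightarrow> t' (\<sigma> i) = t i"
    using bij_betw_of_fibre_cards[OF V.fin W.fin cards] by blast
  have "char_lattice I V \<psi> (t' \<circ> \<sigma>) = char_lattice I V \<psi> t"
    by (rule char_lattice_cong) (simp add: \<sigma>)
  then have "unimodularly_equivalent d (convex hull (v ` I)) d (convex hull ((w \<circ> \<sigma>) ` I))"
    by (intro unimodularly_equivalent_same_coords assms(1) W.lattice_simplex_reindex[OF \<sigma>(1)])
      (simp add: v W.char_lattice_reindex[OF \<sigma>(1) w])
  moreover have "(w \<circ> \<sigma>) ` I = w ` J"
    by (subst image_comp[symmetric]) (simp only: bij_betw_imp_surj_on[OF \<sigma>(1)])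
  ultimately show ?thesis by simp
qed

section \<open>The \<open>\<delta>\<close>-polynomial\<close>

text \<open>These are the possible integral parts of the coordinates of a lattice point. Extension
  by zero makes such a function determined by its values on \<open>I\<close>.\<close>

definition weak_compositions :: "'a set \<Rightarrow> nat \<Rightarrow> ('a \<Rightarrow> nat) set" where
  "weak_compositions I n = {f. (\<forall>i. i \<notin> I \<longrightarrow> f i = 0) \<and> sum f I = n}"

text \<open>Pascal's recursion: either the entry at \<open>a\<close> vanishes, or it can be lowered
  by one.\<close>

lemma weak_compositions_insert:
  assumes "finite I" "a \<notin> I"
  shows "weak_compositions (insert a I) 0 = weak_compositions I 0"
    and "weak_compositions (insert a I) (Suc n) =
      weak_compositions I (Suc n) \<union> (\<lambda>f. f(a := Suc (f a))) ` weak_compositions (insert a I) n"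
proof -
  show "weak_compositions (insert a I) 0 = weak_compositions I 0"
    unfolding weak_compositions_def using assms(1) by (intro Collect_cong) (simp, metis)
  have upd: "(\<Sum>x\<in>I. if x = a then y else f x) = sum f I" for f :: "'a \<Rightarrow> nat" and y
    using assms(2) by (intro sum.cong) auto
  show "weak_compositions (insert a I) (Suc n) =
      weak_compositions I (Suc n) \<union> (\<lambda>f. f(a := Suc (f a))) ` weak_compositions (insert a I) n"
    (is "?L = ?R")
  proof
    show "?L \<subseteq> ?R"
    proof
      fix f assume f: "f \<in> ?L"
      show "f \<in> ?R"
      proof (cases "f a")
        case 0
        then have "f \<in> weak_compositions I (Suc n)"
          using f assms unfolding weak_compositions_def by simp metis
        then show ?thesis ..
      next
        case (Suc k)
        then have "f(a := k) \<in> weak_compositions (insert a I) n"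
          using f assms by (auto simp: weak_compositions_def upd)
        moreover have "f = (\<lambda>f. f(a := Suc (f a))) (f(a := k))"
          using Suc by (auto simp: fun_eq_iff)
        ultimately show ?thesis by blast
      qed
    qed
    show "?R \<subseteq> ?L"
      using assms by (auto simp: weak_compositions_def upd)
  qed
qed

lemma finite_weak_compositions:
  assumes "finite I"
  shows "finite (weak_compositions I n)"
  using assms
proof (induction I arbitrary: n)
  case empty
  have "weak_compositions {} n \<subseteq> {\<lambda>_. 0 :: nat}" for n by (auto simp: weak_compositions_def)
  then show ?case using finite_subset by blast
next
  case (insert a I)
  show ?case
    by (induction n) (use insert in \<open>simp_all add: weak_compositions_insert\<close>)
qed

text \<open>By Pascal's recursion each further index divides the generating function by
  \<open>1 - fps_X\<close>.\<close>

lemma weak_compositions_gf: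
  assumes "finite I"
  shows "(1 - fps_X) ^ card I * Abs_fps (\<lambda>n. int (card (weak_compositions I n))) = 1"
  using assms
proof (induction I)
  case empty
  have "weak_compositions ({} :: 'a set) n = (if n = 0 then {\<lambda>_. 0} else {})" for n
    by (auto simp: weak_compositions_def)
  then show ?case by (auto simp: fps_eq_iff)
next
  case (insert a I)
  let ?G = "\<lambda>I. Abs_fps (\<lambda>n. int (card (weak_compositions I n)))"
  have "inj (\<lambda>f. f(a := Suc (f a)))"
  proof (rule injI)
    fix f g :: "'a \<Rightarrow> nat" assume eq: "f(a := Suc (f a)) = g(a := Suc (g a))"
    have "f x = g x" for x using fun_cong[OF eq, of x] by (cases "x = a") auto
    then show "f = g" by blast
  qed
  then have "card (weak_compositions (insert a I) (Suc n)) =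
      card (weak_compositions I (Suc n)) + card (weak_compositions (insert a I) n)" for n
    using insert.hyps finite_weak_compositions[of I] finite_weak_compositions[of "insert a I"]
    by (subst weak_compositions_insert(2), simp, simp, subst card_Un_disjoint)
      (auto simp: weak_compositions_def card_image inj_on_subset)
  then have "(1 - fps_X) * ?G (insert a I) = ?G I"
    using insert.hyps
    by (auto simp: fps_eq_iff left_diff_distrib weak_compositions_insert(1) gr0_conv_Suc
        split: nat.split)
  moreover have "(1 - fps_X) ^ card (insert a I) * ?G (insert a I) =
      (1 - fps_X) ^ card I * ((1 - fps_X) * ?G (insert a I))"
    using insert.hyps by (simp add: mult_ac)
  ultimately show ?case using insert.IH by simp
qed

context lattice_simplex
begin

lemma dilated_vertices:
  "(\<lambda>x. real n *\<^sub>R x) ` (convex hull (v ` I)) =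
    {\<Sum>i\<in>I. l i *\<^sub>R v i | l. (\<forall>i\<in>I. 0 \<le> l i) \<and> sum l I = real n}" (is "?L = ?R")
proof
  show "?L \<subseteq> ?R"
  proof
    fix y assume "y \<in> ?L"
    then obtain l where l: "\<forall>i\<in>I. 0 \<le> l i" "sum l I = 1" "y = real n *\<^sub>R (\<Sum>i\<in>I. l i *\<^sub>R v i)"
      unfolding convex_hull_vertices by blast
    show "y \<in> ?R"
      using l by (intro CollectI exI[of _ "\<lambda>i. real n * l i"])
        (auto simp: scaleR_sum_right sum_distrib_left[symmetric])
  qed
  show "?R \<subseteq> ?L"
  proof
    fix y assume "y \<in> ?R"
    then obtain l where l: "\<forall>i\<in>I. 0 \<le> l i" "sum l I = real n" "y = (\<Sum>i\<in>I. l i *\<^sub>R v i)"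
      by blast
    show "y \<in> ?L"
    proof (cases "n = 0")
      \<comment> \<open>The rescaling by \<open>1 / n\<close> used below is impossible for
        \<open>n = 0\<close>; both sides then consist of the origin.\<close>
      case True
      then have "\<forall>i\<in>I. l i = 0" using l fin by (simp add: sum_nonneg_eq_0_iff)
      then have "y = 0" using l(3) by simp
      moreover have "convex hull (v ` I) \<noteq> {}" using nonempty by simp
      ultimately show ?thesis using True by (auto simp: image_constant_conv)
    next
      case False
      have "(\<Sum>i\<in>I. (l i / real n) *\<^sub>R v i) \<in> convex hull (v ` I)"
        unfolding convex_hull_vertices using l(1,2) False
        by (intro CollectI exI[of _ "\<lambda>i. l i / real n"]) (auto simp: sum_divide_distrib[symmetric])
      moreover have "y = real n *\<^sub>R (\<Sum>i\<in>I. (l i / real n) *\<^sub>R v i)"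
        using False l(3) by (simp add: scaleR_sum_right)
      ultimately show ?thesis by blast
    qed
  qed
qed

lemma lincomb_in_int_lattice_iff:
  "sum l I \<in> \<int> \<Longrightarrow> (\<Sum>i\<in>I. l i *\<^sub>R v i) \<in> int_lattice d \<longleftrightarrow> l \<in> coord_lattice"
  by (simp add: coord_lattice_def)

text \<open>Splitting the coordinates of a lattice point of the cone over the simplex into fractional
  and integral parts shows that the Ehrhart series is the height enumerator of the fractional parts
  times the power series of \<open>1 / (1 - t) ^ (d + 1)\<close>.\<close>

theorem delta_eq_sum_heights:
  assumes "finite X"
    and reps: "\<And>l. l \<in> coord_lattice \<longleftrightarrow> (\<exists>c\<in>X. \<forall>i\<in>I. l i - b c i \<in> \<int>)"
    and range: "\<And>c i. c \<in> X \<Longrightarrow> i \<in> I \<Longrightarrow> 0 \<le> b c i \<and> b c i < (1 :: real)"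
    and distinct: "\<And>c c'. c \<in> X \<Longrightarrow> c' \<in> X \<Longrightarrow> \<forall>i\<in>I. b c i = b c' i \<Longrightarrow> c = c'"
    and height: "\<And>c. c \<in> X \<Longrightarrow> real (h c) = (\<Sum>i\<in>I. b c i)"
  shows "delta d (convex hull (v ` I)) = (\<Sum>c\<in>X. fps_X ^ h c)"
proof -
  let ?A = "\<lambda>n. (\<lambda>x. real n *\<^sub>R x) ` (convex hull (v ` I)) \<inter> int_lattice d"
  \<comment> \<open>A lattice point of the \<open>n\<close>-th dilate is encoded by its fractional
    part \<open>c\<close> and a distribution of the remaining height \<open>n - h c\<close> over the
    vertices.\<close>
  let ?N = "\<lambda>n. SIGMA c:{c \<in> X. h c \<le> n}. weak_compositions I (n - h c)"
  let ?\<phi> = "\<lambda>(c, f). \<Sum>i\<in>I. (b c i + real (f i)) *\<^sub>R v i"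
  have split: "b c i = b c' i \<and> f i = f' i" 
    if "b c i + real (f i) = b c' i + real (f' i)" "c \<in> X" "c' \<in> X" "i \<in> I" for c c' i and f f' :: "'a \<Rightarrow> nat"
  proof -
    have "real (f i) < real (Suc (f' i))" "real (f' i) < real (Suc (f i))"
      using range[of c i] range[of c' i] that by auto
    then have "f i = f' i" unfolding of_nat_less_iff by simp
    then show ?thesis using that by simp
  qed
  have sum_bf: "(\<Sum>i\<in>I. b c i + real (f i)) = real n"
    if "(c, f) \<in> ?N n" for n c f
    using that height[of c] by (auto simp: sum.distrib weak_compositions_def simp flip: of_nat_sum)
  have bij: "bij_betw ?\<phi> (?N n) (?A n)" for n
  proof (rule bij_betw_imageI)
    show "inj_on ?\<phi> (?N n)"
    proof (rule inj_onI)
      fix p q assume "p \<in> ?N n" "q \<in> ?N n" "?\<phi> p = ?\<phi> q"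
      moreover obtain c f where p: "p = (c, f)" by fastforce
      moreover obtain c' f' where q: "q = (c', f')" by fastforce
      ultimately have cf: "(c, f) \<in> ?N n" "(c', f') \<in> ?N n"
        and eq: "(\<Sum>i\<in>I. (b c i + real (f i)) *\<^sub>R v i) = (\<Sum>i\<in>I. (b c' i + real (f' i)) *\<^sub>R v i)"
        by auto
      have "b c i + real (f i) = b c' i + real (f' i)" if "i \<in> I" for i
        by (rule coords_unique[OF _ eq that]) (simp only: sum_bf[OF cf(1)] sum_bf[OF cf(2)])
      then have *: "b c i = b c' i \<and> f i = f' i" if "i \<in> I" for i
        using split cf that by blast
      then have "c = c'" using distinct[of c c'] cf by blast
      moreover have "f i = f' i" for i
        using * cf by (cases "i \<in> I") (auto simp: weak_compositions_def)
      ultimately show "p = q" using p q by auto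
    qed
    show "?\<phi> ` ?N n = ?A n"
    proof
      show "?\<phi> ` ?N n \<subseteq> ?A n"
      proof
        fix y assume "y \<in> ?\<phi> ` ?N n"
        then obtain c f where cf: "(c, f) \<in> ?N n" "y = (\<Sum>i\<in>I. (b c i + real (f i)) *\<^sub>R v i)"
          by auto
        have "y \<in> (\<lambda>x. real n *\<^sub>R x) ` (convex hull (v ` I))"
          unfolding dilated_vertices using cf range sum_bf[OF cf(1)]
          by (intro CollectI exI[of _ "\<lambda>i. b c i + real (f i)"]) (auto intro!: add_nonneg_nonneg)
        moreover have "(\<lambda>i. b c i + real (f i)) \<in> coord_lattice"
          using cf by (subst reps) (intro bexI[of _ c]; auto)
        then have "y \<in> int_lattice d"
          unfolding cf(2) by (subst lincomb_in_int_lattice_iff) (simp_all only: sum_bf[OF cf(1)], simp)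
        ultimately show "y \<in> ?A n" by blast
      qed
      show "?A n \<subseteq> ?\<phi> ` ?N n"
      proof
        fix y assume y: "y \<in> ?A n"
        then obtain l where l: "\<forall>i\<in>I. 0 \<le> l i" "sum l I = real n" "y = (\<Sum>i\<in>I. l i *\<^sub>R v i)"
          unfolding dilated_vertices by blast
        have "l \<in> coord_lattice"
          using lincomb_in_int_lattice_iff[of l] l(2,3) y by simp
        then obtain c where c: "c \<in> X" "\<forall>i\<in>I. l i - b c i \<in> \<int>" using reps by blast
        have "\<exists>m. l i = b c i + real m" if "i \<in> I" for i
        proof -
          obtain z where z: "l i - b c i = of_int z" using c(2) \<open>i \<in> I\<close> Ints_cases by blast
          \<comment> \<open>A nonnegative coordinate minus a number below 1 exceeds -1, so the
            integral part is a natural number.\<close>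
          then have "of_int z > (-1 :: real)" using l(1) range[OF c(1) that] that by force
          then have "l i = b c i + real (nat z)" using z by simp
          then show ?thesis by blast
        qed
        then obtain g where g: "\<And>i. i \<in> I \<Longrightarrow> l i = b c i + real (g i)" by metis
        define f where "f i = (if i \<in> I then g i else 0)" for i
        have f: "l i = b c i + real (f i)" if "i \<in> I" for i using g that by (simp add: f_def)
        have "real n = real (h c) + real (sum f I)"
          using l(2) f height[OF c(1)] by (simp add: sum.distrib)
        then have "n = h c + sum f I" by linarith
        then have "(c, f) \<in> ?N n"
          using c(1) by (auto simp: weak_compositions_def f_def)
        moreover have "y = ?\<phi> (c, f)" using l(3) f by simp
        ultimately show "y \<in> ?\<phi> ` ?N n" by blast
      qed
    qed
  qed
  have card_N: "card (?A n) = (\<Sum>c\<in>X. if n < h c then 0 else card (weak_compositions I (n - h c)))" for n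
  proof -
    have "card (?A n) = card (?N n)" using bij_betw_same_card[OF bij] by simp
    also have "\<dots> = (\<Sum>c\<in>{c \<in> X. h c \<le> n}. card (weak_compositions I (n - h c)))"
      using assms(1) fin by (intro card_SigmaI) (auto simp: finite_weak_compositions)
    also have "\<dots> = (\<Sum>c\<in>X. if n < h c then 0 else card (weak_compositions I (n - h c)))"
      using assms(1) by (intro sum.mono_neutral_cong_left) auto
    finally show ?thesis .
  qed
  \<comment> \<open>The constant coefficient fixed by \<open>delta\<close> agrees with the actual
    count at \<open>n = 0\<close>, so one series counts the points of all dilates.\<close>
  have "?A 0 = {0}"
    using nonempty by (auto simp: image_constant_conv int_lattice_def euclid_def)
  then have "Abs_fps (\<lambda>n. if n = 0 then 1 else int (card (?A n))) = Abs_fps (\<lambda>n. int (card (?A n)))"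
    by (simp add: fps_eq_iff)
  also have "\<dots> = (\<Sum>c\<in>X. fps_X ^ h c * Abs_fps (\<lambda>n. int (card (weak_compositions I n))))"
    by (simp add: fps_eq_iff card_N fps_sum_nth fps_X_power_mult_nth if_distrib cong: if_cong)
  finally have "delta d (convex hull (v ` I)) =
      (\<Sum>c\<in>X. fps_X ^ h c * ((1 - fps_X) ^ card I * Abs_fps (\<lambda>n. int (card (weak_compositions I n)))))"
    by (simp add: delta_def card_I sum_distrib_left mult.assoc mult.left_commute)
  then show ?thesis by (simp add: weak_compositions_gf fin)
qed

end

section \<open>Lattice pyramids\<close>

text \<open>The three conditions together describe a convex set that contains the base, where the
  last coordinate is 0, and the apex.\<close>

lemma Pyr_apex:
  assumes "Q \<subseteq> euclid e" "y \<in> Pyr e Q"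
  shows "0 \<le> y (e + 1)" "y (e + 1) \<le> 1" "y (e + 1) = 1 \<Longrightarrow> y = unit_vec (e + 1)"
proof -
  let ?S = "{y :: point. 0 \<le> y (e + 1) \<and> y (e + 1) \<le> 1 \<and> (y (e + 1) = 1 \<longrightarrow> y = unit_vec (e + 1))}"
  have "convex ?S"
  proof (rule convexI)
    fix x y :: point and u v :: real
    assume xy: "x \<in> ?S" "y \<in> ?S" and uv: "0 \<le> u" "0 \<le> v" "u + v = 1"
    show "u *\<^sub>R x + v *\<^sub>R y \<in> ?S"
    proof (cases "u = 0 \<or> v = 0")
      case True
      then show ?thesis using xy uv by auto
    next
      case False
      have "u * x (e + 1) \<le> u" "v * y (e + 1) \<le> v"
        using xy uv by (auto simp: mult_left_le)
      \<comment> \<open>A proper convex combination of numbers at most 1 equals 1 only if both do;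
        then both points are the apex.\<close>
      moreover have "x (e + 1) = 1 \<and> y (e + 1) = 1" if "u * x (e + 1) + v * y (e + 1) = 1"
      proof -
        have "u * x (e + 1) = u" "v * y (e + 1) = v" using that calculation uv by linarith+
        then show ?thesis using False by simp
      qed
      moreover have "u *\<^sub>R z + v *\<^sub>R z = z" for z :: point
        using uv by (simp flip: scaleR_add_left)
      ultimately show ?thesis
        using xy uv by auto
    qed
  qed
  moreover have "Q \<union> {unit_vec (e + 1)} \<subseteq> ?S"
    using assms(1) by (auto simp: unit_vec_def euclid_def subset_iff)
  ultimately have "Pyr e Q \<subseteq> ?S"
    unfolding Pyr_def by (intro hull_minimal)
  then show "0 \<le> y (e + 1)" "y (e + 1) \<le> 1" "y (e + 1) = 1 \<Longrightarrow> y = unit_vec (e + 1)"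
    using assms(2) by auto
qed

text \<open>An equivalence with a pyramid sends exactly one vertex \<open>v j\<close> to the apex, so the last
  coordinate of the image of a point is the \<open>j\<close>-th barycentric coordinate of the point.\<close>

lemma (in lattice_simplex) not_lattice_pyramid:
  assumes nonint: "\<And>j. j \<in> I \<Longrightarrow> \<exists>l\<in>coord_lattice. l j \<notin> \<int>"
  shows "\<not> lattice_pyramid d (convex hull (v ` I))"
proof
  let ?P = "convex hull (v ` I)"
  assume "lattice_pyramid d ?P"
  then obtain e Q where Q: "lattice_polytope e Q" and "unimodularly_equivalent d ?P (e + 1) (Pyr e Q)"
    unfolding lattice_pyramid_def by blast
  then obtain f where f: "affine_map_on (euclid d) f"
      "bij_betw f (int_lattice d \<inter> euclid d) (int_lattice (e + 1) \<inter> affine hull Pyr e Q)"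
      "f ` ?P = Pyr e Q"
    unfolding unimodularly_equivalent_def affine_hull_convex_hull affine_hull by blast
  obtain L c where L: "linear L" "\<And>x. x \<in> euclid d \<Longrightarrow> f x = L x + c"
    using f(1) unfolding affine_map_on_def by blast
  have Qe: "Q \<subseteq> euclid e" using Q by (simp add: lattice_polytope_def)
  have comb: "f (\<Sum>i\<in>I. l i *\<^sub>R v i) (e + 1) = (\<Sum>i\<in>I. l i * f (v i) (e + 1))" if l: "sum l I = 1" for l
  proof -
    have "f (v i) = L (v i) + c" if "i \<in> I" for i
      using L(2) vertex[OF that] int_lattice_euclid by blast
    then have "(\<Sum>i\<in>I. l i *\<^sub>R f (v i)) = (\<Sum>i\<in>I. l i *\<^sub>R (L (v i) + c))" by simp
    also have "\<dots> = L (\<Sum>i\<in>I. l i *\<^sub>R v i) + c"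
      by (simp add: linear_sum[OF L(1)] linear_scale[OF L(1)] scaleR_add_right sum.distrib l
          flip: scaleR_left.sum)
    also have "\<dots> = f (\<Sum>i\<in>I. l i *\<^sub>R v i)"
      using L(2)[OF lincomb_euclid] by simp
    finally have "f (\<Sum>i\<in>I. l i *\<^sub>R v i) = (\<Sum>i\<in>I. l i *\<^sub>R f (v i))" by (rule sym)
    then show ?thesis by (simp only: lincomb_apply)
  qed
  have lat: "f x (e + 1) \<in> \<int>" if "x \<in> int_lattice d" for x
  proof -
    have "f x \<in> int_lattice (e + 1)"
      using bij_betwE[OF f(2)] that int_lattice_euclid by blast
    then show ?thesis by (simp add: int_lattice_def)
  qed
  have Pyr: "f (v i) \<in> Pyr e Q" if "i \<in> I" for i
    using f(3) that hull_inc[of "v i" "v ` I" convex] by blast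
  have zero_or_apex: "f (v i) (e + 1) = 0 \<or> f (v i) = unit_vec (e + 1)" if i: "i \<in> I" for i
  proof -
    obtain n where n: "f (v i) (e + 1) = of_int n" using lat[OF vertex[OF i]] by (auto elim: Ints_cases)
    then have "n = 0 \<or> n = 1" using Pyr_apex(1,2)[OF Qe Pyr[OF i]] by auto
    then show ?thesis using n Pyr_apex(3)[OF Qe Pyr[OF i]] by auto
  qed
  \<comment> \<open>The apex is attained on the simplex, so the last coordinates of the images of
    the vertices cannot all vanish.\<close>
  have "unit_vec (e + 1) \<in> f ` ?P"
    unfolding f(3) Pyr_def by (intro hull_inc) simp
  then obtain l where l: "sum l I = 1" "unit_vec (e + 1) = f (\<Sum>i\<in>I. l i *\<^sub>R v i)"
    unfolding convex_hull_vertices by blast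
  have "(\<Sum>i\<in>I. l i * f (v i) (e + 1)) = 1"
    by (simp only: comb[OF l(1), symmetric] l(2)[symmetric]) (simp add: unit_vec_def)
  then have "\<exists>j\<in>I. f (v j) (e + 1) \<noteq> 0"
    by (metis (no_types, lifting) mult_zero_right sum.neutral zero_neq_one)
  then obtain j where j: "j \<in> I" "f (v j) = unit_vec (e + 1)" using zero_or_apex by blast
  \<comment> \<open>Two vertices cannot both go to the apex because \<open>f\<close> is injective on
    lattice points.\<close>
  have other: "f (v i) (e + 1) = 0" if i: "i \<in> I" "i \<noteq> j" for i
  proof (rule ccontr)
    assume "f (v i) (e + 1) \<noteq> 0"
    then have "f (v i) = f (v j)" using zero_or_apex[OF i(1)] j by simp
    moreover have "v i \<in> int_lattice d \<inter> euclid d" "v j \<in> int_lattice d \<inter> euclid d"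
      using vertex i(1) j(1) int_lattice_euclid by blast+
    ultimately have "v i = v j" using f(2) by (simp add: bij_betw_def inj_on_def)
    then show False using inj i j(1) by (auto dest: inj_onD)
  qed
  obtain k where k: "k \<in> coord_lattice" "k j \<notin> \<int>" using nonint[OF j(1)] by blast
  \<comment> \<open>The coordinate \<open>j\<close> is shifted by an integer to bring the total to
    1, so that \<open>k'\<close> describes a lattice point of the affine space and \<open>f\<close>
    can be applied to it.\<close>
  define k' where "k' = k(j := k j - (sum k I - 1))"
  have sumZ: "sum k I - 1 \<in> \<int>" using k(1) by (simp add: coord_lattice_def)
  have "k' \<in> coord_lattice"
    using k(1)
  proof (rule coord_lattice_cong)
    show "k' i - k i \<in> \<int>" for i using sumZ Ints_minus[OF sumZ] by (auto simp: k'_def)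
  qed
  moreover have "sum k' I = 1"
    using fin j(1) by (simp add: k'_def sum.remove[of I j])
  ultimately have "(\<Sum>i\<in>I. k' i * f (v i) (e + 1)) \<in> \<int>"
    using comb[of k'] lat[of "\<Sum>i\<in>I. k' i *\<^sub>R v i"] by (simp add: coord_lattice_def)
  moreover have "(\<Sum>i\<in>I. k' i * f (v i) (e + 1)) = k' j"
    using fin j other by (simp add: sum.remove[of I j] unit_vec_def)
  ultimately have "k' j \<in> \<int>" by simp
  then have "k' j + (sum k I - 1) \<in> \<int>" using sumZ by (rule Ints_add)
  then show False using k(2) by (simp add: k'_def)
qed

text \<open>Among the vertices only the apex has a nonzero last coordinate, and it is 1. The last
  coordinate of a combination is therefore the coefficient of the apex, which must be integral for a
  lattice point.\<close>

lemma lattice_simplex_Pyr: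
  assumes "lattice_simplex e {..e} u"
  defines "w \<equiv> u(Suc e := unit_vec (Suc e))"
  shows "lattice_simplex (Suc e) {..Suc e} w"
    and "lattice_simplex.coord_lattice (Suc e) {..Suc e} w =
      {l \<in> lattice_simplex.coord_lattice e {..e} u. l (Suc e) \<in> \<int>}"
    and "convex hull (w ` {..Suc e}) = Pyr e (convex hull (u ` {..e}))"
proof -
  interpret U: lattice_simplex e "{..e}" u by fact
  have comb: "(\<Sum>i\<le>Suc e. l i *\<^sub>R w i) = (\<Sum>i\<le>e. l i *\<^sub>R u i) + l (Suc e) *\<^sub>R unit_vec (Suc e)" for l
    by (simp add: w_def)
  let ?s = "\<lambda>l. \<Sum>i\<le>e. l i *\<^sub>R u i"
  have zero: "?s l (Suc e) = 0" for l
    using U.lincomb_euclid[of l] by (simp add: euclid_def)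
  show w: "lattice_simplex (Suc e) {..Suc e} w"
  proof
    show "w i \<in> int_lattice (Suc e)" if "i \<in> {..Suc e}" for i
    proof (cases "i = Suc e")
      case True
      then show ?thesis by (simp add: w_def unit_vec_in_int_lattice)
    next
      case False
      then have "w i \<in> int_lattice e" using that U.vertex[of i] by (simp add: w_def)
      then show ?thesis by (auto simp: int_lattice_def euclid_def)
    qed
    fix l :: "nat \<Rightarrow> real" and i assume l: "sum l {..Suc e} = 0" "(\<Sum>i\<le>Suc e. l i *\<^sub>R w i) = 0" "i \<in> {..Suc e}"
    have "(?s l + l (Suc e) *\<^sub>R unit_vec (Suc e)) (Suc e) = 0"
      using l(2) by (simp only: comb) simp
    then have last: "l (Suc e) = 0" by (simp add: zero unit_vec_def)
    then have "sum l {..e} = 0" "?s l = 0" using l(1,2) unfolding comb by simp_all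
    then have "l i = 0" if "i \<le> e" for i using U.indep[of l i] that by simp
    then show "l i = 0" using last l(3) by (cases "i = Suc e") auto
  qed simp_all
  have "(?s l + r *\<^sub>R unit_vec (Suc e)) \<in> int_lattice (Suc e) \<longleftrightarrow> ?s l \<in> int_lattice e \<and> r \<in> \<int>" for l r
  proof
    assume A: "(?s l + r *\<^sub>R unit_vec (Suc e)) \<in> int_lattice (Suc e)"
    have "(?s l + r *\<^sub>R unit_vec (Suc e)) k \<in> \<int>" for k using A by (simp only: int_lattice_def) simp
    then have Z: "?s l k + r * unit_vec (Suc e) k \<in> \<int>" for k by simp
    have r: "r \<in> \<int>" using Z[of "Suc e"] by (simp add: zero unit_vec_def)
    have "?s l k \<in> \<int>" for k using Z[of k] zero[of l] by (cases "k = Suc e") (auto simp: unit_vec_def)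
    then show "?s l \<in> int_lattice e \<and> r \<in> \<int>" using r U.lincomb_euclid by (simp add: int_lattice_def)
  next
    assume A: "?s l \<in> int_lattice e \<and> r \<in> \<int>"
    then have "?s l \<in> int_lattice (Suc e)" by (simp only: int_lattice_def euclid_def) auto
    moreover have "r *\<^sub>R unit_vec (Suc e) \<in> int_lattice (Suc e)"
      using A by (intro int_lattice_scale unit_vec_in_int_lattice) auto
    ultimately show "(?s l + r *\<^sub>R unit_vec (Suc e)) \<in> int_lattice (Suc e)"
      by (rule int_lattice_add)
  qed
  moreover have "sum l {..Suc e} \<in> \<int> \<longleftrightarrow> sum l {..e} \<in> \<int>" if "l (Suc e) \<in> \<int>" for l :: "nat \<Rightarrow> real"
    using that Ints_diff[of "sum l {..Suc e}" "l (Suc e)"] by auto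
  ultimately show "lattice_simplex.coord_lattice (Suc e) {..Suc e} w = {l \<in> U.coord_lattice. l (Suc e) \<in> \<int>}"
    unfolding lattice_simplex.coord_lattice_def[OF w] U.coord_lattice_def comb by blast
  have w_im: "w ` {..Suc e} = u ` {..e} \<union> {unit_vec (Suc e)}"
    by (auto simp: w_def image_iff)
  show "convex hull (w ` {..Suc e}) = Pyr e (convex hull (u ` {..e}))"
  proof
    show "convex hull (w ` {..Suc e}) \<subseteq> Pyr e (convex hull (u ` {..e}))"
      unfolding Pyr_def w_im using hull_subset[of "u ` {..e}" convex] by (intro hull_mono) auto
    have "convex hull (u ` {..e}) \<subseteq> convex hull (w ` {..Suc e})"
      unfolding w_im by (intro hull_mono) auto
    then show "Pyr e (convex hull (u ` {..e})) \<subseteq> convex hull (w ` {..Suc e})"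
      unfolding Pyr_def by (intro hull_minimal convex_convex_hull) (auto simp: w_im intro: hull_inc)
  qed
qed

text \<open>A vertex of type 0 merely requires an integral coordinate, exactly as an apex does.
  Recognizing a pyramid is thereby reduced to finding a simplex \<open>u\<close> that realizes the
  types of the remaining vertices.\<close>

lemma lattice_pyramid_of_char_lattice:
  assumes v: "lattice_simplex (Suc e) {..Suc e} v"
      "lattice_simplex.coord_lattice (Suc e) {..Suc e} v = char_lattice {..Suc e} V \<psi> t"
    and u: "lattice_simplex e {..e} u"
      "lattice_simplex.coord_lattice e {..e} u = char_lattice {..e} V \<psi> t"
    and t: "t (Suc e) = 0" "\<And>c. \<psi> c 0 = 0"
  shows "lattice_pyramid (Suc e) (convex hull (v ` {..Suc e}))"
proof -
  let ?w = "u(Suc e := unit_vec (Suc e))"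
  note w = lattice_simplex_Pyr[OF u(1)]
  have "char_lattice {..Suc e} V \<psi> t = {l \<in> char_lattice {..e} V \<psi> t. l (Suc e) \<in> \<int>}"
    by (auto simp: char_lattice_def t atMost_Suc)
  then have "unimodularly_equivalent (Suc e) (convex hull (v ` {..Suc e})) (Suc e) (convex hull (?w ` {..Suc e}))"
    by (intro unimodularly_equivalent_same_coords v(1) w(1)) (simp add: v(2) w(2) u(2))
  then show ?thesis
    unfolding lattice_pyramid_def w(3)
    using lattice_simplex.lattice_polytope[OF u(1)] lattice_simplex.full_dimensional[OF u(1)] by auto
qed

section \<open>Simplices with prescribed coordinate lattice\<close>

text \<open>The character \<open>x\<close> of the cyclic group of order \<open>m\<close> at the
  element \<open>c\<close>: the fraction \<open>c * x / m\<close> modulo 1, represented in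
  \<open>[0, 1)\<close>.\<close>

definition cyc :: "nat \<Rightarrow> nat \<Rightarrow> nat \<Rightarrow> real" where
  "cyc m c x = real (c * x mod m) / real m"

text \<open>Labelling the elements of the Klein four-group and its characters by \<open>0, 1, 2, 3\<close> suitably, a
  nontrivial character takes the value \<open>1 / 2\<close> exactly at the two nonzero elements other than its own
  label.\<close>

definition klein :: "nat \<Rightarrow> nat \<Rightarrow> real" where
  "klein c x = (if c \<noteq> 0 \<and> x \<noteq> 0 \<and> c \<noteq> x then 1 / 2 else 0)"

lemma cyc_mod_Ints:
  assumes "m > 0"
  shows "cyc m c x - real (c * x) / real m \<in> \<int>"
proof -
  have "real (c * x) = real m * real (c * x div m) + real (c * x mod m)"
    by (simp flip: of_nat_mult of_nat_add)
  then have "cyc m c x - real (c * x) / real m = - real (c * x div m)"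
    using assms unfolding cyc_def by (simp add: field_simps del: of_nat_mult)
  then show ?thesis by simp
qed

text \<open>Reductions modulo \<open>m\<close> change coordinates by integers only, so the group
  element may be replaced by an arbitrary integer multiplier and the remainders disappear.\<close>

lemma char_lattice_cyc:
  assumes "m > 0"
  shows "l \<in> char_lattice I m (cyc m) t \<longleftrightarrow> (\<exists>z::int. \<forall>i\<in>I. l i - of_int z * real (t i) / real m \<in> \<int>)"
proof
  assume "l \<in> char_lattice I m (cyc m) t"
  then obtain c where c: "\<forall>i\<in>I. l i - cyc m c (t i) \<in> \<int>" by (auto simp: char_lattice_def)
  have "l i - of_int (int c) * real (t i) / real m \<in> \<int>" if "i \<in> I" for i
    using Ints_add[OF c[rule_format, OF that] cyc_mod_Ints[OF assms, of c "t i"]] by simp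
  then show "\<exists>z::int. \<forall>i\<in>I. l i - of_int z * real (t i) / real m \<in> \<int>" by blast
next
  assume "\<exists>z::int. \<forall>i\<in>I. l i - of_int z * real (t i) / real m \<in> \<int>"
  then obtain z :: int where z: "\<forall>i\<in>I. l i - of_int z * real (t i) / real m \<in> \<int>" by blast
  define c where "c = nat (z mod int m)"
  have c: "c < m" using assms by (simp add: c_def nat_less_iff)
  have "z = int c + int m * (z div int m)" using assms by (simp add: c_def)
  then have zc: "of_int z = real c + real m * of_int (z div int m)"
    by (metis of_int_add of_int_mult of_int_of_nat_eq)
  have "l i - cyc m c (t i) \<in> \<int>" if "i \<in> I" for i
  proof -
    have "of_int z * real (t i) / real m = real (c * t i) / real m + of_int (z div int m) * real (t i)"
      using assms by (simp add: zc field_simps)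
    then have "l i - cyc m c (t i) = (l i - of_int z * real (t i) / real m)
        + of_int (z div int m * int (t i)) - (cyc m c (t i) - real (c * t i) / real m)"
      by simp
    then show ?thesis
      using z that cyc_mod_Ints[OF assms, of c "t i"]
      by (metis Ints_add Ints_diff Ints_of_int)
  qed
  then show "l \<in> char_lattice I m (cyc m) t" using c by (auto simp: char_lattice_def)
qed

text \<open>Multiplying all types by a unit only changes the generator: a multiplier
  \<open>z\<close> on one side corresponds to \<open>z * u\<close> or \<open>z * u'\<close> on the
  other.\<close>

lemma char_lattice_cyc_mult:
  assumes "m > 0" and u': "u * u' mod m = 1 mod m"
  shows "char_lattice I m (cyc m) (\<lambda>i. u * t i mod m) = char_lattice I m (cyc m) t"
proof -
  have *: "of_int z * real (x mod m) / real m - of_int z * real x / real m \<in> \<int>" for z :: int and x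
  proof -
    have "real x = real m * real (x div m) + real (x mod m)"
      by (simp flip: of_nat_mult of_nat_add)
    then have "of_int z * real (x mod m) / real m - of_int z * real x / real m = of_int (- z * int (x div m))"
      using assms by (simp add: field_simps del: of_nat_mult)
    then show ?thesis by (metis Ints_of_int)
  qed
  have "l \<in> char_lattice I m (cyc m) (\<lambda>i. u * t i mod m) \<longleftrightarrow> l \<in> char_lattice I m (cyc m) t" for l
    unfolding char_lattice_cyc[OF assms(1)]
  proof
    assume "\<exists>z::int. \<forall>i\<in>I. l i - of_int z * real (u * t i mod m) / real m \<in> \<int>"
    then obtain z :: int where z: "\<forall>i\<in>I. l i - of_int z * real (u * t i mod m) / real m \<in> \<int>" by blast
    have "l i - of_int (z * int u) * real (t i) / real m \<in> \<int>" if "i \<in> I" for i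
      using Ints_add[OF z[rule_format, OF that] *[of z "u * t i"]] by (simp add: mult_ac)
    then show "\<exists>z::int. \<forall>i\<in>I. l i - of_int z * real (t i) / real m \<in> \<int>" by blast
  next
    assume "\<exists>z::int. \<forall>i\<in>I. l i - of_int z * real (t i) / real m \<in> \<int>"
    then obtain z :: int where z: "\<forall>i\<in>I. l i - of_int z * real (t i) / real m \<in> \<int>" by blast
    have "l i - of_int (z * int u') * real (u * t i mod m) / real m \<in> \<int>" if i: "i \<in> I" for i
    proof -
      have eq: "u * u' * t i mod m = t i mod m"
        using mod_mult_left_eq[of "u * u'" m "t i"] u' mod_mult_left_eq[of 1 m "t i"] by simp
      have 1: "l i - of_int z * real (t i mod m) / real m \<in> \<int>"
        using Ints_diff[OF z[rule_format, OF i] *[of z "t i"]] by simp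
      have 2: "l i - of_int z * real (u * u' * t i) / real m \<in> \<int>"
        using Ints_add[OF 1 *[of z "u * u' * t i", unfolded eq]] by simp
      show ?thesis
        using Ints_diff[OF 2 *[of "z * int u'" "u * t i"]] by (simp add: mult_ac)
    qed
    then show "\<exists>z::int. \<forall>i\<in>I. l i - of_int z * real (u * t i mod m) / real m \<in> \<int>" by blast
  qed
  then show ?thesis by blast
qed

text \<open>All permutations of the three nonzero elements are automorphisms of the Klein group, and
  in the chosen labelling characters are permuted in the same way: \<open>klein\<close> only tests
  whether labels are zero or equal.\<close>

lemma char_lattice_klein_relabel:
  assumes "bij_betw \<pi> {..<4} {..<4}" "\<pi> 0 = 0" "\<And>i. i \<in> I \<Longrightarrow> t i < 4"
  shows "char_lattice I 4 klein (\<pi> \<circ> t) = char_lattice I 4 klein t"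
proof -
  have eq0: "\<pi> x = 0 \<longleftrightarrow> x = 0" if "x < 4" for x
    using bij_betw_imp_inj_on[OF assms(1)] assms(2) that by (auto dest: inj_onD[of _ _ x 0])
  have "klein (\<pi> c) (\<pi> x) = klein c x" if "c < 4" "x < 4" for c x
    using eq0 that inj_on_eq_iff[OF bij_betw_imp_inj_on[OF assms(1)], of c x] by (simp add: klein_def)
  then have "(\<forall>i\<in>I. l i - klein (\<pi> c) (\<pi> (t i)) \<in> \<int>) \<longleftrightarrow> (\<forall>i\<in>I. l i - klein c (t i) \<in> \<int>)" if "c < 4" for l c
    using assms(3) that by simp
  then have "(\<exists>c\<in>{..<4}. \<forall>i\<in>I. l i - klein (\<pi> c) (\<pi> (t i)) \<in> \<int>) \<longleftrightarrow> (\<exists>c\<in>{..<4}. \<forall>i\<in>I. l i - klein c (t i) \<in> \<int>)" for l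
    by simp
  then have "(\<exists>c\<in>\<pi> ` {..<4}. \<forall>i\<in>I. l i - klein c (\<pi> (t i)) \<in> \<int>) \<longleftrightarrow> (\<exists>c\<in>{..<4}. \<forall>i\<in>I. l i - klein c (t i) \<in> \<int>)" for l
    by simp
  then show ?thesis
    unfolding bij_betw_imp_surj_on[OF assms(1)]
    by (simp only: char_lattice_def o_def Bex_def lessThan_iff)
qed

lemma klein_Ints: "2 * klein c x \<in> \<int>"
  by (simp add: klein_def)

text \<open>The characters 2 and 1 together separate the four elements, so every pair of
  half-integers modulo 1 occurs as their pair of values.\<close>

lemma klein_halves:
  assumes "2 * p \<in> \<int>" "2 * q \<in> \<int>"
  obtains c where "c < 4" "p - klein c 2 \<in> \<int>" "q - klein c 1 \<in> \<int>"
proof -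
  have half: "r \<in> \<int> \<or> r - 1 / 2 \<in> \<int>" if "2 * r \<in> \<int>" for r :: real
  proof -
    obtain n where n: "2 * r = of_int n" using \<open>2 * r \<in> \<int>\<close> by (auto elim: Ints_cases)
    show ?thesis
    proof (cases "even n")
      case True
      then obtain k where "n = 2 * k" by (elim evenE)
      then have "r = of_int k" using n by simp
      then show ?thesis by simp
    next
      case False
      then obtain k where "n = 2 * k + 1" by (elim oddE)
      then have "r - 1 / 2 = of_int k" using n by simp
      then show ?thesis by (metis Ints_of_int)
    qed
  qed
  show thesis
    using half[OF assms(1)] half[OF assms(2)] that[of 0] that[of 1] that[of 2] that[of 3]
    by (auto simp: klein_def)
qed

text \<open>Modulo 1 the character 3 is the sum of the characters 1 and 2. The parities of
  \<open>a\<close> and \<open>b\<close> record which of the characters 2 and 1 make up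
  \<open>x\<close>; signs do not matter for half-integers.\<close>

lemma klein_bilinear:
  fixes a b :: int
  assumes "c < 4" "x < 4" "odd a \<longleftrightarrow> x \<in> {2, 3}" "odd b \<longleftrightarrow> x \<in> {1, 3}"
  shows "klein c x + (of_int a * klein c 2 + of_int b * klein c 1) \<in> \<int>"
proof -
  have *: "of_int (2 * n + 1) * klein c y + klein c y \<in> \<int>" "of_int (2 * n) * klein c y \<in> \<int>" for n y
  proof -
    have "of_int (2 * n + 1) * klein c y + klein c y = of_int (n + 1) * (2 * klein c y)"
      "of_int (2 * n) * klein c y = of_int n * (2 * klein c y)" by (simp_all add: algebra_simps)
    then show "of_int (2 * n + 1) * klein c y + klein c y \<in> \<int>" "of_int (2 * n) * klein c y \<in> \<int>"
      using klein_Ints by (metis Ints_mult Ints_of_int)+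
  qed
  have **: "of_int n * klein c y - (if odd n then klein c y else 0) \<in> \<int>" for n y
  proof (cases "odd n")
    case True
    then obtain k where k: "n = 2 * k + 1" by (elim oddE)
    show ?thesis using True Ints_diff[OF *(1)[of k y] klein_Ints[of c y]] by (simp add: k)
  next
    case False
    then have "even n" by simp
    then obtain k where k: "n = 2 * k" by (elim evenE)
    show ?thesis using False *(2)[of k y] by (simp add: k)
  qed
  have "klein c x + ((if odd a then klein c 2 else 0) + (if odd b then klein c 1 else 0)) \<in> \<int>"
  proof -
    have "c = 0 \<or> c = 1 \<or> c = 2 \<or> c = 3" "x = 0 \<or> x = 1 \<or> x = 2 \<or> x = 3" using assms(1,2) by auto
    then show ?thesis unfolding assms(3,4) by (elim disjE) (simp_all add: klein_def)
  qed
  from Ints_add[OF this Ints_add[OF **[of a 2] **[of b 1]]] show ?thesis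
    by (simp add: algebra_simps)
qed

lemma sum_atMost_split_ends:
  fixes f :: "nat \<Rightarrow> 'a :: comm_monoid_add"
  assumes "1 \<le> e"
  shows "sum f {..e} = f 0 + (sum f {1..<e} + f e)"
proof -
  have "{..e} = insert 0 (insert e {1..<e})" using assms by auto
  then show ?thesis using assms by (simp add: add_ac)
qed

lemma Ints_add_cancel: "x + y \<in> \<int> \<Longrightarrow> y \<in> \<int> \<Longrightarrow> x \<in> \<int>" for x y :: "'a :: ring_1"
  using Ints_diff[of "x + y" y] by simp

text \<open>For a lattice point the last coordinate gives \<open>l e = z / m\<close> with
  \<open>z\<close> an integer, and the coordinate \<open>k\<close> gives
  \<open>l k = - z * a k / m\<close> modulo 1, which is \<open>z * t k / m\<close> by the congruence
  between \<open>a\<close> and \<open>t\<close>. The coefficient of the origin follows from the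
  integral height because \<open>m\<close> divides the sum of the types.\<close>

lemma cyclic_simplex:
  fixes a :: "nat \<Rightarrow> int" and t :: "nat \<Rightarrow> nat"
  assumes e: "1 \<le> e" and m: "m > 0" and te: "t e = 1"
    and dvd: "\<And>k. k \<in> {1..<e} \<Longrightarrow> int m dvd a k + int (t k)"
    and dvd_sum: "m dvd sum t {..e}"
  defines "y \<equiv> \<lambda>k. if k \<in> {1..<e} then of_int (a k) else if k = e then real m else 0"
  defines "w \<equiv> \<lambda>k. if k = 0 then 0 else if k < e then unit_vec k else y"
  shows "lattice_simplex e {..e} w"
    and "lattice_simplex.coord_lattice e {..e} w = char_lattice {..e} m (cyc m) t"
proof -
  let ?s = "\<lambda>l. \<Sum>i\<le>e. l i *\<^sub>R w i"
  have comb: "?s l = (\<Sum>i\<in>{1..<e}. l i *\<^sub>R unit_vec i) + l e *\<^sub>R y" for l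
    using e by (simp add: sum_atMost_split_ends w_def)
  have s: "?s l k = (if k \<in> {1..<e} then l k else 0) + l e * y k" for l k
    unfolding comb by (auto simp: lincomb_apply unit_vec_apply if_distrib[of "(*) _"] cong: if_cong)
  have y_lat: "y \<in> int_lattice e"
    using e by (auto simp: int_lattice_def euclid_def y_def)
  show w: "lattice_simplex e {..e} w"
  proof
    show "w i \<in> int_lattice e" if "i \<in> {..e}" for i
      using that y_lat e
      by (auto simp: w_def unit_vec_in_int_lattice) (simp add: int_lattice_def euclid_def)
    fix l :: "nat \<Rightarrow> real" and i assume l: "sum l {..e} = 0" "?s l = 0" "i \<in> {..e}"
    have "?s l k = 0" for k using l(2) by simp
    then have z: "(if k \<in> {1..<e} then l k else 0) + l e * y k = 0" for k by (simp only: s)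
    have le: "l e = 0" using z[of e] m e by (simp add: y_def)
    have lk: "l k = 0" if "k \<in> {1..<e}" for k using z[of k] le that by simp
    have "l 0 = 0" using l(1) le lk sum_atMost_split_ends[OF e, of l] by simp
    then show "l i = 0" using le lk l(3) by (cases "i = 0 \<or> i = e") auto
  qed simp_all
  have lat: "?s l \<in> int_lattice e \<longleftrightarrow> real m * l e \<in> \<int> \<and> (\<forall>k\<in>{1..<e}. l k + l e * of_int (a k) \<in> \<int>)" for l
  proof -
    have "?s l \<in> int_lattice e \<longleftrightarrow> (\<forall>k. ?s l k \<in> \<int>)"
      using lattice_simplex.lincomb_euclid[OF w] by (simp add: int_lattice_def)
    also have "\<dots> \<longleftrightarrow> real m * l e \<in> \<int> \<and> (\<forall>k\<in>{1..<e}. l k + l e * of_int (a k) \<in> \<int>)"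
      (is "?A \<longleftrightarrow> ?B")
    proof
      assume A: ?A
      then have A': "(if k \<in> {1..<e} then l k else 0) + l e * y k \<in> \<int>" for k
        by (simp only: s)
      have "l k + l e * of_int (a k) \<in> \<int>" if "k \<in> {1..<e}" for k
        using A'[of k] that by (simp add: y_def)
      moreover have "real m * l e \<in> \<int>"
        using A'[of e] by (simp add: y_def mult.commute)
      ultimately show ?B by blast
    next
      assume B: ?B
      have "?s l k \<in> \<int>" for k
        unfolding s y_def using B by (cases "k \<in> {1..<e}") (auto simp: mult.commute)
      then show ?A by blast
    qed
    finally show ?thesis .
  qed
  obtain q where q: "sum t {..e} = m * q" using dvd_sum by blast
  have "l \<in> lattice_simplex.coord_lattice e {..e} w \<longleftrightarrow> l \<in> char_lattice {..e} m (cyc m) t" for l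
    unfolding lattice_simplex.coord_lattice_def[OF w] mem_Collect_eq lat char_lattice_cyc[OF m]
  proof
    assume A: "sum l {..e} \<in> \<int> \<and> real m * l e \<in> \<int> \<and> (\<forall>k\<in>{1..<e}. l k + l e * of_int (a k) \<in> \<int>)"
    then obtain z where z: "real m * l e = of_int z" by (auto elim: Ints_cases)
    then have le: "l e = of_int z / real m" using m by (simp add: field_simps)
    let ?r = "\<lambda>i. l i - of_int z * real (t i) / real m"
    have mid: "?r k \<in> \<int>" if k: "k \<in> {1..<e}" for k
    proof -
      obtain n where n: "a k + int (t k) = int m * n" using dvd[OF k] by blast
      have tk: "real (t k) = real m * of_int n - of_int (a k)"
        using arg_cong[OF n, of "of_int :: int \<Rightarrow> real"] by simp
      have "?r k = (l k + l e * of_int (a k)) - of_int (z * n)"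
        using m by (simp add: tk le field_simps)
      then show ?thesis using A k by (metis Ints_diff Ints_of_int)
    qed
    have last: "?r e = 0" by (simp add: te le)
    \<comment> \<open>The origin does not contribute to the lattice point, so its coefficient can
      only be controlled through the height.\<close>
    have "sum ?r {..e} = sum l {..e} - of_int z * real (sum t {..e}) / real m"
      by (simp add: sum_subtractf sum_distrib_left sum_divide_distrib)
    also have "\<dots> = sum l {..e} - of_int (z * int q)" using m by (simp add: q)
    finally have "sum ?r {..e} \<in> \<int>" using A by (metis Ints_diff Ints_of_int)
    then have "?r 0 + (sum ?r {1..<e} + ?r e) \<in> \<int>" by (simp only: sum_atMost_split_ends[OF e])
    moreover have "sum ?r {1..<e} + ?r e \<in> \<int>"
      unfolding last using mid by (intro Ints_add Ints_sum) auto
    ultimately have "?r 0 \<in> \<int>" by (rule Ints_add_cancel)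
    then have "?r i \<in> \<int>" if "i \<in> {..e}" for i
      using mid last that by (cases "i = 0 \<or> i = e") auto
    then show "\<exists>z::int. \<forall>i\<in>{..e}. l i - of_int z * real (t i) / real m \<in> \<int>" by blast
  next
    assume "\<exists>z::int. \<forall>i\<in>{..e}. l i - of_int z * real (t i) / real m \<in> \<int>"
    then obtain z :: int where z: "\<And>i. i \<le> e \<Longrightarrow> l i - of_int z * real (t i) / real m \<in> \<int>" by auto
    let ?r = "\<lambda>i. l i - of_int z * real (t i) / real m"
    have "sum l {..e} = sum ?r {..e} + of_int z * real (sum t {..e}) / real m"
      by (simp add: sum_subtractf sum_distrib_left sum_divide_distrib)
    also have "\<dots> = sum ?r {..e} + of_int (z * int q)" using m by (simp add: q)
    also have "\<dots> \<in> \<int>" using z by (intro Ints_add Ints_sum) auto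
    finally have 1: "sum l {..e} \<in> \<int>" .
    have 2: "real m * l e \<in> \<int>"
    proof -
      have "real m * l e = of_int (int m) * ?r e + of_int z" using m by (simp add: te field_simps)
      then show ?thesis using z[of e] by (metis Ints_add Ints_mult Ints_of_int order_refl)
    qed
    have 3: "l k + l e * of_int (a k) \<in> \<int>" if k: "k \<in> {1..<e}" for k
    proof -
      obtain n where n: "a k + int (t k) = int m * n" using dvd[OF k] by blast
      have tk: "real (t k) = real m * of_int n - of_int (a k)"
        using arg_cong[OF n, of "of_int :: int \<Rightarrow> real"] by simp
      have "l k + l e * of_int (a k) = ?r k + ?r e * of_int (a k) + of_int (z * n)"
        using m by (simp add: te tk field_simps)
      moreover have "?r k \<in> \<int>" "?r e \<in> \<int>" using z k by auto
      ultimately show ?thesis by (metis Ints_add Ints_mult Ints_of_int)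
    qed
    show "sum l {..e} \<in> \<int> \<and> real m * l e \<in> \<int> \<and> (\<forall>k\<in>{1..<e}. l k + l e * of_int (a k) \<in> \<int>)"
      using 1 2 3 by blast
  qed
  then show "lattice_simplex.coord_lattice e {..e} w = char_lattice {..e} m (cyc m) t" by blast
qed

text \<open>The coordinates carrying the entries 2 make the coefficients of \<open>y\<close> and
  \<open>z\<close> half-integers, and these select a group element since \<open>y\<close> has type 2
  and \<open>z\<close> type 1. \<open>klein_bilinear\<close> then yields the coefficients of the
  unit vectors, and integrality of the height that of the origin.\<close>

lemma klein_simplex:
  fixes a b :: "nat \<Rightarrow> int" and t :: "nat \<Rightarrow> nat"
  assumes te: "t (Suc e) = 2" "t (Suc (Suc e)) = 1" and t4: "\<And>k. k \<le> Suc (Suc e) \<Longrightarrow> t k < 4"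
    and odd_a: "\<And>k. k \<in> {1..e} \<Longrightarrow> odd (a k) \<longleftrightarrow> t k \<in> {2, 3}"
    and odd_b: "\<And>k. k \<in> {1..e} \<Longrightarrow> odd (b k) \<longleftrightarrow> t k \<in> {1, 3}"
    and sums: "\<And>c. c < 4 \<Longrightarrow> (\<Sum>k\<le>Suc (Suc e). klein c (t k)) \<in> \<int>"
  defines "y \<equiv> \<lambda>k. if k \<in> {1..e} then of_int (a k) else if k = Suc e then 2 else (0 :: real)"
    and "z \<equiv> \<lambda>k. if k \<in> {1..e} then of_int (b k) else if k = Suc (Suc e) then 2 else (0 :: real)"
  defines "w \<equiv> \<lambda>k. if k = 0 then 0 else if k \<le> e then unit_vec k else if k = Suc e then y else z"
  shows "lattice_simplex (Suc (Suc e)) {..Suc (Suc e)} w"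
    and "lattice_simplex.coord_lattice (Suc (Suc e)) {..Suc (Suc e)} w
      = char_lattice {..Suc (Suc e)} 4 klein t"
proof -
  let ?d = "Suc (Suc e)"
  let ?s = "\<lambda>l. \<Sum>i\<le>?d. l i *\<^sub>R w i"
  have split: "sum f {..?d} = f 0 + (sum f {1..e} + f (Suc e) + f ?d)"
    for f :: "nat \<Rightarrow> 'b :: comm_monoid_add"
  proof -
    have "{..e} = insert 0 {1..e}" by auto
    then show ?thesis by (simp add: add_ac)
  qed
  have comb: "?s l = (\<Sum>i\<in>{1..e}. l i *\<^sub>R unit_vec i) + l (Suc e) *\<^sub>R y + l ?d *\<^sub>R z" for l
    unfolding split by (simp add: w_def)
  have s: "?s l k = (if k \<in> {1..e} then l k else 0) + l (Suc e) * y k + l ?d * z k" for l k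
    unfolding comb by (auto simp: lincomb_apply unit_vec_apply if_distrib[of "(*) _"] cong: if_cong)
  have yz_lat: "y \<in> int_lattice ?d" "z \<in> int_lattice ?d"
    by (auto simp: int_lattice_def euclid_def y_def z_def)
  show w: "lattice_simplex ?d {..?d} w"
  proof
    show "w i \<in> int_lattice ?d" if "i \<in> {..?d}" for i
      using that yz_lat by (auto simp: w_def unit_vec_in_int_lattice) (simp add: int_lattice_def euclid_def)
    fix l :: "nat \<Rightarrow> real" and i assume l: "sum l {..?d} = 0" "?s l = 0" "i \<in> {..?d}"
    have "?s l k = 0" for k using l(2) by simp
    then have zero: "(if k \<in> {1..e} then l k else 0) + l (Suc e) * y k + l ?d * z k = 0" for k
      by (simp only: s)
    have ends: "l (Suc e) = 0" "l ?d = 0"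
      using zero[of "Suc e"] zero[of ?d] by (simp_all add: y_def z_def)
    have lk: "l k = 0" if "k \<in> {1..e}" for k using zero[of k] ends that by simp
    have "l 0 = 0" using l(1) ends lk unfolding split by simp
    then show "l i = 0" using ends lk l(3) by (cases "i = 0 \<or> i = Suc e \<or> i = ?d") auto
  qed simp_all
  have lat: "?s l \<in> int_lattice ?d \<longleftrightarrow> 2 * l (Suc e) \<in> \<int> \<and> 2 * l ?d \<in> \<int> \<and>
      (\<forall>k\<in>{1..e}. l k + (of_int (a k) * l (Suc e) + of_int (b k) * l ?d) \<in> \<int>)" for l
  proof -
    have "?s l \<in> int_lattice ?d \<longleftrightarrow> (\<forall>k. ?s l k \<in> \<int>)"
      using lattice_simplex.lincomb_euclid[OF w] by (simp add: int_lattice_def)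
    also have "\<dots> \<longleftrightarrow> 2 * l (Suc e) \<in> \<int> \<and> 2 * l ?d \<in> \<int> \<and>
      (\<forall>k\<in>{1..e}. l k + (of_int (a k) * l (Suc e) + of_int (b k) * l ?d) \<in> \<int>)"
      (is "?A \<longleftrightarrow> ?B")
    proof
      assume A: ?A
      then have A': "(if k \<in> {1..e} then l k else 0) + l (Suc e) * y k + l ?d * z k \<in> \<int>" for k
        by (simp only: s)
      have "l k + (of_int (a k) * l (Suc e) + of_int (b k) * l ?d) \<in> \<int>" if "k \<in> {1..e}" for k
        using A'[of k] that by (simp add: y_def z_def mult.commute add.assoc)
      moreover have "2 * l (Suc e) \<in> \<int>" "2 * l ?d \<in> \<int>"
        using A'[of "Suc e"] A'[of ?d] by (simp_all add: y_def z_def mult.commute)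
      ultimately show ?B by blast
    next
      assume B: ?B
      have "?s l k \<in> \<int>" for k
        unfolding s y_def z_def using B
        by (cases "k \<in> {1..e}") (auto simp: mult.commute add.assoc)
      then show ?A by blast
    qed
    finally show ?thesis .
  qed
  have "l \<in> lattice_simplex.coord_lattice ?d {..?d} w \<longleftrightarrow> l \<in> char_lattice {..?d} 4 klein t" for l
    unfolding lattice_simplex.coord_lattice_def[OF w] mem_Collect_eq lat
  proof
    assume A: "sum l {..?d} \<in> \<int> \<and> 2 * l (Suc e) \<in> \<int> \<and> 2 * l ?d \<in> \<int> \<and>
      (\<forall>k\<in>{1..e}. l k + (of_int (a k) * l (Suc e) + of_int (b k) * l ?d) \<in> \<int>)"
    then obtain c where c: "c < 4" "l (Suc e) - klein c 2 \<in> \<int>" "l ?d - klein c 1 \<in> \<int>"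
      using klein_halves[of "l (Suc e)" "l ?d"] by blast
    let ?r = "\<lambda>i. l i - klein c (t i)"
    have ends: "?r (Suc e) \<in> \<int>" "?r ?d \<in> \<int>" using c te by simp_all
    have mid: "?r k \<in> \<int>" if k: "k \<in> {1..e}" for k
    proof -
      have 1: "l k + (of_int (a k) * l (Suc e) + of_int (b k) * l ?d) \<in> \<int>"
        using A k by blast
      have 2: "klein c (t k) + (of_int (a k) * klein c 2 + of_int (b k) * klein c 1) \<in> \<int>"
        using k c(1) t4[of k] odd_a[OF k] odd_b[OF k] by (intro klein_bilinear) auto
      have 3: "of_int (a k) * (l (Suc e) - klein c 2) + of_int (b k) * (l ?d - klein c 1) \<in> \<int>"
        using c(2,3) by (intro Ints_add Ints_mult Ints_of_int)
      show ?thesis using Ints_diff[OF Ints_diff[OF 1 2] 3] by (simp add: algebra_simps)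
    qed
    have "sum ?r {..?d} \<in> \<int>"
      unfolding sum_subtractf using A sums[OF c(1)] by (intro Ints_diff) auto
    then have "?r 0 + (sum ?r {1..e} + ?r (Suc e) + ?r ?d) \<in> \<int>" by (simp only: split)
    moreover have "sum ?r {1..e} + ?r (Suc e) + ?r ?d \<in> \<int>"
      using mid ends by (intro Ints_add Ints_sum)
    ultimately have "?r 0 \<in> \<int>" by (rule Ints_add_cancel)
    then have "?r i \<in> \<int>" if "i \<in> {..?d}" for i
      using mid ends that by (cases "i = 0 \<or> i = Suc e \<or> i = ?d") auto
    then show "l \<in> char_lattice {..?d} 4 klein t" using c(1) by (auto simp: char_lattice_def)
  next
    assume "l \<in> char_lattice {..?d} 4 klein t"
    then obtain c where c: "c < 4" and r: "\<And>i. i \<le> ?d \<Longrightarrow> l i - klein c (t i) \<in> \<int>"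
      by (auto simp: char_lattice_def)
    let ?r = "\<lambda>i. l i - klein c (t i)"
    have "sum ?r {..?d} \<in> \<int>" using r by (intro Ints_sum) blast
    from Ints_add[OF this sums[OF c]] have 1: "sum l {..?d} \<in> \<int>"
      by (simp only: sum_subtractf diff_add_cancel)
    have 2: "2 * l i \<in> \<int>" if "i \<le> ?d" for i
    proof -
      have "2 * l i = of_int 2 * ?r i + 2 * klein c (t i)" by simp
      then show ?thesis using r[OF that] klein_Ints by (metis Ints_add Ints_mult Ints_of_int)
    qed
    have 3: "l k + (of_int (a k) * l (Suc e) + of_int (b k) * l ?d) \<in> \<int>" if k: "k \<in> {1..e}" for k
    proof -
      have 1: "?r k \<in> \<int>" using r[of k] k by simp
      have 2: "klein c (t k) + (of_int (a k) * klein c 2 + of_int (b k) * klein c 1) \<in> \<int>"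
        using k c t4[of k] odd_a[OF k] odd_b[OF k] by (intro klein_bilinear) auto
      have 3: "of_int (a k) * ?r (Suc e) + of_int (b k) * ?r ?d \<in> \<int>"
        by (intro Ints_add Ints_mult Ints_of_int r) simp_all
      show ?thesis using Ints_add[OF Ints_add[OF 1 2] 3] by (simp add: te algebra_simps)
    qed
    show "sum l {..?d} \<in> \<int> \<and> 2 * l (Suc e) \<in> \<int> \<and> 2 * l ?d \<in> \<int> \<and>
      (\<forall>k\<in>{1..e}. l k + (of_int (a k) * l (Suc e) + of_int (b k) * l ?d) \<in> \<int>)"
      using 1 2[of "Suc e"] 2[of ?d] 3 by auto
  qed
  then show "lattice_simplex.coord_lattice ?d {..?d} w = char_lattice {..?d} 4 klein t" by blast
qed

section \<open>The box of a lattice simplex\<close>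

lemma Ints_less_1: "x \<in> \<int> \<Longrightarrow> \<bar>x\<bar> < 1 \<Longrightarrow> x = 0" for x :: real
  by (auto elim!: Ints_cases)

lemma fps_nth_sum_fps_X_power:
  fixes h :: "'c \<Rightarrow> nat"
  assumes "finite X"
  shows "fps_nth (\<Sum>c\<in>X. fps_X ^ h c) n = int (card {c \<in> X. h c = n})"
  using assms by (simp add: fps_sum_nth fps_X_power_nth sum.If_cases Int_def eq_commute)

context lattice_simplex
begin

text \<open>Vanishing outside \<open>I\<close> makes an element determined by its coordinates, so
  that the elements of this set represent the quotient group without repetition.\<close>

definition box :: "('a \<Rightarrow> real) set" where
  "box = {l \<in> coord_lattice. (\<forall>i\<in>I. 0 \<le> l i \<and> l i < 1) \<and> (\<forall>i. i \<notin> I \<longrightarrow> l i = 0)}"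

definition height :: "('a \<Rightarrow> real) \<Rightarrow> nat" where
  "height l = nat \<lfloor>sum l I\<rfloor>"

definition frac_part :: "('a \<Rightarrow> real) \<Rightarrow> 'a \<Rightarrow> real" where
  "frac_part l = (\<lambda>i. if i \<in> I then frac (l i) else 0)"

lemma boxD:
  assumes "b \<in> box"
  shows "b \<in> coord_lattice" "i \<in> I \<Longrightarrow> 0 \<le> b i" "i \<in> I \<Longrightarrow> b i < 1" "i \<notin> I \<Longrightarrow> b i = 0"
  using assms by (auto simp: box_def)

lemma height: "b \<in> box \<Longrightarrow> real (height b) = sum b I"
  using boxD[of b] sum_nonneg[of I b]
  by (auto simp: height_def coord_lattice_def elim!: Ints_cases)

lemma frac_part_diff: "i \<in> I \<Longrightarrow> l i - frac_part l i \<in> \<int>"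
  by (simp add: frac_part_def frac_def)

lemma frac_part_in_box:
  assumes "l \<in> coord_lattice"
  shows "frac_part l \<in> box"
proof -
  have "frac_part l \<in> coord_lattice"
    using assms by (rule coord_lattice_cong) (simp add: frac_part_def frac_def)
  then show ?thesis by (auto simp: box_def frac_part_def frac_lt_1)
qed

lemma box_eqI:
  assumes b: "b \<in> box" "b' \<in> box" and "\<And>i. i \<in> I \<Longrightarrow> b i - b' i \<in> \<int>"
  shows "b = b'"
proof
  fix i
  show "b i = b' i"
  proof (cases "i \<in> I")
    case True
    then have "\<bar>b i - b' i\<bar> < 1" using boxD(2,3)[OF b(1) True] boxD(2,3)[OF b(2) True] by auto
    then show ?thesis using Ints_less_1[OF assms(3)[OF True]] by simp
  qed (simp add: boxD(4)[OF b(1)] boxD(4)[OF b(2)])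
qed

lemma coord_lattice_iff_box: "l \<in> coord_lattice \<longleftrightarrow> (\<exists>b\<in>box. \<forall>i\<in>I. l i - b i \<in> \<int>)"
  using frac_part_in_box frac_part_diff coord_lattice_cong boxD(1) by metis

lemma zero_in_box: "(\<lambda>_. 0) \<in> box"
  by (auto simp: box_def coord_lattice_def int_lattice_def euclid_def)

text \<open>An element is determined by its height together with the lattice point it represents.
  The height is at most the number of vertices, and the point is bounded because all coefficients
  lie in \<open>[0, 1)\<close>.\<close>

lemma finite_box: "finite box"
proof -
  let ?f = "\<lambda>b. (sum b I, \<Sum>i\<in>I. b i *\<^sub>R v i)"
  let ?M = "\<Sum>k\<in>{1..d}. \<Sum>i\<in>I. \<bar>v i k\<bar>"
  have "inj_on ?f box"
  proof (rule inj_onI)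
    fix b b' assume b: "b \<in> box" "b' \<in> box" "?f b = ?f b'"
    show "b = b'"
      using b(1,2)
    proof (rule box_eqI)
      show "b i - b' i \<in> \<int>" if "i \<in> I" for i
        using coords_unique[of b b' i] b(3) that by simp
    qed
  qed
  moreover have "?f ` box \<subseteq> real ` {..card I} \<times> {x \<in> int_lattice d. \<forall>k. \<bar>x k\<bar> \<le> ?M}"
  proof
    fix y assume "y \<in> ?f ` box"
    then obtain b where b: "b \<in> box" "y = ?f b" by blast
    have "sum b I \<le> (\<Sum>i\<in>I. 1)" using boxD(3)[OF b(1)] by (intro sum_mono less_imp_le)
    then have "height b \<le> card I" using height[OF b(1)] by simp
    moreover have "\<bar>(\<Sum>i\<in>I. b i *\<^sub>R v i) k\<bar> \<le> ?M" for k
    proof (cases "k \<in> {1..d}")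
      case True
      have "\<bar>\<Sum>i\<in>I. b i * v i k\<bar> \<le> (\<Sum>i\<in>I. \<bar>b i * v i k\<bar>)" by (rule sum_abs)
      also have "\<dots> \<le> (\<Sum>i\<in>I. \<bar>v i k\<bar>)"
      proof (rule sum_mono)
        fix i assume "i \<in> I"
        then show "\<bar>b i * v i k\<bar> \<le> \<bar>v i k\<bar>"
          using boxD(2,3)[OF b(1), of i] mult_left_le_one_le[of "\<bar>v i k\<bar>" "b i"] by (simp add: abs_mult)
      qed
      also have "\<dots> \<le> ?M"
        using True by (intro member_le_sum) (auto intro: sum_nonneg)
      finally show ?thesis by (simp add: lincomb_apply)
    next
      case False
      then have "(\<Sum>i\<in>I. b i *\<^sub>R v i) k = 0" using euclid_zero[OF lincomb_euclid] by blast
      then show ?thesis by (simp add: sum_nonneg)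
    qed
    moreover have "(\<Sum>i\<in>I. b i *\<^sub>R v i) \<in> int_lattice d"
      using boxD(1)[OF b(1)] by (simp add: coord_lattice_def)
    ultimately show "y \<in> real ` {..card I} \<times> {x \<in> int_lattice d. \<forall>k. \<bar>x k\<bar> \<le> ?M}"
      using b(2) height[OF b(1)] by (auto intro!: image_eqI[of _ real "height b"])
  qed
  ultimately show ?thesis
    using finite_int_lattice_box by (meson finite_SigmaI finite_atMost finite_imageI inj_on_finite)
qed

lemma delta_box: "delta d (convex hull (v ` I)) = (\<Sum>b\<in>box. fps_X ^ height b)"
proof (rule delta_eq_sum_heights[where b = "\<lambda>b. b"])
  show "b = b'" if "b \<in> box" "b' \<in> box" "\<forall>i\<in>I. b i = b' i" for b b'
    using that(1,2) by (rule box_eqI) (simp add: that)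
qed (use finite_box coord_lattice_iff_box boxD height in auto)

text \<open>Comparing coefficients, each height occurs as often as the corresponding exponent. The
  resulting enumeration respects heights but need not reflect the group structure.\<close>

lemma box_enumeration:
  fixes V :: nat
  assumes "delta d (convex hull (v ` I)) = (\<Sum>c<V. fps_X ^ g c)"
  obtains \<beta> where "bij_betw \<beta> {..<V} box" "\<And>c. c < V \<Longrightarrow> height (\<beta> c) = g c"
proof -
  have "card {c \<in> {..<V}. g c = n} = card {b \<in> box. height b = n}" for n
    using arg_cong[OF assms, of "\<lambda>f. fps_nth f n"] by (simp add: delta_box fps_nth_sum_fps_X_power finite_box)
  then obtain \<beta> where "bij_betw \<beta> {..<V} box" "\<And>c. c \<in> {..<V} \<Longrightarrow> height (\<beta> c) = g c"
    by (rule bij_betw_of_fibre_cards[OF finite_lessThan finite_box], blast)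
  then show thesis using that by simp
qed

lemma height_eq_0_iff:
  assumes "b \<in> box"
  shows "height b = 0 \<longleftrightarrow> b = (\<lambda>_. 0)"
proof
  assume "height b = 0"
  then have "sum b I = 0" using height[OF assms] by simp
  then have "\<forall>i\<in>I. b i = 0" using sum_nonneg_eq_0_iff[OF fin boxD(2)[OF assms]] by simp
  then show "b = (\<lambda>_. 0)" using boxD(4)[OF assms] by auto
qed (simp add: height_def)

text \<open>Translation by \<open>b\<close> modulo 1 permutes the box; comparing the sums of all elements before and
  after gives the order bound.\<close>

lemma card_box_mult_Ints:
  assumes b: "b \<in> box" and i: "i \<in> I"
  shows "real (card box) * b i \<in> \<int>"
proof -
  let ?s = "\<lambda>x. frac_part (\<lambda>i. x i + b i)"
  have into: "?s x \<in> box" if "x \<in> box" for x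
    using that b by (intro frac_part_in_box coord_lattice_add boxD(1))
  have "inj_on ?s box"
  proof (rule inj_onI)
    fix x y assume xy: "x \<in> box" "y \<in> box" "?s x = ?s y"
    show "x = y"
      using xy(1,2)
    proof (rule box_eqI)
      fix k assume k: "k \<in> I"
      have "?s x k = ?s y k" using xy(3) by simp
      then show "x k - y k \<in> \<int>"
        using Ints_diff[OF frac_part_diff[OF k, of "\<lambda>i. x i + b i"] frac_part_diff[OF k, of "\<lambda>i. y i + b i"]]
        by simp
    qed
  qed
  then have "?s ` box = box" using into finite_box by (intro endo_inj_surj) auto
  then have "(\<Sum>x\<in>box. x i) = (\<Sum>x\<in>box. ?s x i)"
    using sum.reindex[OF \<open>inj_on ?s box\<close>, of "\<lambda>x. x i"] by simp
  moreover have "(\<Sum>x\<in>box. (x i + b i) - ?s x i) \<in> \<int>"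
    by (intro Ints_sum frac_part_diff[OF i])
  ultimately show ?thesis by (simp add: sum_subtractf sum.distrib)
qed

text \<open>By the order bound the size of the box is a common denominator of all coordinates; types
  are the numerators.\<close>

lemma box_type:
  assumes "b \<in> box"
  obtains t where "\<And>i. i \<in> I \<Longrightarrow> real (t i) = real (card box) * b i" "\<And>i. i \<in> I \<Longrightarrow> t i < card box"
proof -
  have "\<exists>n<card box. real n = real (card box) * b i" if i: "i \<in> I" for i
  proof -
    obtain z where z: "real (card box) * b i = of_int z"
      using card_box_mult_Ints[OF assms i] by (auto elim: Ints_cases)
    have "box \<noteq> {}" using assms by auto
    then have pos: "0 < card box" using finite_box by (simp add: card_gt_0_iff)
    have "0 \<le> real_of_int z" using boxD(2)[OF assms i] unfolding z[symmetric] by simp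
    then have "real (nat z) = real (card box) * b i" using z by simp
    moreover have "real (card box) * b i < real (card box)" using boxD(3)[OF assms i] pos by simp
    ultimately show ?thesis by (intro exI[of _ "nat z"]) linarith
  qed
  then have "\<exists>t. \<forall>i\<in>I. t i < card box \<and> real (t i) = real (card box) * b i" by metis
  then show thesis using that by blast
qed

text \<open>Reduced modulo 1, the multiples of \<open>g\<close> already differ in the coordinate
  \<open>p\<close>, whose numerator is a unit modulo \<open>V\<close>. Hence there are
  \<open>V\<close> of them and they exhaust the box.\<close>

lemma cyclic_box:
  fixes t :: "'a \<Rightarrow> nat"
  defines "V \<equiv> card box"
  defines "m \<equiv> \<lambda>c i. if i \<in> I then cyc V c (t i) else 0"
  assumes g: "g \<in> box" and t: "\<And>i. i \<in> I \<Longrightarrow> real (t i) = real V * g i"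
    and p: "p \<in> I" "coprime (t p) V"
  shows "bij_betw m {..<V} box" "coord_lattice = char_lattice I V (cyc V) t"
proof -
  have "box \<noteq> {}" using g by auto
  then have V: "V > 0" using finite_box by (simp add: V_def card_gt_0_iff)
  have into: "m c \<in> box" for c
  proof -
    have "(\<lambda>i. real c * g i) \<in> coord_lattice"
    proof (induction c)
      case 0
      then show ?case using zero_in_box boxD(1) by simp
    next
      case (Suc c)
      then show ?case using coord_lattice_add[OF Suc boxD(1)[OF g]] by (simp add: algebra_simps)
    qed
    then have "frac_part (\<lambda>i. real c * g i) \<in> box" by (rule frac_part_in_box)
    moreover have "m c i = frac_part (\<lambda>i. real c * g i) i" for i
    proof (cases "i \<in> I")
      case True
      have "real c * g i = real (c * t i) / real V" using t[OF True] V by simp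
      then have Z: "cyc V c (t i) - real c * g i \<in> \<int>" using cyc_mod_Ints[OF V, of c "t i"] by simp
      have "0 \<le> cyc V c (t i)" "cyc V c (t i) < 1" using V by (auto simp: cyc_def)
      then have "frac (real c * g i) = cyc V c (t i)"
        using Ints_minus[OF Z] by (simp add: frac_unique_iff)
      then show ?thesis using True by (simp add: m_def frac_part_def)
    qed (simp add: m_def frac_part_def)
    ultimately show ?thesis by presburger
  qed
  have "inj_on m {..<V}"
  proof (rule inj_onI)
    fix c c' assume c: "c \<in> {..<V}" "c' \<in> {..<V}" "m c = m c'"
    have "cyc V c (t p) = cyc V c' (t p)" using fun_cong[OF c(3), of p] p(1) by (simp add: m_def)
    then have "c * t p mod V = c' * t p mod V" using V by (simp add: cyc_def)
    then have "int (c * t p) mod int V = int (c' * t p) mod int V" by (metis zmod_int)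
    then have "int V dvd (int c - int c') * int (t p)"
      by (simp add: mod_eq_dvd_iff left_diff_distrib)
    moreover have "coprime (int V) (int (t p))" using p(2) by (simp add: coprime_commute)
    ultimately have "int V dvd int c - int c'" by (simp add: coprime_dvd_mult_left_iff)
    show "c = c'"
    proof (rule ccontr)
      assume "c \<noteq> c'"
      then have "\<bar>int V\<bar> \<le> \<bar>int c - int c'\<bar>"
        using \<open>int V dvd int c - int c'\<close> by (intro dvd_imp_le_int) simp_all
      then show False using c(1,2) by auto
    qed
  qed
  moreover have "m ` {..<V} = box"
    using into finite_box \<open>inj_on m {..<V}\<close>
    by (intro card_subset_eq) (auto simp: card_image V_def)
  ultimately show bij: "bij_betw m {..<V} box" by (simp add: bij_betw_def)
  have "l \<in> coord_lattice \<longleftrightarrow> l \<in> char_lattice I V (cyc V) t" for l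
    unfolding coord_lattice_iff_box bij_betw_imp_surj_on[OF bij, symmetric]
    by (auto simp: char_lattice_def m_def)
  then show "coord_lattice = char_lattice I V (cyc V) t" by blast
qed

text \<open>The enumeration is arbitrary apart from its zero, but in a group of exponent 2 with four
  elements the sum of two distinct nonzero elements must be the third one. The whole box is thus
  known from where \<open>\<beta> 1\<close> and \<open>\<beta> 2\<close> vanish.\<close>

lemma klein_box:
  assumes \<beta>: "bij_betw \<beta> {..<4} box" "\<beta> 0 = (\<lambda>_. 0)"
    and order: "\<forall>b\<in>box. \<forall>i\<in>I. 2 * b i \<in> \<int>"
  obtains t where "\<And>i. i \<in> I \<Longrightarrow> t i < 4" "\<And>c i. c < 4 \<Longrightarrow> i \<in> I \<Longrightarrow> \<beta> c i = klein c (t i)"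
    "coord_lattice = char_lattice I 4 klein t"
proof -
  have box: "\<beta> c \<in> box" if "c < 4" for c using \<beta>(1) that by (auto simp: bij_betw_def)
  have neq: "\<beta> c \<noteq> \<beta> c'" if "c < 4" "c' < 4" "c \<noteq> c'" for c c'
    using \<beta>(1) that by (auto simp: bij_betw_def inj_on_def)
  have half: "b i = 0 \<or> b i = 1 / 2" if "b \<in> box" "i \<in> I" for b i
  proof -
    obtain n where "2 * b i = of_int n" using order \<open>b \<in> box\<close> \<open>i \<in> I\<close> by (blast elim: Ints_cases)
    moreover have "0 \<le> b i" "b i < 1" using boxD that by blast+
    ultimately have "n = 0 \<or> n = 1" by linarith
    then show ?thesis using \<open>2 * b i = of_int n\<close> by auto
  qed
  \<comment> \<open>The group sum of \<open>\<beta> 1\<close> and \<open>\<beta> 2\<close>;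
    excluding the indices 0, 1 and 2 for it leaves only 3.\<close>
  let ?s = "frac_part (\<lambda>i. \<beta> 1 i + \<beta> 2 i)"
  have s: "?s \<in> box" by (intro frac_part_in_box coord_lattice_add boxD(1) box) simp_all
  have sZ: "\<beta> 1 i + \<beta> 2 i - ?s i \<in> \<int>" if "i \<in> I" for i
    using frac_part_diff[OF that, of "\<lambda>i. \<beta> 1 i + \<beta> 2 i"] .
  obtain c where c: "c < 4" "?s = \<beta> c" 
    using s bij_betw_imp_surj_on[OF \<beta>(1), symmetric] by blast
  have "c \<noteq> 0"
  proof
    assume "c = 0"
    then have "?s = (\<lambda>_. 0)" using c \<beta>(2) by simp
    have "\<beta> 1 = \<beta> 2"
    proof (rule box_eqI)
      fix i assume i: "i \<in> I"
      have "\<beta> 1 i + \<beta> 2 i \<in> \<int>" using sZ[OF i] \<open>?s = (\<lambda>_. 0)\<close> by simp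
      \<comment> \<open>The sum and the difference of two coordinates differ by twice the second
        one, which is integral.\<close>
      from Ints_diff[OF this bspec[OF bspec[OF order box[of 2]] i]] show "\<beta> 1 i - \<beta> 2 i \<in> \<int>" by simp
    qed (simp_all add: box)
    then show False using neq[of 1 2] by simp
  qed
  moreover have "c \<noteq> 1"
  proof
    assume "c = 1"
    have "\<beta> 2 = (\<lambda>_. 0)"
    proof (rule box_eqI)
      show "\<beta> 2 i - 0 \<in> \<int>" if "i \<in> I" for i
        using sZ[OF that] c(2) \<open>c = 1\<close> by simp
    qed (simp_all add: box zero_in_box)
    then show False using neq[of 2 0] \<beta>(2) by simp
  qed
  moreover have "c \<noteq> 2"
  proof
    assume "c = 2"
    have "\<beta> 1 = (\<lambda>_. 0)"
    proof (rule box_eqI)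
      show "\<beta> 1 i - 0 \<in> \<int>" if "i \<in> I" for i
        using sZ[OF that] c(2) \<open>c = 2\<close> by simp
    qed (simp_all add: box zero_in_box)
    then show False using neq[of 1 0] \<beta>(2) by simp
  qed
  ultimately have "c = 3" using c(1) by linarith
  then have s3: "?s = \<beta> 3" using c(2) by simp
  \<comment> \<open>A nonzero type is the label of the only nonzero element vanishing at this
    vertex; type 0 means that all elements vanish there.\<close>
  define t where "t i = (if \<beta> 1 i = 0 then if \<beta> 2 i = 0 then 0 else 1 else if \<beta> 2 i = 0 then 2 else (3::nat))" for i
  have t: "\<beta> c i = klein c (t i)" if "c < 4" "i \<in> I" for c i
  proof -
    let ?x = "\<beta> 1 i + \<beta> 2 i - \<beta> 3 i"
    have "?x \<in> \<int>" using sZ[OF that(2)] by (simp only: s3)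
    then have x: "?x \<noteq> 1 / 2" "?x \<noteq> - (1 / 2)" using Ints_less_1[of ?x] by auto
    have h: "\<beta> 1 i = 0 \<or> \<beta> 1 i = 1 / 2" "\<beta> 2 i = 0 \<or> \<beta> 2 i = 1 / 2" "\<beta> 3 i = 0 \<or> \<beta> 3 i = 1 / 2"
      using half box that(2) by simp_all
    then have "\<beta> 3 i = (if \<beta> 1 i = \<beta> 2 i then 0 else 1 / 2)"
      using x by (elim disjE) simp_all
    moreover have "c = 0 \<or> c = 1 \<or> c = 2 \<or> c = 3" using that(1) by auto
    ultimately show ?thesis using \<beta>(2) h(1,2) by (auto simp: t_def klein_def)
  qed
  have "l \<in> coord_lattice \<longleftrightarrow> l \<in> char_lattice I 4 klein t" for l
    unfolding coord_lattice_iff_box bij_betw_imp_surj_on[OF \<beta>(1), symmetric]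
    by (auto simp: char_lattice_def t)
  then have "coord_lattice = char_lattice I 4 klein t" by blast
  moreover have "t i < 4" for i by (simp add: t_def)
  ultimately show thesis using that t by blast
qed

lemma delta_char_lattice:
  assumes "coord_lattice = char_lattice I V \<psi> t"
    and "\<And>c x. c < V \<Longrightarrow> 0 \<le> \<psi> c x \<and> \<psi> c x < 1"
    and "\<And>c c'. c < V \<Longrightarrow> c' < V \<Longrightarrow> \<forall>i\<in>I. \<psi> c (t i) = \<psi> c' (t i) \<Longrightarrow> c = c'"
    and "\<And>c. c < V \<Longrightarrow> real (h c) = (\<Sum>i\<in>I. \<psi> c (t i))"
  shows "delta d (convex hull (v ` I)) = (\<Sum>c<V. fps_X ^ h c)"
  by (rule delta_eq_sum_heights[where b = "\<lambda>c i. \<psi> c (t i)"])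
    (use assms in \<open>auto simp: char_lattice_def\<close>)

lemma char_in_coord_lattice:
  assumes "coord_lattice = char_lattice I V \<psi> t" "c < V"
  shows "(\<lambda>i. \<psi> c (t i)) \<in> coord_lattice"
  using assms by (auto simp: char_lattice_def)

lemma not_lattice_pyramid_char_lattice:
  assumes "coord_lattice = char_lattice I V \<psi> t" "\<And>i. i \<in> I \<Longrightarrow> \<exists>c<V. \<psi> c (t i) \<notin> \<int>"
  shows "\<not> lattice_pyramid d (convex hull (v ` I))"
  using not_lattice_pyramid char_in_coord_lattice[OF assms(1)] assms(2) by meson

end

section \<open>A vertex of type 0 makes the simplex a lattice pyramid\<close>

lemma bij_betw_extend:
  assumes "bij_betw \<tau> {..<n} A" "j \<notin> A"
  shows "bij_betw (\<tau>(n := j)) {..<Suc n} (insert j A)"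
proof -
  have in_A: "\<tau> x \<in> A" if "x < n" for x
    using assms(1) that by (auto simp: bij_betw_def)
  have "(\<tau>(n := j)) ` {..<n} = A"
    using assms(1) by (auto simp: bij_betw_def)
  then have "(\<tau>(n := j)) ` {..<Suc n} = insert j A"
    unfolding lessThan_Suc image_insert by simp
  moreover have "inj_on (\<tau>(n := j)) {..<Suc n}"
  proof (rule inj_onI)
    fix x y assume "x \<in> {..<Suc n}" "y \<in> {..<Suc n}" "(\<tau>(n := j)) x = (\<tau>(n := j)) y"
    then show "x = y"
      using in_A[of x] in_A[of y] assms(2) bij_betw_imp_inj_on[OF assms(1)]
      by (auto simp: less_Suc_eq inj_on_def split: if_splits)
  qed
  ultimately show ?thesis by (simp add: bij_betw_def)
qed

lemma bij_betw_lessThan_card: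
  assumes "finite A"
  obtains \<tau> where "bij_betw \<tau> {..<card A} A"
  using ex_bij_betw_nat_finite[OF assms] by (auto simp: atLeast0LessThan)

text \<open>Deleting the vertex \<open>j\<close> leaves types that still sum to a multiple of
  \<open>m\<close>, by integrality of the height of the generator. With a vertex of type 1 placed
  last they are realized by an explicit simplex, which serves as the base.\<close>

lemma lattice_pyramid_cyclic:
  assumes "lattice_simplex d I v"
    and coords: "lattice_simplex.coord_lattice d I v = char_lattice I m (cyc m) t"
    and m: "m > 1" and u: "u * u mod m = 1 mod m"
    and p: "p \<in> I" "u * t p mod m = 1" and j: "j \<in> I" "t j = 0"
  shows "lattice_pyramid d (convex hull (v ` I))"
proof -
  interpret lattice_simplex d I v by fact
  \<comment> \<open>Scaling by \<open>u\<close> changes the generator so that \<open>p\<close> gets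
    type 1, while \<open>j\<close> keeps type 0.\<close>
  define s where "s i = u * t i mod m" for i
  have s: "coord_lattice = char_lattice I m (cyc m) s"
    unfolding coords s_def using m u by (intro char_lattice_cyc_mult[symmetric]) simp_all
  have sp: "s p = 1" and sj: "s j = 0" using p j by (simp_all add: s_def)
  then have "p \<noteq> j" by auto
  have "card (I - {p, j}) = card I - card {p, j}"
    using fin p(1) j(1) by (intro card_Diff_subset) auto
  then have "card (I - {p, j}) + 1 = d" using card_I \<open>p \<noteq> j\<close> card_mono[OF fin, of "{p, j}"] p(1) j(1) by simp
  then obtain e where d: "d = Suc e" and e: "card (I - {p, j}) = e" by auto
  obtain \<tau>0 where \<tau>0: "bij_betw \<tau>0 {..<e} (I - {p, j})" using bij_betw_lessThan_card[of "I - {p, j}"] fin e by auto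
  \<comment> \<open>The explicit base needs the vertex of type 1 in its last position
    \<open>e\<close>; the prospective apex comes after it.\<close>
  define \<tau> where "\<tau> = \<tau>0(e := p, Suc e := j)"
  have "bij_betw (\<tau>0(e := p, Suc e := j)) {..<Suc (Suc e)} (insert j (insert p (I - {p, j})))"
    using \<open>p \<noteq> j\<close> by (intro bij_betw_extend \<tau>0) auto
  moreover have "insert j (insert p (I - {p, j})) = I" using p(1) j(1) by auto
  ultimately have \<tau>: "bij_betw \<tau> {..Suc e} I" by (simp add: \<tau>_def lessThan_Suc_atMost)
  let ?t = "s \<circ> \<tau>"
  note w = lattice_simplex_reindex[OF \<tau>] char_lattice_reindex[OF \<tau> s]
  have te: "?t e = 1" "?t (Suc e) = 0" using sp sj by (simp_all add: \<tau>_def)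
  have "(\<lambda>i. cyc m 1 (?t i)) \<in> lattice_simplex.coord_lattice d {..Suc e} (v \<circ> \<tau>)"
    using m lattice_simplex.char_in_coord_lattice[OF w, of 1] by simp
  then have "(\<Sum>i\<le>Suc e. cyc m 1 (?t i)) \<in> \<int>"
    by (simp only: lattice_simplex.coord_lattice_def[OF w(1)] mem_Collect_eq)
  moreover have "(\<Sum>i\<le>Suc e. cyc m 1 (?t i)) = real (sum ?t {..e}) / real m"
    using te by (simp add: cyc_def s_def sum_divide_distrib)
  ultimately obtain z where "real (sum ?t {..e}) / real m = of_int z" by (auto elim: Ints_cases)
  then have "real_of_int (int (sum ?t {..e})) = of_int (int m * z)" using m by (simp add: field_simps)
  then have "int (sum ?t {..e}) = int m * z" by (simp only: of_int_eq_iff)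
  then have dvd: "m dvd sum ?t {..e}" by (metis dvd_triv_left int_dvd_int_iff)
  \<comment> \<open>For \<open>e = 0\<close> the only remaining type would be 1, which
    \<open>m > 1\<close> does not divide.\<close>
  have "1 \<le> e"
  proof (rule ccontr)
    assume "\<not> 1 \<le> e"
    then have "e = 0" by simp
    then show False using dvd te m by simp
  qed
  note u = cyclic_simplex[OF \<open>1 \<le> e\<close> _ te(1) _ dvd, of "\<lambda>k. - int (?t k)"]
  have "lattice_pyramid (Suc e) (convex hull ((v \<circ> \<tau>) ` {..Suc e}))"
    by (rule lattice_pyramid_of_char_lattice[OF w[unfolded d] u te(2)]) (use m in \<open>simp_all add: cyc_def\<close>)
  moreover have "(v \<circ> \<tau>) ` {..Suc e} = v ` I"
    by (subst image_comp[symmetric]) (simp only: bij_betw_imp_surj_on[OF \<tau>])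
  ultimately show ?thesis by (simp add: d)
qed

text \<open>As in the cyclic case, with two vertices of different nonzero types relabelled to 1 and
  2 and placed last, as the explicit simplex for the Klein group demands.\<close>

lemma lattice_pyramid_klein:
  assumes "lattice_simplex d I v"
    and coords: "lattice_simplex.coord_lattice d I v = char_lattice I 4 klein t"
    and t4: "\<And>i. i \<in> I \<Longrightarrow> t i < 4"
    and p: "p \<in> I" "t p \<noteq> 0" and q: "q \<in> I" "t q \<noteq> 0" "t q \<noteq> t p" and j: "j \<in> I" "t j = 0"
  shows "lattice_pyramid d (convex hull (v ` I))"
proof -
  interpret lattice_simplex d I v by fact
  obtain \<pi> where \<pi>: "bij_betw \<pi> {..<4} {..<4}" "\<pi> 0 = 0" "\<pi> (t p) = 1" "\<pi> (t q) = (2::nat)"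
  proof -
    \<comment> \<open>The one nonzero label that is neither \<open>t p\<close> nor
      \<open>t q\<close> is sent to 3.\<close>
    let ?\<pi> = "\<lambda>z. if z = 0 then 0 else if z = t p then 1 else if z = t q then 2 else (3::nat)"
    have "inj_on ?\<pi> {..<4}"
    proof (rule inj_onI)
      fix x y assume "x \<in> {..<4}" "y \<in> {..<4}" "?\<pi> x = ?\<pi> y"
      moreover have "t p < 4" "t q < 4" using t4 p q by blast+
      ultimately show "x = y" using p(2) q(2,3)
        unfolding lessThan_iff by (simp split: if_split_asm; presburger)
    qed
    moreover from this have "?\<pi> ` {..<4} = {..<4}" by (intro endo_inj_surj) auto
    ultimately have "bij_betw ?\<pi> {..<4} {..<4}" by (simp only: bij_betw_def)
    then show thesis using that[of ?\<pi>] p q by simp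
  qed
  define s where "s = \<pi> \<circ> t"
  have s: "coord_lattice = char_lattice I 4 klein s"
    unfolding coords s_def using \<pi>(1,2) t4 by (intro char_lattice_klein_relabel[symmetric])
  have s4: "s i < 4" if "i \<in> I" for i using bij_betwE[OF \<pi>(1)] t4[OF that] by (simp add: s_def)
  have sp: "s p = 1" "s q = 2" "s j = 0" using \<pi> j by (simp_all add: s_def)
  then have neq: "p \<noteq> j" "q \<noteq> j" "p \<noteq> q" by auto
  have "card (I - {p, q, j}) = card I - card {p, q, j}"
    using fin p(1) q(1) j(1) by (intro card_Diff_subset) auto
  then have "card (I - {p, q, j}) + 2 = d"
    using card_I neq card_mono[OF fin, of "{p, q, j}"] p(1) q(1) j(1) by simp
  then obtain n where d: "d = Suc (Suc n)" and n: "card (I - {p, q, j}) = n" by auto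
  obtain \<tau>0 where \<tau>0: "bij_betw \<tau>0 {..<n} (I - {p, q, j})"
    using bij_betw_lessThan_card[of "I - {p, q, j}"] fin n by auto
  define \<tau> where "\<tau> = \<tau>0(n := q, Suc n := p, Suc (Suc n) := j)"
  have "bij_betw (\<tau>0(n := q, Suc n := p, Suc (Suc n) := j)) {..<Suc (Suc (Suc n))}
      (insert j (insert p (insert q (I - {p, q, j}))))"
    using neq by (intro bij_betw_extend \<tau>0) auto
  moreover have "insert j (insert p (insert q (I - {p, q, j}))) = I" using p(1) q(1) j(1) by auto
  ultimately have \<tau>: "bij_betw \<tau> {..Suc (Suc n)} I" by (simp add: \<tau>_def lessThan_Suc_atMost)
  let ?t = "s \<circ> \<tau>"
  note w = lattice_simplex_reindex[OF \<tau>] char_lattice_reindex[OF \<tau> s]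
  have te: "?t n = 2" "?t (Suc n) = 1" "?t (Suc (Suc n)) = 0" using sp by (simp_all add: \<tau>_def)
  have sums: "(\<Sum>k\<le>Suc n. klein c (?t k)) \<in> \<int>" if "c < 4" for c
  proof -
    have "(\<lambda>i. klein c (?t i)) \<in> lattice_simplex.coord_lattice d {..Suc (Suc n)} (v \<circ> \<tau>)"
      using that by (rule lattice_simplex.char_in_coord_lattice[OF w])
    then have "(\<Sum>i\<le>Suc (Suc n). klein c (?t i)) \<in> \<int>"
      by (simp only: lattice_simplex.coord_lattice_def[OF w(1)] mem_Collect_eq)
    then show ?thesis using te(3) by (simp add: klein_def)
  qed
  \<comment> \<open>With only the vertices of types 2 and 1 left, the element 2 would have height
    1/2.\<close>
  have "n \<noteq> 0"
  proof
    assume "n = 0"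
    then have "(1 / 2 :: real) \<in> \<int>" using sums[of 2] te by (simp add: klein_def)
    then show False using Ints_less_1[of "1/2"] by simp
  qed
  then obtain e where e: "n = Suc e" using not0_implies_Suc by blast
  have t4': "?t k < 4" if "k \<le> Suc (Suc e)" for k
    using s4 bij_betwE[OF \<tau>] that e by simp
  have "lattice_pyramid (Suc (Suc (Suc e))) (convex hull ((v \<circ> \<tau>) ` {..Suc (Suc (Suc e))}))"
    by (rule lattice_pyramid_of_char_lattice[OF w[unfolded d e] klein_simplex[OF te(1,2)[unfolded e] t4',
          of "\<lambda>k. if ?t k \<in> {2, 3} then 1 else 0" "\<lambda>k. if ?t k \<in> {1, 3} then 1 else 0"] te(3)[unfolded e]])
      (use sums[unfolded e] in \<open>simp_all add: klein_def\<close>)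
  moreover have "(v \<circ> \<tau>) ` {..Suc (Suc n)} = v ` I"
    by (subst image_comp[symmetric]) (simp only: bij_betw_imp_surj_on[OF \<tau>])
  ultimately show ?thesis by (simp add: d e)
qed

lemma sum_by_type:
  fixes f :: "nat \<Rightarrow> 'b :: comm_semiring_1"
  assumes "finite I" "\<And>i. i \<in> I \<Longrightarrow> t i < m"
  shows "(\<Sum>i\<in>I. f (t i)) = (\<Sum>x<m. of_nat (card {i \<in> I. t i = x}) * f x)"
proof -
  have "(\<Sum>i\<in>I. f (t i)) = (\<Sum>x<m. \<Sum>i\<in>{i \<in> I. t i = x}. f (t i))"
    using assms by (intro sum.group[symmetric]) auto
  also have "\<dots> = (\<Sum>x<m. of_nat (card {i \<in> I. t i = x}) * f x)"
    by (intro sum.cong) auto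
  finally show ?thesis .
qed

section \<open>The five families\<close>

text \<open>The constant term is treated as exponent 0 at index 0, matching the zero element of the
  box, so that exponents and group elements share the index set \<open>{..<V}\<close>.\<close>

lemma fps_of_poly_exponents:
  fixes V :: nat and i :: "nat \<Rightarrow> nat"
  assumes "1 \<le> V"
  shows "fps_of_poly (1 + (\<Sum>j = 1..V - 1. monom 1 (i j))) =
    (\<Sum>c<V. fps_X ^ (if c = 0 then 0 else i c) :: int fps)"
proof -
  have "{..<V} = insert 0 {1..V - 1}" using assms by auto
  moreover have "(\<Sum>j = 1..V - 1. fps_X ^ (if j = 0 then 0 else i j)) = (\<Sum>j = 1..V - 1. fps_X ^ i j :: int fps)"
    by (intro sum.cong) auto
  ultimately show ?thesis
    by (simp add: fps_of_poly_add fps_of_poly_sum fps_of_poly_monom')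
qed

text \<open>The vertex of type 1 tells the group elements apart, so the heights of the multiples
  give the \<open>\<delta>\<close>-polynomial. As no type is 0, the generator has a nonintegral
  coordinate at every vertex, which excludes a pyramid.\<close>

lemma (in lattice_simplex) nonpyramidal_cyclic:
  assumes coords: "coord_lattice = char_lattice I m (cyc m) t"
    and t: "\<And>i. i \<in> I \<Longrightarrow> 0 < t i \<and> t i < m" and p: "p \<in> I" "t p = 1"
    and h: "\<And>c. c < m \<Longrightarrow> (\<Sum>i\<in>I. c * t i mod m) = m * h c"
    and P: "fps_of_poly P = (\<Sum>c<m. fps_X ^ h c)"
  shows "nonpyramidal_simplex d P (convex hull (v ` I))"
proof -
  have m: "m > 1" using t[OF p(1)] p(2) by simp
  have "delta d (convex hull (v ` I)) = (\<Sum>c<m. fps_X ^ h c)"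
    using coords
  proof (rule delta_char_lattice)
    show "0 \<le> cyc m c x \<and> cyc m c x < 1" for c x using m by (simp add: cyc_def)
    show "c = c'" if "c < m" "c' < m" "\<forall>i\<in>I. cyc m c (t i) = cyc m c' (t i)" for c c'
      using bspec[OF that(3) p(1)] that(1,2) p(2) m by (simp add: cyc_def)
    show "real (h c) = (\<Sum>i\<in>I. cyc m c (t i))" if "c < m" for c
      using m arg_cong[OF h[OF that], of real]
      by (simp add: cyc_def sum_divide_distrib[symmetric] field_simps del: of_nat_mult flip: of_nat_sum)
        (simp add: mult.commute)
  qed
  moreover have "\<not> lattice_pyramid d (convex hull (v ` I))"
    using coords
  proof (rule not_lattice_pyramid_char_lattice)
    fix i assume i: "i \<in> I"
    have "cyc m 1 (t i) \<noteq> 0" "\<bar>cyc m 1 (t i)\<bar> < 1" using t[OF i] by (simp_all add: cyc_def)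
    then show "\<exists>c<m. cyc m c (t i) \<notin> \<int>" using m Ints_less_1 by blast
  qed
  ultimately show ?thesis
    using lattice_polytope is_simplex P by (simp add: nonpyramidal_simplex_def)
qed

text \<open>Vertices of types 1 and 2 tell the four elements apart. At each vertex a nonzero element
  with a label other than the type has coordinate 1/2, so no coordinate is integral
  throughout.\<close>

lemma (in lattice_simplex) nonpyramidal_klein:
  assumes coords: "coord_lattice = char_lattice I 4 klein t"
    and t: "\<And>i. i \<in> I \<Longrightarrow> 0 < t i \<and> t i < 4" and pq: "p \<in> I" "t p = 1" "q \<in> I" "t q = 2"
    and h: "\<And>c. c < 4 \<Longrightarrow> (\<Sum>i\<in>I. klein c (t i)) = real (h c)"
    and P: "fps_of_poly P = (\<Sum>c<4. fps_X ^ h c)"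
  shows "nonpyramidal_simplex d P (convex hull (v ` I))"
proof -
  have "delta d (convex hull (v ` I)) = (\<Sum>c<4. fps_X ^ h c)"
    using coords
  proof (rule delta_char_lattice)
    show "0 \<le> klein c x \<and> klein c x < 1" for c x by (simp add: klein_def)
    show "c = c'" if "c < 4" "c' < 4" "\<forall>i\<in>I. klein c (t i) = klein c' (t i)" for c c'
    proof -
      have "klein c 1 = klein c' 1" "klein c 2 = klein c' 2"
        using bspec[OF that(3) pq(1)] bspec[OF that(3) pq(3)] pq by simp_all
      moreover have "c = 0 \<or> c = 1 \<or> c = 2 \<or> c = 3" "c' = 0 \<or> c' = 1 \<or> c' = 2 \<or> c' = 3"
        using that(1,2) by auto
      ultimately show ?thesis by (elim disjE) (simp_all add: klein_def)
    qed
    show "real (h c) = (\<Sum>i\<in>I. klein c (t i))" if "c < 4" for c using h[OF that] by simp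
  qed
  moreover have "\<not> lattice_pyramid d (convex hull (v ` I))"
    using coords
  proof (rule not_lattice_pyramid_char_lattice)
    fix i assume i: "i \<in> I"
    define c where "c = (if t i = 1 then 2 else 1 :: nat)"
    have "klein c (t i) = 1 / 2" "c < 4" using t[OF i] by (auto simp: klein_def c_def)
    then have "klein c (t i) \<notin> \<int>" using Ints_less_1[of "klein c (t i)"] by auto
    then show "\<exists>c<4. klein c (t i) \<notin> \<int>" using \<open>c < 4\<close> by blast
  qed
  ultimately show ?thesis
    using lattice_polytope is_simplex P by (simp add: nonpyramidal_simplex_def)
qed

text \<open>The element \<open>b\<close> generates the box because its numerator at \<open>p\<close>
  is a unit, and this unit, being its own inverse, also feeds the pyramid criterion that excludes
  type 0. The permutation \<open>\<pi>\<close> tells which exponent belongs to which multiple of the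
  generator.\<close>

lemma (in lattice_simplex) cyclic_classification:
  fixes t :: "'a \<Rightarrow> nat"
  assumes \<beta>: "bij_betw \<beta> {..<V} box" "\<beta> 0 = (\<lambda>_. 0)" "\<And>c. c < V \<Longrightarrow> height (\<beta> c) = g c"
    and V: "V > 1" and nonpyr: "\<not> lattice_pyramid d (convex hull (v ` I))"
    and b: "b \<in> box" and t: "\<And>i. i \<in> I \<Longrightarrow> real (t i) = real V * b i"
    and p: "p \<in> I" "coprime (t p) V" "t p * t p mod V = 1"
  obtains \<pi> where "coord_lattice = char_lattice I V (cyc V) t" "\<And>i. i \<in> I \<Longrightarrow> 0 < t i \<and> t i < V"
    "bij_betw \<pi> {..<V} {..<V}" "\<pi> 0 = 0" "\<And>c. c < V \<Longrightarrow> (\<Sum>i\<in>I. c * t i mod V) = V * g (\<pi> c)"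
proof -
  have card: "card box = V" using bij_betw_same_card[OF \<beta>(1)] by simp
  define m where "m c i = (if i \<in> I then cyc V c (t i) else 0)" for c i
  have m: "bij_betw m {..<V} box" and coords: "coord_lattice = char_lattice I V (cyc V) t"
    using cyclic_box[OF b _ p(1), of t] t p(2) unfolding card m_def by blast+
  have tV: "t i < V" if "i \<in> I" for i
  proof -
    have "real (t i) < real V * 1"
      unfolding t[OF that] using boxD(3)[OF b that] V by (intro mult_strict_left_mono) auto
    then show ?thesis by simp
  qed
  have "t i \<noteq> 0" if "i \<in> I" for i
  proof
    assume "t i = 0"
    then have "lattice_pyramid d (convex hull (v ` I))"
      using lattice_pyramid_cyclic[OF lattice_simplex_axioms coords V _ p(1) p(3) that] p(3) V by simp
    then show False using nonpyr by simp
  qed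
  \<comment> \<open>The multiple \<open>m c\<close> is looked up in the enumeration
    \<open>\<beta>\<close> by exponents.\<close>
  moreover define \<pi> where "\<pi> c = the_inv_into {..<V} \<beta> (m c)" for c
  have "bij_betw \<pi> {..<V} {..<V}"
    using bij_betw_trans[OF m bij_betw_the_inv_into[OF \<beta>(1)]] by (simp add: \<pi>_def[abs_def] comp_def)
  moreover have "m 0 = \<beta> 0" by (simp add: m_def \<beta>(2) cyc_def fun_eq_iff)
  then have "\<pi> 0 = 0"
    using the_inv_into_f_f[OF bij_betw_imp_inj_on[OF \<beta>(1)], of 0] V by (simp add: \<pi>_def)
  moreover have "(\<Sum>i\<in>I. c * t i mod V) = V * g (\<pi> c)" if "c < V" for c
  proof -
    have mc: "m c \<in> box" using bij_betwE[OF m] that by blast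
    then have "\<beta> (\<pi> c) = m c"
      using f_the_inv_into_f_bij_betw[OF \<beta>(1)] by (simp add: \<pi>_def)
    moreover have "\<pi> c < V" using bij_betwE[OF \<open>bij_betw \<pi> {..<V} {..<V}\<close>] that by simp
    ultimately have "height (m c) = g (\<pi> c)" using \<beta>(3) by metis
    then have "real (g (\<pi> c)) = (\<Sum>i\<in>I. cyc V c (t i))"
      using height[OF mc] by (simp add: m_def)
    also have "\<dots> = real (\<Sum>i\<in>I. c * t i mod V) / real V"
      by (simp add: cyc_def sum_divide_distrib)
    finally have "real (\<Sum>i\<in>I. c * t i mod V) = real (V * g (\<pi> c))"
      using V by (simp add: field_simps)
    then show ?thesis by (simp only: of_nat_eq_iff)
  qed
  ultimately show thesis using that coords tV by blast
qed

definition unit_simplex_with :: "nat \<Rightarrow> point \<Rightarrow> point set" where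
  "unit_simplex_with d y = {0} \<union> unit_vec ` {1..d - 1} \<union> {y}"

lemma cyclic_simplex_vertices:
  fixes a :: "nat \<Rightarrow> int" and t :: "nat \<Rightarrow> nat"
  assumes "1 \<le> d" "m > 0" "t d = 1" "\<And>k. k \<in> {1..<d} \<Longrightarrow> int m dvd a k + int (t k)" "m dvd sum t {..d}"
    and y: "\<And>k. y k = (if k \<in> {1..<d} then of_int (a k) else if k = d then real m else 0)"
  obtains w where "lattice_simplex d {..d} w"
    "lattice_simplex.coord_lattice d {..d} w = char_lattice {..d} m (cyc m) t"
    "w ` {..d} = unit_simplex_with d y"
proof -
  have "y = (\<lambda>k. if k \<in> {1..<d} then of_int (a k) else if k = d then real m else 0)"
    using y by blast
  note w = cyclic_simplex[OF assms(1-5), folded this]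
  have "{..d} = insert 0 (insert d {1..d - 1})" using assms(1) by auto
  then have "(\<lambda>k. if k = 0 then 0 else if k < d then unit_vec k else y) ` {..d} = unit_simplex_with d y"
    using assms(1) by (auto simp: unit_simplex_with_def)
  with w show thesis using that by blast
qed

lemma F2_simplex:
  assumes "d + 1 = 2 * i 1" "d \<ge> 1"
  obtains w where "lattice_simplex d {..d} w"
    "lattice_simplex.coord_lattice d {..d} w = char_lattice {..d} 2 (cyc 2) (\<lambda>_. 1)"
    "w ` {..d} = vertices F2 d i"
proof -
  let ?y = "(\<Sum>k\<in>{1..d - 1}. unit_vec k) + 2 *\<^sub>R unit_vec d"
  obtain w where w: "lattice_simplex d {..d} w"
    "lattice_simplex.coord_lattice d {..d} w = char_lattice {..d} 2 (cyc 2) (\<lambda>_. 1)"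
    "w ` {..d} = unit_simplex_with d ?y"
  proof (rule cyclic_simplex_vertices[of d 2 "\<lambda>_. 1" "\<lambda>_. 1" ?y])
    show "?y k = (if k \<in> {1..<d} then of_int 1 else if k = d then real 2 else 0)" for k
      using assms(2) by (auto simp: sum_unit_vec unit_vec_apply)
    show "2 dvd (\<Sum>k\<le>d. 1 :: nat)" using assms(1) by simp
  qed (use assms in auto)
  then show thesis using that by (simp add: unit_simplex_with_def)
qed

text \<open>Coefficient 2 means type 1 and coefficient 1 means type 2. The unit vectors and the last
  vertex supply \<open>k\<close> vertices of type 1 and \<open>k - 1\<close> of type 2, so the
  origin gets type 2 to make the sum of the types \<open>3 * k\<close>.\<close>

lemma F3_simplex:
  assumes "d + 1 = i 1 + i 2" "i 1 = k" "i 2 = k" "k \<ge> 1"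
  obtains w t where "lattice_simplex d {..d} w"
    "lattice_simplex.coord_lattice d {..d} w = char_lattice {..d} 3 (cyc 3) t"
    "w ` {..d} = vertices F3 d i" "\<And>j. 0 < t j \<and> t j < 3" "t d = 1"
    "card {j \<in> {..d}. t j = 1} = k" "card {j \<in> {..d}. t j = 2} = k"
proof -
  define t where "t j = (if j = 0 then 2 else if j = d then 1 else if j < k then 1 else 2 :: nat)" for j
  have d: "d = 2 * k - 1" and "1 \<le> d" using assms by (simp, linarith)
  have "{j \<in> {..d}. t j = 1} = insert d {1..k - 1}" using assms(4) by (auto simp: t_def d)
  moreover have "\<not> d \<le> k - 1" using assms(4) d by simp
  ultimately have N1: "card {j \<in> {..d}. t j = 1} = k" using assms(4) by simp
  have "{j \<in> {..d}. t j = 2} = insert 0 {k..<d}" using assms(4) by (auto simp: t_def d)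
  then have N2: "card {j \<in> {..d}. t j = 2} = k" using assms(4) by (simp add: d)
  have t3: "0 < t j \<and> t j < 3" for j by (simp add: t_def)
  then have "card {j \<in> {..d}. t j = 0} = 0" by (auto simp: card_eq_0_iff) 
  then have "sum t {..d} = 3 * k"
    using sum_by_type[of "{..d}" t 3 "\<lambda>x. x"] t3 N1 N2 by (simp add: eval_nat_numeral)
  let ?y = "2 *\<^sub>R (\<Sum>k\<in>{1..2 * i 2 - i 1 - 1} - {d}. unit_vec k)
      + (\<Sum>k\<in>{2 * i 2 - i 1..d - 1}. unit_vec k) + 3 *\<^sub>R unit_vec d"
  obtain w where w: "lattice_simplex d {..d} w"
    "lattice_simplex.coord_lattice d {..d} w = char_lattice {..d} 3 (cyc 3) t"
    "w ` {..d} = unit_simplex_with d ?y"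
  proof (rule cyclic_simplex_vertices[of d 3 t "\<lambda>j. if j < k then 2 else 1" ?y])
    show "?y j = (if j \<in> {1..<d} then of_int (if j < k then 2 else 1) else if j = d then real 3 else 0)" for j
      using assms by (auto simp: sum_unit_vec unit_vec_apply)
    show "3 dvd sum t {..d}" using \<open>sum t {..d} = 3 * k\<close> by simp
  qed (use \<open>1 \<le> d\<close> in \<open>auto simp: t_def\<close>)
  moreover have "w ` {..d} = vertices F3 d i" using w(3) by (simp add: unit_simplex_with_def)
  moreover have "t d = 1" using \<open>1 \<le> d\<close> by (simp add: t_def)
  ultimately show thesis using that t3 N1 N2 by blast
qed

text \<open>The common shape of the families \<open>F4_1\<close> and \<open>F4_2\<close>, which differ in whether the element of order
  2 in the cyclic group has height \<open>i 2\<close> or \<open>i 1\<close>; \<open>h1, h2, h3\<close> are the heights of the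
  generator and its multiples.\<close>

definition quarter_vertices :: "nat \<Rightarrow> nat \<Rightarrow> nat \<Rightarrow> nat \<Rightarrow> point set" where
  "quarter_vertices d h1 h2 h3 = {0} \<union> unit_vec ` {1..d - 1} \<union>
     {2 *\<^sub>R (\<Sum>k\<in>{1..h1 + h3 - 2 * h2}. unit_vec k)
      + (\<Sum>k\<in>{h1 + h3 - 2 * h2 + 1..2 * h1 - h2} - {d}. unit_vec k)
      + 3 *\<^sub>R (\<Sum>k\<in>{2 * h1 - h2 + 1..d - 1}. unit_vec k)
      + 4 *\<^sub>R unit_vec d}"

text \<open>The coefficients 2, 1, 3 on the ranges up to \<open>B\<close>, from there to
  \<open>C\<close>, and beyond \<open>C\<close> give the types 2, 3, 1, their negatives modulo 4.
  The thresholds are tuned to the counts in the conclusion, whose types sum to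
  \<open>4 * h1\<close>, the numerator of the height \<open>h1\<close> of the generator.\<close>

lemma quarter_simplex:
  assumes d: "d + 1 = h1 + h3" and h: "2 * h2 \<le> h1 + h3" "h3 \<le> h1 + h2" "h1 \<le> h3" "1 \<le> h1" "1 \<le> h2"
  obtains w t where "lattice_simplex d {..d} w"
    "lattice_simplex.coord_lattice d {..d} w = char_lattice {..d} 4 (cyc 4) t"
    "w ` {..d} = quarter_vertices d h1 h2 h3" "\<And>j. 0 < t j \<and> t j < 4" "t d = 1"
    "card {j \<in> {..d}. t j = 1} = h2 + h3 - h1" "card {j \<in> {..d}. t j = 2} = h1 + h3 - 2 * h2"
    "card {j \<in> {..d}. t j = 3} = h1 + h2 - h3"
proof -
  define B where "B = h1 + h3 - 2 * h2"
  define C where "C = 2 * h1 - h2"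
  \<comment> \<open>The type of the origin is forced by the divisibility of the sum. Normally it is
    1; if \<open>C = d\<close>, the middle range would run into index \<open>d\<close>, which
    already has type 1, and the origin takes over the missing type 3.\<close>
  define t where "t j = (if j = 0 then if C = d then 3 else 1 else if j = d then 1
    else if j \<le> B then 2 else if j \<le> C then 3 else 1 :: nat)" for j
  have BC: "B \<le> C" "C \<le> d" "B < d" "C - B = h1 + h2 - h3" "d + 1 - C = h2 + h3 - h1" "1 \<le> d"
    using d h by (auto simp: B_def C_def)
  have N: "card {j \<in> {..d}. t j = 1} = d + 1 - C \<and> card {j \<in> {..d}. t j = 3} = C - B"
  proof (cases "C = d")
    case True
    have "{j \<in> {..d}. t j = 1} = {d}" "{j \<in> {..d}. t j = 3} = insert 0 {B<..<d}"
      using BC True by (auto simp: t_def)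
    then show ?thesis using True BC by simp
  next
    case False
    have "{j \<in> {..d}. t j = 1} = insert 0 {C<..d}" "{j \<in> {..d}. t j = 3} = {B<..C}"
      using BC False by (auto simp: t_def)
    then show ?thesis using BC by simp
  qed
  have "{j \<in> {..d}. t j = 2} = {1..B}" using BC by (auto simp: t_def)
  then have N2: "card {j \<in> {..d}. t j = 2} = B" by simp
  have t4: "0 < t j \<and> t j < 4" for j by (simp add: t_def)
  then have "card {j \<in> {..d}. t j = 0} = 0" by (auto simp: card_eq_0_iff) 
  then have "sum t {..d} = (d + 1 - C) + 2 * B + 3 * (C - B)"
    using sum_by_type[of "{..d}" t 4 "\<lambda>x. x"] t4 N N2 by (simp add: eval_nat_numeral)
  also have "\<dots> = 4 * h1" using BC h d by (simp add: B_def)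
  finally have sum_t: "sum t {..d} = 4 * h1" .
  let ?y = "2 *\<^sub>R (\<Sum>k\<in>{1..h1 + h3 - 2 * h2}. unit_vec k)
      + (\<Sum>k\<in>{h1 + h3 - 2 * h2 + 1..2 * h1 - h2} - {d}. unit_vec k)
      + 3 *\<^sub>R (\<Sum>k\<in>{2 * h1 - h2 + 1..d - 1}. unit_vec k)
      + 4 *\<^sub>R unit_vec d"
  obtain w where w: "lattice_simplex d {..d} w"
    "lattice_simplex.coord_lattice d {..d} w = char_lattice {..d} 4 (cyc 4) t"
    "w ` {..d} = unit_simplex_with d ?y"
  proof (rule cyclic_simplex_vertices[of d 4 t "\<lambda>j. if j \<le> B then 2 else if j \<le> C then 1 else 3" ?y])
    show "?y j = (if j \<in> {1..<d} then of_int (if j \<le> B then 2 else if j \<le> C then 1 else 3)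
      else if j = d then real 4 else 0)" for j
      unfolding B_def[symmetric] C_def[symmetric] using BC
      by (auto simp: sum_unit_vec unit_vec_apply)
    show "4 dvd sum t {..d}" using sum_t by simp
  qed (use BC in \<open>auto simp: t_def\<close>)
  moreover have "w ` {..d} = quarter_vertices d h1 h2 h3"
    using w(3) by (simp only: unit_simplex_with_def quarter_vertices_def)
  moreover have "t d = 1" using BC by (simp add: t_def)
  ultimately show thesis using that[of w t] t4 N N2 BC by (simp add: B_def)
qed

text \<open>The unit vectors below \<open>R\<close> have type 1, those from \<open>R\<close> to
  below \<open>S\<close> type 2, and those from \<open>S\<close> on type 3. Solving for the three
  type counts in terms of the heights gives these thresholds.\<close>

lemma F4_3_simplex:
  assumes d: "d + 1 = i 1 + i 2 + i 3" and i: "1 \<le> i 1" "i 1 \<le> i 2" "i 2 \<le> i 3" "i 3 \<le> i 1 + i 2"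
  obtains w t where "lattice_simplex d {..d} w"
    "lattice_simplex.coord_lattice d {..d} w = char_lattice {..d} 4 klein t"
    "w ` {..d} = vertices F4_3 d i" "\<And>j. 0 < t j \<and> t j < 4" "t d = 1" "t (d - 1) = 2"
    "card {j \<in> {..d}. t j = 1} = i 2 + i 3 - i 1" "card {j \<in> {..d}. t j = 2} = i 1 + i 3 - i 2"
    "card {j \<in> {..d}. t j = 3} = i 1 + i 2 - i 3"
proof -
  define e where "e = d - 2"
  have de: "d = Suc (Suc e)" using d i by (simp add: e_def)
  define R where "R = i 2 + i 3 - i 1"
  define S where "S = 2 * i 3 - 1"
  \<comment> \<open>The origin has type 3 unless there is no vertex of type 3, which happens exactly
    when \<open>i 3 = i 1 + i 2\<close>; then it supplies the last vertex of type 2.\<close>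
  define t where "t j = (if j = 0 then if i 3 = i 1 + i 2 then 2 else 3
    else if j = Suc (Suc e) then 1 else if j = Suc e then 2
    else if j < R then 1 else if j < S then 2 else 3 :: nat)" for j
  have RS: "1 \<le> R" "R \<le> Suc e" "R \<le> S" "S \<le> e + 2" "S = e + 2 \<longleftrightarrow> i 3 = i 1 + i 2"
    "S - R + 1 = i 1 + i 3 - i 2" "e + 2 - S = i 1 + i 2 - i 3"
    using d i de by (auto simp: R_def S_def)
  have "{j \<in> {..d}. t j = 1} = insert d {1..<R}" using RS by (auto simp: t_def de)
  then have N1: "card {j \<in> {..d}. t j = 1} = R" using RS by (simp add: de)
  have N: "card {j \<in> {..d}. t j = 2} = S - R + 1 \<and> card {j \<in> {..d}. t j = 3} = e + 2 - S"
  proof (cases "i 3 = i 1 + i 2")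
    case True
    then have S: "S = e + 2" using RS by simp
    have "{j \<in> {..d}. t j = 2} = insert 0 (insert (Suc e) {R..e})" "{j \<in> {..d}. t j = 3} = {}"
      using RS True S by (auto simp: t_def de)
    then show ?thesis using RS S by simp
  next
    case False
    then have S: "S \<le> e + 1" using RS by simp
    have "{j \<in> {..d}. t j = 2} = insert (Suc e) {R..<S}" "{j \<in> {..d}. t j = 3} = insert 0 {S..e}"
      using RS False S by (auto simp: t_def de)
    then show ?thesis using RS S by simp
  qed
  have t4: "0 < t j \<and> t j < 4" for j by (simp add: t_def)
  then have N0: "card {j \<in> {..d}. t j = 0} = 0" by (auto simp: card_eq_0_iff) 
  have sums: "(\<Sum>k\<le>Suc (Suc e). klein c (t k)) \<in> \<int>" if "c < 4" for c
  proof -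
    have N': "real (card {j \<in> {..d}. t j = 1}) = real (i 2) + real (i 3) - real (i 1)"
      "real (card {j \<in> {..d}. t j = 2}) = real (i 1) + real (i 3) - real (i 2)"
      "real (card {j \<in> {..d}. t j = 3}) = real (i 1) + real (i 2) - real (i 3)"
      using N1 N RS i by (simp_all add: R_def)
    have "(\<Sum>k\<le>d. klein c (t k)) = (\<Sum>x<4. real (card {j \<in> {..d}. t j = x}) * klein c x)"
      using t4 by (intro sum_by_type) auto
    then have "(\<Sum>k\<le>d. klein c (t k)) = (real (i 2) + real (i 3) - real (i 1)) * klein c 1
        + (real (i 1) + real (i 3) - real (i 2)) * klein c 2
        + (real (i 1) + real (i 2) - real (i 3)) * klein c 3"
      using N0 N' by (simp add: eval_nat_numeral)
    also have "\<dots> = real (if c = 0 then 0 else i c)"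
    proof -
      have "c = 0 \<or> c = 1 \<or> c = 2 \<or> c = 3" using that by auto
      then show ?thesis by (elim disjE) (simp_all add: klein_def field_simps)
    qed
    finally have "(\<Sum>k\<le>d. klein c (t k)) \<in> \<int>" by (metis Ints_of_nat)
    then show ?thesis by (simp only: de)
  qed
  \<comment> \<open>The parities prescribed by \<open>klein_simplex\<close>: \<open>?a\<close> is
    odd at the types 2 and 3, \<open>?b\<close> at the types 1 and 3.\<close>
  let ?a = "\<lambda>j. if R \<le> j then 1 else 0 :: int" and ?b = "\<lambda>j. if j < R \<or> S \<le> j then 1 else 0 :: int"
  let ?y = "\<lambda>k. if k \<in> {1..e} then of_int (?a k) else if k = Suc e then 2 else (0 :: real)"
    and ?z = "\<lambda>k. if k \<in> {1..e} then of_int (?b k) else if k = Suc (Suc e) then 2 else (0 :: real)"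
  define w where "w k = (if k = 0 then 0 else if k \<le> e then unit_vec k else if k = Suc e then ?y else ?z)" for k
  have te: "t (Suc e) = 2" "t (Suc (Suc e)) = 1" by (simp_all add: t_def)
  have a: "odd (?a k) \<longleftrightarrow> t k \<in> {2, 3}" and b: "odd (?b k) \<longleftrightarrow> t k \<in> {1, 3}" if "k \<in> {1..e}" for k
    using that RS by (auto simp: t_def)
  note w = klein_simplex[OF te _ a b sums, simplified t4, simplified, folded w_def de]
  have "w ` {..d} = {0} \<union> unit_vec ` {1..d - 2} \<union> {?y, ?z}"
  proof -
    have "{..d} = insert 0 (insert (Suc e) (insert (Suc (Suc e)) {1..e}))" by (auto simp: de)
    then show ?thesis by (auto simp: w_def de)
  qed
  moreover have "?y = (\<Sum>k\<in>{i 2 + i 3 - i 1..d - 2}. unit_vec k) + 2 *\<^sub>R unit_vec (d - 1)"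
    unfolding R_def[symmetric] using RS by (auto simp: fun_eq_iff sum_unit_vec unit_vec_apply de)
  moreover have "?z = (\<Sum>k\<in>{1..i 2 + i 3 - i 1 - 1}. unit_vec k)
      + (\<Sum>k\<in>{2 * i 3 - 1..d - 2}. unit_vec k) + 2 *\<^sub>R unit_vec d"
    unfolding R_def[symmetric] S_def[symmetric]
    using RS by (auto simp: fun_eq_iff sum_unit_vec unit_vec_apply de)
  ultimately have "w ` {..d} = vertices F4_3 d i" by (simp only: vertices.simps)
  then show thesis using that[of w t] w t4 te N1 N RS by (simp add: R_def de)
qed

section \<open>The listed simplices have the required properties\<close>

text \<open>The cyclic group of order 3 is covered too: it has no vertices of type 3.\<close>

lemma sum_by_type_4:
  fixes f :: "nat \<Rightarrow> nat"
  assumes "finite I" "\<And>i. i \<in> I \<Longrightarrow> 0 < t i \<and> t i < 4"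
  shows "(\<Sum>i\<in>I. f (t i)) = card {i \<in> I. t i = 1} * f 1 + card {i \<in> I. t i = 2} * f 2
    + card {i \<in> I. t i = 3} * f 3"
proof -
  have "{..<4} = {0, 1, 2, 3::nat}" by auto
  moreover have "{i \<in> I. t i = 0} = {}" using assms(2) by fastforce
  ultimately show ?thesis
    using sum_by_type[of I t 4 f] assms by simp
qed

lemma fibre_cards_eq_4:
  assumes "\<And>i. i \<in> I \<Longrightarrow> 0 < t i \<and> t i < (4 :: nat)" "\<And>j. j \<in> J \<Longrightarrow> 0 < t' j \<and> t' j < (4 :: nat)"
    and "card {i \<in> I. t i = 1} = card {j \<in> J. t' j = 1}" "card {i \<in> I. t i = 2} = card {j \<in> J. t' j = 2}"
      "card {i \<in> I. t i = 3} = card {j \<in> J. t' j = 3}"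
  shows "card {i \<in> I. t i = x} = card {j \<in> J. t' j = x}"
proof (cases "x \<in> {1, 2, 3}")
  case True
  then show ?thesis using assms(3-5) by auto
next
  case False
  have "t i \<in> {1, 2, 3}" if "i \<in> I" for i using assms(1)[OF that] by auto
  moreover have "t' j \<in> {1, 2, 3}" if "j \<in> J" for j using assms(2)[OF that] by auto
  ultimately have "{i \<in> I. t i = x} = {}" "{j \<in> J. t' j = x} = {}" using False by blast+
  then show ?thesis by (simp only: card.empty)
qed

text \<open>The polynomial does not show which exponent is the height of the element of order 2, so
  the families \<open>F4_1\<close> and \<open>F4_2\<close> are both instances.\<close>

lemma nonpyramidal_quarter:
  assumes d: "d + 1 = h1 + h3" and h: "2 * h2 \<le> h1 + h3" "h3 \<le> h1 + h2" "h1 \<le> h3" "1 \<le> h1" "1 \<le> h2"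
    and P: "fps_of_poly P = 1 + fps_X ^ h1 + fps_X ^ h2 + fps_X ^ h3"
  shows "nonpyramidal_simplex d P (convex hull (quarter_vertices d h1 h2 h3))"
proof -
  obtain w t where w: "lattice_simplex d {..d} w"
    "lattice_simplex.coord_lattice d {..d} w = char_lattice {..d} 4 (cyc 4) t"
    "w ` {..d} = quarter_vertices d h1 h2 h3" and t: "\<And>j. 0 < t j \<and> t j < 4" "t d = 1"
    and N: "card {j \<in> {..d}. t j = 1} = h2 + h3 - h1" "card {j \<in> {..d}. t j = 2} = h1 + h3 - 2 * h2"
    "card {j \<in> {..d}. t j = 3} = h1 + h2 - h3"
    using quarter_simplex[OF d h] by blast
  interpret lattice_simplex d "{..d}" w by (rule w(1))
  define g where "g c = (if c = 0 then 0 else if c = 1 then h1 else if c = 2 then h2 else h3)" for c :: nat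
  have "nonpyramidal_simplex d P (convex hull (w ` {..d}))"
    using w(2) t(1)
  proof (rule nonpyramidal_cyclic[where p = d and h = g])
    show "(\<Sum>i\<le>d. c * t i mod 4) = 4 * g c" if "c < 4" for c
    proof -
      have "c = 0 \<or> c = 1 \<or> c = 2 \<or> c = 3" using that by auto
      then show ?thesis
        unfolding sum_by_type_4[where I = "{..d}" and t = t and f = "\<lambda>x. c * x mod 4", OF finite_atMost t(1)] N
        using h by (elim disjE) (simp_all add: g_def)
    qed
    have "{..<4} = {0, 1, 2, 3::nat}" by auto
    then show "fps_of_poly P = (\<Sum>c<4. fps_X ^ g c)" by (simp add: P g_def add_ac)
  qed (simp_all add: t)
  then show ?thesis by (simp only: w(3))
qed

lemma nonpyramidal_family:
  assumes d: "d \<ge> 1" and i1: "\<forall>j\<in>{1..V - 1}. 1 \<le> i j \<and> i j \<le> d" and mono: "mono_on {1..V - 1} i"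
    and V3: "V = 3 \<longrightarrow> 2 * i 1 \<ge> i 2 \<and> i 2 \<le> (d + 1) div 2"
    and V4: "V = 4 \<longrightarrow> i 3 \<le> i 1 + i 2 \<and> i 1 + i 3 \<le> d + 1 \<and> i 2 \<le> (d + 1) div 2"
    and occ: "occurs F V d i"
  shows "nonpyramidal_simplex d (1 + (\<Sum>j = 1..V - 1. monom 1 (i j))) (convex hull (vertices F d i))"
proof -
  let ?g = "\<lambda>c. if c = 0 then 0 else i c"
  let ?P = "1 + (\<Sum>j = 1..V - 1. monom 1 (i j)) :: int poly"
  have "V \<ge> 1" using occ by (cases F) auto
  then have P: "fps_of_poly ?P = (\<Sum>c<V. fps_X ^ ?g c)" by (rule fps_of_poly_exponents)
  have four: "{..<4} = {0, 1, 2, 3::nat}" by auto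
  have order: "1 \<le> i 1" "1 \<le> i 2" "1 \<le> i 3" "i 1 \<le> i 2" "i 2 \<le> i 3" if "V = 4"
    using i1 that mono by (auto simp: mono_on_def)
  show ?thesis
  proof (cases F)
    case F2
    then have V: "V = 2" "d + 1 = 2 * i 1" using occ by auto
    obtain w where w: "lattice_simplex d {..d} w"
      "lattice_simplex.coord_lattice d {..d} w = char_lattice {..d} 2 (cyc 2) (\<lambda>_. 1)"
      "w ` {..d} = vertices F2 d i"
      using F2_simplex[where d = d and i = i, OF V(2) d] by blast
    have "nonpyramidal_simplex d ?P (convex hull (w ` {..d}))"
    proof (rule lattice_simplex.nonpyramidal_cyclic[OF w(1,2), where p = d and h = ?g])
      show "(\<Sum>i\<le>d. c * 1 mod 2) = 2 * ?g c" if "c < 2" for c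
      proof -
        have "c = 0 \<or> c = 1" using that by auto
        then show ?thesis using V(2) by auto
      qed
      show "fps_of_poly ?P = (\<Sum>c<2. fps_X ^ ?g c)" using P by (simp only: V)
    qed simp_all
    then show ?thesis by (simp only: w(3) F2)
  next
    case F3
    then have V: "V = 3" "d + 1 = i 1 + i 2" using occ by auto
    have "i 1 \<le> i 2" "1 \<le> i 1" using mono i1 V(1) by (auto simp: mono_on_def)
    \<comment> \<open>From \<open>d + 1 = i 1 + i 2\<close> and
      \<open>i 2 \<le> (d + 1) div 2\<close> follows \<open>i 2 \<le> i 1\<close>, hence
      equality.\<close>
    then have k: "i 1 = i 2" "i 2 \<ge> 1" using V3 V by auto
    obtain w t where w: "lattice_simplex d {..d} w"
      "lattice_simplex.coord_lattice d {..d} w = char_lattice {..d} 3 (cyc 3) t"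
      "w ` {..d} = vertices F3 d i" and t: "\<And>j. 0 < t j \<and> t j < 3" "t d = 1"
      and N: "card {j \<in> {..d}. t j = 1} = i 2" "card {j \<in> {..d}. t j = 2} = i 2"
      using F3_simplex[where d = d and i = i and k = "i 2", OF V(2) k(1) refl k(2)] by blast
    have t4: "0 < t j \<and> t j < 4" for j using t(1)[of j] by simp
    have N3: "card {j \<in> {..d}. t j = 3} = 0" using t(1) by (auto simp: card_eq_0_iff) (metis less_irrefl)
    have "nonpyramidal_simplex d ?P (convex hull (w ` {..d}))"
    proof (rule lattice_simplex.nonpyramidal_cyclic[OF w(1,2), where p = d and h = ?g])
      show "(\<Sum>i\<le>d. c * t i mod 3) = 3 * ?g c" if "c < 3" for c
      proof -
        have "c = 0 \<or> c = 1 \<or> c = 2" using that by auto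
        then show ?thesis
          unfolding sum_by_type_4[where I = "{..d}" and t = t and f = "\<lambda>x. c * x mod 3", OF finite_atMost t4] N N3
          using k(1) by (elim disjE) simp_all
      qed
      show "fps_of_poly ?P = (\<Sum>c<3. fps_X ^ ?g c)" using P by (simp only: V)
    qed (simp_all add: t)
    then show ?thesis by (simp only: w(3) F3)
  next
    case F4_1
    then have V: "V = 4" "2 * i 2 \<le> i 1 + i 3" "d + 1 = i 1 + i 3" using occ by auto
    have "vertices F4_1 d i = quarter_vertices d (i 1) (i 2) (i 3)"
      by (simp only: vertices.simps quarter_vertices_def)
    moreover have "nonpyramidal_simplex d ?P (convex hull (quarter_vertices d (i 1) (i 2) (i 3)))"
      using V order V4 P[unfolded V(1) four] by (intro nonpyramidal_quarter) (simp_all add: add_ac)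
    ultimately show ?thesis by (simp only: F4_1)
  next
    case F4_2
    then have V: "V = 4" "d + 1 = i 2 + i 3" using occ by auto
    have "vertices F4_2 d i = quarter_vertices d (i 2) (i 1) (i 3)"
      by (simp only: vertices.simps quarter_vertices_def)
    moreover have "nonpyramidal_simplex d ?P (convex hull (quarter_vertices d (i 2) (i 1) (i 3)))"
      using V order V4 P[unfolded V(1) four] by (intro nonpyramidal_quarter) (simp_all add: add_ac)
    ultimately show ?thesis by (simp only: F4_2)
  next
    case F4_3
    then have V: "V = 4" "d + 1 = i 1 + i 2 + i 3" using occ by auto
    obtain w t where w: "lattice_simplex d {..d} w"
      "lattice_simplex.coord_lattice d {..d} w = char_lattice {..d} 4 klein t"
      "w ` {..d} = vertices F4_3 d i" and t: "\<And>j. 0 < t j \<and> t j < 4" "t d = 1" "t (d - 1) = 2"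
      and N: "card {j \<in> {..d}. t j = 1} = i 2 + i 3 - i 1" "card {j \<in> {..d}. t j = 2} = i 1 + i 3 - i 2"
        "card {j \<in> {..d}. t j = 3} = i 1 + i 2 - i 3"
      using F4_3_simplex[where d = d and i = i, OF V(2) order(1,4,5)] V4 V(1) by blast
    have "nonpyramidal_simplex d ?P (convex hull (w ` {..d}))"
    proof (rule lattice_simplex.nonpyramidal_klein[OF w(1,2), where p = d and q = "d - 1" and h = ?g])
      show "(\<Sum>i\<le>d. klein c (t i)) = real (?g c)" if "c < 4" for c
      proof -
        \<comment> \<open>As no type is 0, twice the character sum is a plain count of the vertices
          whose type differs from \<open>c\<close>.\<close>
        have "(\<Sum>j\<le>d. klein c (t j)) = (\<Sum>j\<le>d. real (if c = 0 \<or> c = t j then 0 else 1) / 2)"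
          using t(1) by (intro sum.cong) (auto simp: klein_def)
        also have "\<dots> = real (\<Sum>j\<le>d. if c = 0 \<or> c = t j then 0 else 1) / 2"
          by (simp only: of_nat_sum sum_divide_distrib)
        also have "(\<Sum>j\<le>d. if c = 0 \<or> c = t j then 0 else 1) = 2 * ?g c"
        proof -
          have "c = 0 \<or> c = 1 \<or> c = 2 \<or> c = 3" using that by auto
          then show ?thesis
            unfolding sum_by_type_4[where I = "{..d}" and t = t and f = "\<lambda>x. if c = 0 \<or> c = x then 0 else 1", OF finite_atMost t(1)] N
            using order V V4 by (elim disjE) simp_all
        qed
        finally show ?thesis by simp
      qed
      show "fps_of_poly ?P = (\<Sum>c<4. fps_X ^ ?g c)" using P by (simp only: V)
    qed (use t(3) in \<open>simp_all add: t(1,2)\<close>)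
    then show ?thesis by (simp only: w(3) F4_3)
  qed
qed

section \<open>Recovering the family from heights and types\<close>

text \<open>The heights of the three nonzero multiples are linear equations for the numbers of
  vertices of types 1, 2, 3, and they have a unique solution. Adding the equations of the generator
  and its inverse gives the dimension; nonnegativity of the counts gives the inequalities needed for
  the explicit simplex.\<close>

lemma equivalent_to_quarter:
  assumes I: "lattice_simplex d I v" and coords: "lattice_simplex.coord_lattice d I v = char_lattice I 4 (cyc 4) t"
    and t: "\<And>i. i \<in> I \<Longrightarrow> 0 < t i \<and> t i < 4"
    and H: "(\<Sum>i\<in>I. 1 * t i mod 4) = 4 * h1" "(\<Sum>i\<in>I. 2 * t i mod 4) = 4 * h2" "(\<Sum>i\<in>I. 3 * t i mod 4) = 4 * h3"
    and le: "h1 \<le> h3" "1 \<le> h1" "1 \<le> h2"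
  shows "d + 1 = h1 + h3" "2 * h2 \<le> h1 + h3"
    "unimodularly_equivalent d (convex hull (v ` I)) d (convex hull (quarter_vertices d h1 h2 h3))"
proof -
  interpret lattice_simplex d I v by fact
  let ?N = "\<lambda>x. card {i \<in> I. t i = x}"
  have N: "?N 1 + 2 * ?N 2 + 3 * ?N 3 = 4 * h1" "2 * ?N 1 + 2 * ?N 3 = 4 * h2"
    "3 * ?N 1 + 2 * ?N 2 + ?N 3 = 4 * h3"
    using H sum_by_type_4[where t = t and f = "\<lambda>x. 1 * x mod 4", OF fin t] sum_by_type_4[where t = t and f = "\<lambda>x. 2 * x mod 4", OF fin t]
      sum_by_type_4[where t = t and f = "\<lambda>x. 3 * x mod 4", OF fin t] by simp_all
  have total: "?N 1 + ?N 2 + ?N 3 = d + 1"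
    using sum_by_type_4[where t = t and f = "\<lambda>_. 1", OF fin t] card_I by simp
  show d: "d + 1 = h1 + h3" and h2: "2 * h2 \<le> h1 + h3" using N total by linarith+
  have h3: "h3 \<le> h1 + h2" using N by linarith
  obtain w s where w: "lattice_simplex d {..d} w"
    "lattice_simplex.coord_lattice d {..d} w = char_lattice {..d} 4 (cyc 4) s"
    "w ` {..d} = quarter_vertices d h1 h2 h3" and s: "\<And>j. 0 < s j \<and> s j < 4" "s d = 1"
    and M: "card {j \<in> {..d}. s j = 1} = h2 + h3 - h1" "card {j \<in> {..d}. s j = 2} = h1 + h3 - 2 * h2"
    "card {j \<in> {..d}. s j = 3} = h1 + h2 - h3"
    using quarter_simplex[OF d h2 h3 le] by blast
  have N': "?N 1 = h2 + h3 - h1" "?N 2 = h1 + h3 - 2 * h2" "?N 3 = h1 + h2 - h3"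
    using N total by linarith+
  have "card {i \<in> I. t i = x} = card {j \<in> {..d}. s j = x}" for x
    by (rule fibre_cards_eq_4[where t = t and t' = s, OF t s(1)]) (simp_all only: M N')
  then show "unimodularly_equivalent d (convex hull (v ` I)) d (convex hull (quarter_vertices d h1 h2 h3))"
    using unimodularly_equivalent_same_type[OF I w(1) coords w(2)] by (simp only: w(3))
qed

context lattice_simplex
begin

lemma box_nonzero:
  assumes \<beta>: "bij_betw \<beta> {..<V} box" "\<beta> 0 = (\<lambda>_. 0)" and c: "c < V" "c \<noteq> (0 :: nat)"
  shows "\<exists>x\<in>I. \<beta> c x \<noteq> 0"
proof (rule ccontr)
  assume A: "\<not> (\<exists>x\<in>I. \<beta> c x \<noteq> 0)"
  have "\<beta> c \<in> box" using bij_betwE[OF \<beta>(1)] c(1) by blast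
  then have "\<beta> c x = 0" for x using A boxD(4)[of "\<beta> c" x] by blast
  then have "\<beta> c = \<beta> 0" unfolding \<beta>(2) by blast
  then show False using inj_on_eq_iff[OF bij_betw_imp_inj_on[OF \<beta>(1)], of c 0] c by simp
qed

text \<open>Modulo 2 the only nonzero type is 1, so the nonzero element has coordinate 1/2 at every
  vertex and height \<open>(d + 1) / 2\<close>.\<close>

lemma equivalent_F2:
  fixes \<beta> :: "nat \<Rightarrow> 'a \<Rightarrow> real" and i :: "nat \<Rightarrow> nat"
  assumes \<beta>: "bij_betw \<beta> {..<2} box" "\<beta> 0 = (\<lambda>_. 0)" and ht: "height (\<beta> 1) = i 1"
    and nonpyr: "\<not> lattice_pyramid d (convex hull (v ` I))" and d: "1 \<le> d"
  shows "d + 1 = 2 * i 1" "unimodularly_equivalent d (convex hull (v ` I)) d (convex hull (vertices F2 d i))"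
proof -
  have card_box: "card box = 2" using bij_betw_same_card[OF \<beta>(1)] by simp
  have box: "\<beta> 1 \<in> box" using bij_betwE[OF \<beta>(1)] by simp
  obtain t where t: "\<And>x. x \<in> I \<Longrightarrow> real (t x) = real 2 * \<beta> 1 x" "\<And>x. x \<in> I \<Longrightarrow> t x < 2"
    using box_type[OF box, unfolded card_box] by blast
  obtain p where p: "p \<in> I" "\<beta> 1 p \<noteq> 0" using box_nonzero[OF \<beta>, of 1] by auto
  have "t p \<noteq> 0" using t(1)[OF p(1)] p(2) by auto
  then have "t p = 1" using t(2)[OF p(1)] by simp
  then have "coprime (t p) 2" "t p * t p mod 2 = 1" by simp_all
  then obtain \<pi> where coords: "coord_lattice = char_lattice I 2 (cyc 2) t"
    and pos: "\<And>x. x \<in> I \<Longrightarrow> 0 < t x \<and> t x < 2"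
    and \<pi>: "bij_betw \<pi> {..<2} {..<2}" "\<pi> 0 = 0"
      "\<And>c. c < 2 \<Longrightarrow> (\<Sum>x\<in>I. c * t x mod 2) = 2 * height (\<beta> (\<pi> c))"
    using cyclic_classification[OF \<beta> refl _ nonpyr box t(1) p(1)] by auto
  have t1: "t x = 1" if "x \<in> I" for x using pos[OF that] by simp
  have "\<pi> 1 < 2" "\<pi> 1 \<noteq> \<pi> 0"
    using bij_betwE[OF \<pi>(1)] inj_on_eq_iff[OF bij_betw_imp_inj_on[OF \<pi>(1)], of 1 0] by auto
  then have "\<pi> 1 = 1" using \<pi>(2) by simp
  then show dim: "d + 1 = 2 * i 1" using \<pi>(3)[of 1] ht t1 card_I by simp
  obtain w where w: "lattice_simplex d {..d} w"
    "lattice_simplex.coord_lattice d {..d} w = char_lattice {..d} 2 (cyc 2) (\<lambda>_. 1)"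
    "w ` {..d} = vertices F2 d i"
    using F2_simplex[where d = d and i = i, OF dim d] by blast
  have "card {x \<in> I. t x = y} = card {j \<in> {..d}. 1 = y}" for y
  proof (cases "y = 1")
    case True
    have "{x \<in> I. t x = 1} = I" using t1 by blast
    then show ?thesis using card_I True by simp
  next
    case False
    then have "{x \<in> I. t x = y} = {}" "{j \<in> {..d}. 1 = y} = {}" using t1 by blast+
    then show ?thesis by (simp only: card.empty)
  qed
  then show "unimodularly_equivalent d (convex hull (v ` I)) d (convex hull (vertices F2 d i))"
    using unimodularly_equivalent_same_type[OF lattice_simplex_axioms w(1) coords w(2)] by (simp only: w(3))
qed

text \<open>A generator and its inverse have heights adding up to \<open>d + 1\<close>, whichever of
  them carries the exponent \<open>i 1\<close>. The bound on \<open>i 2\<close> makes both heights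
  equal, so the ambiguity of the generator has no effect.\<close>

lemma equivalent_F3:
  fixes \<beta> :: "nat \<Rightarrow> 'a \<Rightarrow> real" and i :: "nat \<Rightarrow> nat"
  assumes \<beta>: "bij_betw \<beta> {..<3} box" "\<beta> 0 = (\<lambda>_. 0)"
    and ht: "height (\<beta> 1) = i 1" "height (\<beta> 2) = i 2"
    and nonpyr: "\<not> lattice_pyramid d (convex hull (v ` I))"
    and i: "i 1 \<le> i 2" "i 2 \<le> (d + 1) div 2" "1 \<le> i 1"
  shows "d + 1 = i 1 + i 2"
    "unimodularly_equivalent d (convex hull (v ` I)) d (convex hull (vertices F3 d i))"
proof -
  have card_box: "card box = 3" using bij_betw_same_card[OF \<beta>(1)] by simp
  have box: "\<beta> 1 \<in> box" using bij_betwE[OF \<beta>(1)] by simp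
  obtain t where t: "\<And>x. x \<in> I \<Longrightarrow> real (t x) = real 3 * \<beta> 1 x" "\<And>x. x \<in> I \<Longrightarrow> t x < 3"
    using box_type[OF box, unfolded card_box] by blast
  obtain p where p: "p \<in> I" "\<beta> 1 p \<noteq> 0" using box_nonzero[OF \<beta>, of 1] by auto
  have "t p \<noteq> 0" using t(1)[OF p(1)] p(2) by auto
  then have "t p = 1 \<or> t p = 2" using t(2)[OF p(1)] by linarith
  then have "coprime (t p) 3" "t p * t p mod 3 = 1"
    using coprime_Suc_right_nat[of 2] by auto
  then obtain \<pi> where coords: "coord_lattice = char_lattice I 3 (cyc 3) t"
    and pos: "\<And>x. x \<in> I \<Longrightarrow> 0 < t x \<and> t x < 3"
    and \<pi>: "bij_betw \<pi> {..<3} {..<3}" "\<pi> 0 = 0"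
      "\<And>c. c < 3 \<Longrightarrow> (\<Sum>x\<in>I. c * t x mod 3) = 3 * height (\<beta> (\<pi> c))"
    using cyclic_classification[OF \<beta> refl _ nonpyr box t(1) p(1)] by auto
  have pos4: "0 < t x \<and> t x < 4" if "x \<in> I" for x using pos[OF that] by simp
  have eq: "\<pi> a = \<pi> b \<longleftrightarrow> a = b" if "a < 3" "b < 3" for a b
    using inj_on_eq_iff[OF bij_betw_imp_inj_on[OF \<pi>(1)], of a b] that by simp
  have lt: "\<pi> a < 3" if "a < 3" for a using bij_betwE[OF \<pi>(1)] that by simp
  have \<pi>12: "\<pi> 1 = 1 \<and> \<pi> 2 = 2 \<or> \<pi> 1 = 2 \<and> \<pi> 2 = 1"
    using eq[of 1 0] eq[of 2 0] eq[of 1 2] lt[of 1] lt[of 2] \<pi>(2) by simp linarith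
  let ?N = "\<lambda>y. card {x \<in> I. t x = y}"
  have "{x \<in> I. t x = 3} = {}" using pos by fastforce
  then have N3: "?N 3 = 0" by (simp only: card.empty)
  have N: "?N 1 + 2 * ?N 2 = 3 * height (\<beta> (\<pi> 1))" "2 * ?N 1 + ?N 2 = 3 * height (\<beta> (\<pi> 2))"
    using \<pi>(3)[of 1] \<pi>(3)[of 2] N3 sum_by_type_4[where t = t and f = "\<lambda>x. 1 * x mod 3", OF fin pos4]
      sum_by_type_4[where t = t and f = "\<lambda>x. 2 * x mod 3", OF fin pos4] by simp_all
  have total: "?N 1 + ?N 2 = d + 1"
    using sum_by_type_4[where t = t and f = "\<lambda>_. 1", OF fin pos4] card_I N3 by simp
  show sum: "d + 1 = i 1 + i 2" using \<pi>12
  proof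
    assume "\<pi> 1 = 1 \<and> \<pi> 2 = 2"
    then show ?thesis using N ht total by simp
  next
    assume "\<pi> 1 = 2 \<and> \<pi> 2 = 1"
    then show ?thesis using N ht total by simp
  qed
  \<comment> \<open>Here \<open>i 2 \<le> (d + 1) div 2\<close> turns
    \<open>d + 1 = i 1 + i 2\<close> into equality of the two exponents.\<close>
  then have k: "i 1 = i 2" "1 \<le> i 2" using i by simp_all
  obtain w s where w: "lattice_simplex d {..d} w"
    "lattice_simplex.coord_lattice d {..d} w = char_lattice {..d} 3 (cyc 3) s"
    "w ` {..d} = vertices F3 d i" and s: "\<And>j. 0 < s j \<and> s j < 3" "s d = 1"
    and M: "card {j \<in> {..d}. s j = 1} = i 2" "card {j \<in> {..d}. s j = 2} = i 2"
    using F3_simplex[where d = d and i = i and k = "i 2", OF sum k(1) refl k(2)] by blast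
  have s4: "0 < s j \<and> s j < 4" for j using s(1)[of j] by simp
  have "s j \<noteq> 3" for j using s(1)[of j] by simp
  then have "{j \<in> {..d}. s j = 3} = {}" by blast
  then have M3: "card {j \<in> {..d}. s j = 3} = 0" by (simp only: card.empty)
  have N': "?N 1 = i 2" "?N 2 = i 2" using N k(1) \<pi>12 ht by auto
  have "?N y = card {j \<in> {..d}. s j = y}" for y
    by (rule fibre_cards_eq_4[where t = t and t' = s, OF pos4 s4]) (simp_all only: M M3 N' N3)
  then show "unimodularly_equivalent d (convex hull (v ` I)) d (convex hull (vertices F3 d i))"
    using unimodularly_equivalent_same_type[OF lattice_simplex_axioms w(1) coords w(2)] by (simp only: w(3))
qed

text \<open>A nonzero element is 1/2 exactly at the vertices whose type differs from its label, so
  twice its height is the sum of the other two type counts. These equations determine all counts;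
  labels and exponents agree by the choice of types in \<open>klein_box\<close>.\<close>

lemma equivalent_F4_3:
  fixes \<beta> :: "nat \<Rightarrow> 'a \<Rightarrow> real" and i :: "nat \<Rightarrow> nat"
  assumes \<beta>: "bij_betw \<beta> {..<4} box" "\<beta> 0 = (\<lambda>_. 0)"
    and ht: "\<And>c. c < 4 \<Longrightarrow> c \<noteq> 0 \<Longrightarrow> height (\<beta> c) = i c"
    and nonpyr: "\<not> lattice_pyramid d (convex hull (v ` I))"
    and order: "\<forall>b\<in>box. \<forall>x\<in>I. 2 * b x \<in> \<int>"
    and i: "1 \<le> i 1" "i 1 \<le> i 2" "i 2 \<le> i 3" "i 3 \<le> i 1 + i 2"
  shows "d + 1 = i 1 + i 2 + i 3"
    "unimodularly_equivalent d (convex hull (v ` I)) d (convex hull (vertices F4_3 d i))"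
proof -
  have box: "\<beta> c \<in> box" if "c < 4" for c using bij_betwE[OF \<beta>(1)] that by simp
  obtain t where t: "\<And>x. x \<in> I \<Longrightarrow> t x < 4" "\<And>c x. c < 4 \<Longrightarrow> x \<in> I \<Longrightarrow> \<beta> c x = klein c (t x)"
    and coords: "coord_lattice = char_lattice I 4 klein t"
    using klein_box[OF \<beta> order] by blast
  \<comment> \<open>A nonzero element does not vanish at some vertex, whose type is then neither 0
    nor its own label. Applied to the element 1 this gives \<open>p\<close>; applied to the label
    \<open>t p\<close> it gives \<open>q\<close>.\<close>
  have nz: "\<exists>x\<in>I. t x \<noteq> 0 \<and> t x \<noteq> c" if c: "c < 4" "c \<noteq> 0" for c
  proof -
    obtain x where x: "x \<in> I" "\<beta> c x \<noteq> 0" using box_nonzero[OF \<beta> c] by blast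
    then show ?thesis using t(2)[OF c(1) x(1)] by (auto simp: klein_def split: if_splits)
  qed
  obtain p where p: "p \<in> I" "t p \<noteq> 0" using nz[of 1] by auto
  obtain q where q: "q \<in> I" "t q \<noteq> 0" "t q \<noteq> t p" using nz[OF t(1)[OF p(1)] p(2)] by blast
  have pos: "0 < t x \<and> t x < 4" if x: "x \<in> I" for x
    using lattice_pyramid_klein[OF lattice_simplex_axioms coords t(1) p q x] nonpyr t(1)[OF x] by blast
  let ?N = "\<lambda>y. card {x \<in> I. t x = y}"
  have total: "?N 1 + ?N 2 + ?N 3 = d + 1"
    using sum_by_type_4[where t = t and f = "\<lambda>_. 1", OF fin pos] card_I by simp
  have heights: "(\<Sum>x\<in>I. if c = t x then 0 else 1 :: nat) = 2 * i c" if c: "c < 4" "c \<noteq> 0" for c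
  proof -
    have "real (i c) = sum (\<beta> c) I" using height[OF box[OF c(1)]] ht[OF c] by simp
    also have "\<dots> = (\<Sum>x\<in>I. real (if c = t x then 0 else 1) / 2)"
    proof (rule sum.cong[OF refl])
      fix x assume "x \<in> I"
      then show "\<beta> c x = real (if c = t x then 0 else 1) / 2"
        using t(2)[OF c(1)] pos[of x] c(2) by (simp add: klein_def)
    qed
    also have "\<dots> = real (\<Sum>x\<in>I. if c = t x then 0 else 1) / 2"
      by (simp only: of_nat_sum sum_divide_distrib)
    finally have "real (\<Sum>x\<in>I. if c = t x then 0 else 1) = real (2 * i c)" by simp
    then show ?thesis by (simp only: of_nat_eq_iff)
  qed
  have H: "?N 2 + ?N 3 = 2 * i 1" "?N 1 + ?N 3 = 2 * i 2" "?N 1 + ?N 2 = 2 * i 3"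
    using heights[of 1] heights[of 2] heights[of 3]
      sum_by_type_4[where t = t and f = "\<lambda>x. if 1 = x then 0 else 1", OF fin pos]
      sum_by_type_4[where t = t and f = "\<lambda>x. if 2 = x then 0 else 1", OF fin pos]
      sum_by_type_4[where t = t and f = "\<lambda>x. if 3 = x then 0 else 1", OF fin pos] by simp_all
  show sum: "d + 1 = i 1 + i 2 + i 3" using total H by linarith
  obtain w s where w: "lattice_simplex d {..d} w"
    "lattice_simplex.coord_lattice d {..d} w = char_lattice {..d} 4 klein s"
    "w ` {..d} = vertices F4_3 d i" and s: "\<And>j. 0 < s j \<and> s j < 4" "s d = 1" "s (d - 1) = 2"
    and M: "card {j \<in> {..d}. s j = 1} = i 2 + i 3 - i 1" "card {j \<in> {..d}. s j = 2} = i 1 + i 3 - i 2"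
      "card {j \<in> {..d}. s j = 3} = i 1 + i 2 - i 3"
    using F4_3_simplex[where d = d and i = i, OF sum i] by blast
  have N: "?N 1 = i 2 + i 3 - i 1" "?N 2 = i 1 + i 3 - i 2" "?N 3 = i 1 + i 2 - i 3"
    using H by linarith+
  have "?N y = card {j \<in> {..d}. s j = y}" for y
    by (rule fibre_cards_eq_4[where t = t and t' = s, OF pos s(1)]) (simp_all only: M N)
  then show "unimodularly_equivalent d (convex hull (v ` I)) d (convex hull (vertices F4_3 d i))"
    using unimodularly_equivalent_same_type[OF lattice_simplex_axioms w(1) coords w(2)] by (simp only: w(3))
qed

text \<open>A coordinate whose double is not integral has an odd numerator over 4, so
  \<open>b\<close> generates a cyclic group of order 4. The six triples are the ways the exponents
  can be distributed over its nonzero multiples.\<close>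

lemma cyclic_heights:
  fixes \<beta> :: "nat \<Rightarrow> 'a \<Rightarrow> real" and i :: "nat \<Rightarrow> nat"
  assumes \<beta>: "bij_betw \<beta> {..<4} box" "\<beta> 0 = (\<lambda>_. 0)"
    and ht: "\<And>c. c < 4 \<Longrightarrow> c \<noteq> 0 \<Longrightarrow> height (\<beta> c) = i c"
    and nonpyr: "\<not> lattice_pyramid d (convex hull (v ` I))"
    and b: "b \<in> box" and p: "p \<in> I" "2 * b p \<notin> \<int>"
  obtains t a b c where "coord_lattice = char_lattice I 4 (cyc 4) t" "\<And>x. x \<in> I \<Longrightarrow> 0 < t x \<and> t x < 4"
    "(\<Sum>x\<in>I. 1 * t x mod 4) = 4 * i a" "(\<Sum>x\<in>I. 2 * t x mod 4) = 4 * i b" "(\<Sum>x\<in>I. 3 * t x mod 4) = 4 * i c"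
    "(a, b, c) \<in> {(1, 2, 3), (1, 3, 2), (2, 1, 3), (2, 3, 1), (3, 1, 2), (3, 2, 1)}"
proof -
  have card_box: "card box = 4" using bij_betw_same_card[OF \<beta>(1)] by simp
  obtain t where t: "\<And>x. x \<in> I \<Longrightarrow> real (t x) = real 4 * b x" "\<And>x. x \<in> I \<Longrightarrow> t x < 4"
    using box_type[OF b, unfolded card_box] by blast
  have "odd (t p)"
  proof
    assume "even (t p)"
    then obtain n where "t p = 2 * n" by (elim evenE)
    then have "2 * b p = real n" using t(1)[OF p(1)] by simp
    then show False using p(2) by simp
  qed
  then have "t p = 1 \<or> t p = 3" using t(2)[OF p(1)] by presburger
  then have "coprime (t p) 4" "t p * t p mod 4 = 1"
    using coprime_Suc_right_nat[of 3] by auto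
  then obtain \<pi> where coords: "coord_lattice = char_lattice I 4 (cyc 4) t"
    and pos: "\<And>x. x \<in> I \<Longrightarrow> 0 < t x \<and> t x < 4"
    and \<pi>: "bij_betw \<pi> {..<4} {..<4}" "\<pi> 0 = 0"
      "\<And>c. c < 4 \<Longrightarrow> (\<Sum>x\<in>I. c * t x mod 4) = 4 * height (\<beta> (\<pi> c))"
    using cyclic_classification[OF \<beta> refl _ nonpyr b t(1) p(1)] by auto
  have eq: "\<pi> a = \<pi> b \<longleftrightarrow> a = b" if "a < 4" "b < 4" for a b
    using inj_on_eq_iff[OF bij_betw_imp_inj_on[OF \<pi>(1)], of a b] that by simp
  have lt: "\<pi> a < 4" if "a < 4" for a using bij_betwE[OF \<pi>(1)] that by simp
  have nz: "\<pi> 1 \<noteq> 0" "\<pi> 2 \<noteq> 0" "\<pi> 3 \<noteq> 0" using eq[of 1 0] eq[of 2 0] eq[of 3 0] \<pi>(2) by simp_all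
  have "\<pi> 1 \<noteq> \<pi> 2" "\<pi> 1 \<noteq> \<pi> 3" "\<pi> 2 \<noteq> \<pi> 3" "\<pi> 1 < 4" "\<pi> 2 < 4" "\<pi> 3 < 4"
    using eq[of 1 2] eq[of 1 3] eq[of 2 3] lt by simp_all
  moreover have "a = 1 \<or> a = 2 \<or> a = 3" if "a < 4" "a \<noteq> 0" for a :: nat using that by linarith
  ultimately have "(\<pi> 1, \<pi> 2, \<pi> 3) \<in> {(1, 2, 3), (1, 3, 2), (2, 1, 3), (2, 3, 1), (3, 1, 2), (3, 2, 1)}"
    using nz by (metis insertCI)
  moreover have S: "(\<Sum>x\<in>I. c * t x mod 4) = 4 * i (\<pi> c)" if "c < 4" "\<pi> c \<noteq> 0" for c
    using \<pi>(3)[OF that(1)] ht[OF lt[OF that(1)] that(2)] by simp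
  have "(\<Sum>x\<in>I. 1 * t x mod 4) = 4 * i (\<pi> 1)" "(\<Sum>x\<in>I. 2 * t x mod 4) = 4 * i (\<pi> 2)"
    "(\<Sum>x\<in>I. 3 * t x mod 4) = 4 * i (\<pi> 3)"
    using S[of 1] S[of 2] S[of 3] nz by simp_all
  ultimately show thesis using that[OF coords pos] by blast
qed

text \<open>The heights \<open>h1 \<le> h3\<close> of a generator and its inverse add up to
  \<open>d + 1\<close>, and the element of order 2 has the remaining height. It is left to decide
  which exponents these are.\<close>

lemma equivalent_F4_cyclic:
  fixes \<beta> :: "nat \<Rightarrow> 'a \<Rightarrow> real" and i :: "nat \<Rightarrow> nat"
  assumes \<beta>: "bij_betw \<beta> {..<4} box" "\<beta> 0 = (\<lambda>_. 0)"
    and ht: "\<And>c. c < 4 \<Longrightarrow> c \<noteq> 0 \<Longrightarrow> height (\<beta> c) = i c"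
    and nonpyr: "\<not> lattice_pyramid d (convex hull (v ` I))"
    and b: "b \<in> box" and p: "p \<in> I" "2 * b p \<notin> \<int>"
    and i: "1 \<le> i 1" "i 1 \<le> i 2" "i 2 \<le> i 3" "i 1 + i 3 \<le> d + 1" "i 2 \<le> (d + 1) div 2"
  shows "\<exists>F. occurs F 4 d i \<and> unimodularly_equivalent d (convex hull (v ` I)) d (convex hull (vertices F d i))"
proof -
  \<comment> \<open>From here on the variable \<open>b\<close> is an exponent index, no longer the
    box element; \<open>i b\<close> is the height of the element of order 2.\<close>
  obtain t a b c where coords: "coord_lattice = char_lattice I 4 (cyc 4) t"
    and pos: "\<And>x. x \<in> I \<Longrightarrow> 0 < t x \<and> t x < 4"
    and H: "(\<Sum>x\<in>I. 1 * t x mod 4) = 4 * i a" "(\<Sum>x\<in>I. 2 * t x mod 4) = 4 * i b"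
      "(\<Sum>x\<in>I. 3 * t x mod 4) = 4 * i c"
    and abc: "(a, b, c) \<in> {(1, 2, 3), (1, 3, 2), (2, 1, 3), (2, 3, 1), (3, 1, 2), (3, 2, 1)}"
    using cyclic_heights[OF \<beta> ht nonpyr b p] by metis
  have i_pos: "1 \<le> i a" "1 \<le> i b" "1 \<le> i c" using abc i(1-3) by auto
  obtain h1 h3 where h: "h1 = i a \<and> h3 = i c \<or> h1 = i c \<and> h3 = i a" "h1 \<le> h3" and dim: "d + 1 = h1 + h3"
    and q: "2 * i b \<le> h1 + h3"
      "unimodularly_equivalent d (convex hull (v ` I)) d (convex hull (quarter_vertices d h1 (i b) h3))"
  proof (cases "i a \<le> i c")
    case True
    note e = equivalent_to_quarter[OF lattice_simplex_axioms coords pos H True i_pos(1,2)]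
    show thesis using that[OF _ True e] by blast
  next
    case False
    \<comment> \<open>Replacing the generator of the cyclic group by its inverse exchanges the two outer heights.\<close>
    let ?s = "\<lambda>x. 3 * t x mod 4"
    have t123: "t x = 1 \<or> t x = 2 \<or> t x = 3" if "x \<in> I" for x using pos[OF that] by linarith
    have coords': "coord_lattice = char_lattice I 4 (cyc 4) ?s"
      unfolding coords by (rule char_lattice_cyc_mult[of 4 3 3, symmetric]) simp_all
    have s: "0 < ?s x \<and> ?s x < 4" if "x \<in> I" for x using t123[OF that] by auto
    have s123: "1 * ?s x mod 4 = 3 * t x mod 4" "2 * ?s x mod 4 = 2 * t x mod 4" "3 * ?s x mod 4 = 1 * t x mod 4"
      if "x \<in> I" for x using t123[OF that] by auto
    have H': "(\<Sum>x\<in>I. 1 * ?s x mod 4) = 4 * i c" "(\<Sum>x\<in>I. 2 * ?s x mod 4) = 4 * i b"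
      "(\<Sum>x\<in>I. 3 * ?s x mod 4) = 4 * i a"
      unfolding H[symmetric] by (rule sum.cong[OF refl], erule s123)+
    have le: "i c \<le> i a" using False by simp
    note e = equivalent_to_quarter[OF lattice_simplex_axioms coords' s H' le i_pos(3,2)]
    show thesis using that[OF _ le e] by blast
  qed
  \<comment> \<open>If the outer heights were \<open>i 1\<close> and \<open>i 2\<close>, then
    \<open>i 1 + i 3 \<le> d + 1\<close> and \<open>2 * i 2 \<le> d + 1\<close> would make all three
    exponents equal. If they are \<open>i 1\<close> and \<open>i 3\<close>, a tie with
    \<open>i 2\<close> leads, by the same bound on \<open>i 2\<close>, to \<open>i 1 = i 2\<close>.
    Ties thus fall under the first alternative, and the second one is strict.\<close>
  have "i b = i 1 \<and> h1 = i 2 \<and> h3 = i 3 \<or>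
      i b = i 2 \<and> h1 = i 1 \<and> h3 = i 3 \<and> i 1 < i 2 \<and> i 2 < i 3"
  proof -
    have "(a = 1 \<and> b = 2 \<and> c = 3) \<or> (a = 1 \<and> b = 3 \<and> c = 2) \<or> (a = 2 \<and> b = 1 \<and> c = 3) \<or>
        (a = 2 \<and> b = 3 \<and> c = 1) \<or> (a = 3 \<and> b = 1 \<and> c = 2) \<or> (a = 3 \<and> b = 2 \<and> c = 1)"
      using abc by simp
    moreover have "2 * i 2 \<le> d + 1" using i(5) by linarith
    ultimately show ?thesis using h(2) dim i(1-4)
      by (elim disjE conjE) (use h(1) in \<open>simp_all, linarith+\<close>)
  qed
  then show ?thesis
  proof
    assume A: "i b = i 1 \<and> h1 = i 2 \<and> h3 = i 3"
    have "vertices F4_2 d i = quarter_vertices d (i 2) (i 1) (i 3)"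
      by (simp only: vertices.simps quarter_vertices_def)
    then have "unimodularly_equivalent d (convex hull (v ` I)) d (convex hull (vertices F4_2 d i))"
      using q(2) A by (simp only:)
    moreover have "occurs F4_2 4 d i" using dim A by simp
    ultimately show ?thesis by blast
  next
    assume A: "i b = i 2 \<and> h1 = i 1 \<and> h3 = i 3 \<and> i 1 < i 2 \<and> i 2 < i 3"
    have "vertices F4_1 d i = quarter_vertices d (i 1) (i 2) (i 3)"
      by (simp only: vertices.simps quarter_vertices_def)
    then have "unimodularly_equivalent d (convex hull (v ` I)) d (convex hull (vertices F4_1 d i))"
      using q(2) A by (simp only:)
    moreover have "occurs F4_1 4 d i" using dim q(1) A by simp
    ultimately show ?thesis by blast
  qed
qed

end

section \<open>Case distinction by the order and exponent of the box group\<close>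

lemma family_exists:
  assumes d: "d \<ge> 1" and V: "V \<in> {2, 3, 4}"
    and i1: "\<forall>j\<in>{1..V - 1}. 1 \<le> i j \<and> i j \<le> d" and mono: "mono_on {1..V - 1} i"
    and V3: "V = 3 \<longrightarrow> 2 * i 1 \<ge> i 2 \<and> i 2 \<le> (d + 1) div 2"
    and V4: "V = 4 \<longrightarrow> i 3 \<le> i 1 + i 2 \<and> i 1 + i 3 \<le> d + 1 \<and> i 2 \<le> (d + 1) div 2"
    and \<Delta>: "nonpyramidal_simplex d (1 + (\<Sum>j = 1..V - 1. monom 1 (i j))) \<Delta>"
  shows "\<exists>F. occurs F V d i \<and> unimodularly_equivalent d \<Delta> d (convex hull (vertices F d i))"
proof -
  let ?g = "\<lambda>c. if c = 0 then 0 else i c"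
  have "lattice_polytope d \<Delta>" "is_simplex d \<Delta>" using \<Delta> by (simp_all add: nonpyramidal_simplex_def)
  then obtain C where C: "lattice_simplex d C (\<lambda>x. x)" "\<Delta> = convex hull C"
    by (rule lattice_simplex_obtain)
  interpret lattice_simplex d C "\<lambda>x. x" by (rule C(1))
  have im: "\<Delta> = convex hull ((\<lambda>x. x) ` C)" using C(2) by simp
  have nonpyr: "\<not> lattice_pyramid d (convex hull ((\<lambda>x. x) ` C))"
    using \<Delta> by (simp only: nonpyramidal_simplex_def im) simp
  have "1 \<le> V" using V by auto
  have "delta d (convex hull ((\<lambda>x. x) ` C)) = (\<Sum>c<V. fps_X ^ ?g c)"
    unfolding im[symmetric] fps_of_poly_exponents[OF \<open>1 \<le> V\<close>, of i, symmetric]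
    using \<Delta> by (simp only: nonpyramidal_simplex_def)
  then obtain \<beta> where \<beta>: "bij_betw \<beta> {..<V} box" and ht: "\<And>c. c < V \<Longrightarrow> height (\<beta> c) = ?g c"
    by (rule box_enumeration) blast
  have "\<beta> 0 \<in> box" using bij_betwE[OF \<beta>] \<open>1 \<le> V\<close> by simp
  \<comment> \<open>The other exponents are positive, and index 0 carries the height 0, which only
    the zero element has.\<close>
  then have \<beta>0: "\<beta> 0 = (\<lambda>_. 0)" using ht[of 0] height_eq_0_iff \<open>1 \<le> V\<close> by simp
  consider "V = 2" | "V = 3" | "V = 4" using V by auto
  then show ?thesis
  proof cases
    case 1
    have "height (\<beta> 1) = i 1" using ht[of 1] 1 by simp
    note e = equivalent_F2[where i = i, OF \<beta>[unfolded 1] \<beta>0 this nonpyr d]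
    show ?thesis unfolding im using e 1 by (intro exI[of _ F2]) simp
  next
    case 2
    have "i 1 \<le> i 2" "i 2 \<le> (d + 1) div 2" "1 \<le> i 1"
      using mono i1 V3 2 by (auto simp: mono_on_def)
    moreover have "height (\<beta> 1) = i 1" "height (\<beta> 2) = i 2" using ht[of 1] ht[of 2] 2 by simp_all
    ultimately have "d + 1 = i 1 + i 2"
      "unimodularly_equivalent d \<Delta> d (convex hull (vertices F3 d i))"
      unfolding im using equivalent_F3[where i = i, OF \<beta>[unfolded 2] \<beta>0 _ _ nonpyr] by blast+
    then show ?thesis using 2 by (intro exI[of _ F3]) simp
  next
    case 3
    have i: "1 \<le> i 1" "i 1 \<le> i 2" "i 2 \<le> i 3"
      using i1 3 mono by (auto simp: mono_on_def)
    have V4': "i 3 \<le> i 1 + i 2" "i 1 + i 3 \<le> d + 1" "i 2 \<le> (d + 1) div 2" using V4 3 by blast+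
    have ht': "height (\<beta> c) = i c" if "c < 4" "c \<noteq> 0" for c using ht[of c] that 3 by simp
    show ?thesis
    \<comment> \<open>A group of order 4 either has exponent 2, hence is the Klein group, or
      contains an element of order 4; the latter shows in a coordinate whose double is not
      integral.\<close>
    proof (cases "\<forall>b\<in>box. \<forall>x\<in>C. 2 * b x \<in> \<int>")
      case True
      have "d + 1 = i 1 + i 2 + i 3" "unimodularly_equivalent d \<Delta> d (convex hull (vertices F4_3 d i))"
        unfolding im
        using equivalent_F4_3[where i = i, OF \<beta>[unfolded 3] \<beta>0 ht' nonpyr True i V4'(1)] by blast+
      then show ?thesis using 3 by (intro exI[of _ F4_3]) simp
    next
      case False
      then obtain b p where "b \<in> box" "p \<in> C" "2 * b p \<notin> \<int>" by blast
      then show ?thesis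
        unfolding im 3
        by (intro equivalent_F4_cyclic[OF \<beta>[unfolded 3] \<beta>0 ht' nonpyr _ _ _ i V4'(2,3)])
    qed
  qed
qed

text \<open>The dimension formulas exclude each other: \<open>i 1 < i 2\<close> separates
  \<open>F4_1\<close> from \<open>F4_2\<close>, and positivity of the exponents separates both from
  \<open>F4_3\<close>. Uniqueness of the family therefore needs no comparison of the listed
  simplices.\<close>

lemma occurs_unique:
  assumes "V \<in> {2, 3, 4}" "\<forall>j\<in>{1..V - 1}. 1 \<le> i j" "occurs F V d i" "occurs F' V d i"
  shows "F = F'"
proof -
  have "V = 4 \<Longrightarrow> 1 \<le> i 1 \<and> 1 \<le> i 2 \<and> 1 \<le> i 3" using assms(2) by auto
  then show ?thesis using assms(3,4) by (cases F; cases F') auto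
qed

theorem theorem1p2:
  fixes d V :: nat and i :: "nat \<Rightarrow> nat"
  assumes "d \<ge> 1"
    and "2 \<le> V" and "V \<le> 4"
    and "\<forall>j\<in>{1..V - 1}. 1 \<le> i j \<and> i j \<le> d"
    and "mono_on {1..V - 1} i"
    and "V = 2 \<longrightarrow> i 1 \<le> (d + 1) div 2"
    and "V = 3 \<longrightarrow> 2 * i 1 \<ge> i 2 \<and> i 2 \<le> (d + 1) div 2"
    and "V = 4 \<longrightarrow> i 3 \<le> i 1 + i 2 \<and> i 1 + i 3 \<le> d + 1 \<and> i 2 \<le> (d + 1) div 2 \<and>
           (2 * i 2 \<le> i 1 + i 3 \<or> i 2 + i 3 \<le> d + 1)"
  shows "(\<forall>\<Delta>. nonpyramidal_simplex d (1 + (\<Sum>j = 1..V - 1. monom 1 (i j))) \<Delta> \<longrightarrow>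
            (\<exists>!F. occurs F V d i \<and> unimodularly_equivalent d \<Delta> d (convex hull (vertices F d i)))) \<and>
         (\<forall>F. occurs F V d i \<longrightarrow> nonpyramidal_simplex d (1 + (\<Sum>j = 1..V - 1. monom 1 (i j)))
              (convex hull (vertices F d i)))"
proof (intro conjI allI impI)
  have V: "V \<in> {2, 3, 4}" using assms(2,3) by auto
  have V4: "V = 4 \<longrightarrow> i 3 \<le> i 1 + i 2 \<and> i 1 + i 3 \<le> d + 1 \<and> i 2 \<le> (d + 1) div 2"
    using assms(8) by blast
  show "\<exists>!F. occurs F V d i \<and> unimodularly_equivalent d \<Delta> d (convex hull (vertices F d i))"
    if \<Delta>: "nonpyramidal_simplex d (1 + (\<Sum>j = 1..V - 1. monom 1 (i j))) \<Delta>" for \<Delta>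
  proof (rule ex_ex1I)
    show "\<exists>F. occurs F V d i \<and> unimodularly_equivalent d \<Delta> d (convex hull (vertices F d i))"
      by (rule family_exists[OF assms(1) V assms(4,5,7) V4 \<Delta>])
    show "F = F'" if "occurs F V d i \<and> unimodularly_equivalent d \<Delta> d (convex hull (vertices F d i))"
      "occurs F' V d i \<and> unimodularly_equivalent d \<Delta> d (convex hull (vertices F' d i))" for F F'
      using that assms(4) by (intro occurs_unique[where d = d and i = i, OF V]) auto
  qed
  show "nonpyramidal_simplex d (1 + (\<Sum>j = 1..V - 1. monom 1 (i j))) (convex hull (vertices F d i))"
    if "occurs F V d i" for F
    by (rule nonpyramidal_family[OF assms(1,4,5,7) V4 that])
qed

end
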